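(* Let $k>0$ be an integer and $t\in\mathbb{C}$. Then $\mathcal{I}^t_{\mathcal{V}_k(\mathfrak{sl}_2)}$ is an ideal of the quantum vertex algebra $W_{\mathcal{V}_k(\mathfrak{sl}_2)}$.
   Context: Let $h$ be a formal parameter; tensor products are $h$-adically completed. Negative powers of expressions $z_1+\dots+z_n$ are expanded in negative powers of the leftmost variable. The algebra $W$: the dual Yangian ${\rm Y}^+(\mathfrak{sl}_2)$ is the $\mathbb{C}[[h]]$-algebra with generators $t_{ij}^{(-r)}$ ($i,j=1,2$, $r\ge1$) and relations $R(u-v)T_1^+(u)T_2^+(v)=T_2^+(v)T_1^+(u)R(u-v)$, $\mathrm{qdet}\,T^+(u)=1$, where $R(u)=1-hPu^{-1}$ ($P$ the permutation operator on $\mathbb{C}^2\otimes\mathbb{C}^2$), $T^+(u)=\sum e_{ij}\otimes t^+_{ij}(u)$, $t_{ij}^+(u)=\delta_{ij}-h\sum_{r\ge1}t_{ij}^{(-r)}u^{r-1}$, $\mathrm{qdet}\,T^+(u)=t^+_{11}(u)t^+_{22}(u-h)-t^+_{21}(u)t^+_{12}(u-h)$ (relations read with common powers of $h$ cancelled). Its unit is $\mathbf{1}$. Put $x(-r)=t_{12}^{(-r)}$, $x^+(u)=\sum_{r\ge1}x(-r)u^{r-1}$. $W=W_{\mathcal{V}_k(\mathfrak{sl}_2)}$ is the $h$-adic completion of the unital subalgebra generated by all $x(-r)$, $r\ge1$. The $x(-r)$ commute and, by the Poincaré–Birkhoff–Witt theorem, the ordered monomials in them form a topological basis of $W$; thus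 $W$ is the $h$-adic completion of the polynomial algebra over $\mathbb{C}[[h]]$ in the variables $x(-1),x(-2),\ldots$. Quantum vertex algebra structure on $W$ (for level $c=k$): $W$ is a quantum vertex algebra in the sense of Etingof–Kazhdan (a topologically free $\mathbb{C}[[h]]$-module $V$ with vacuum $\mathbf{1}$, vertex operator map $Y(z):V\otimes V\to V((z))[[h]]$ and braiding $\mathcal S(z):V\otimes V\to V\otimes V\otimes\mathbb{C}((z))[[h]]$ satisfying the vacuum axioms, weak associativity modulo powers of $h$, the shift condition, Yang–Baxter equation, unitarity, $\mathcal S$-locality and hexagon identity) with vacuum $\mathbf{1}$ and, for $u=(u_1,\ldots,u_n)$, $v=(v_1,\ldots,v_m)$, $$Y(x^+_{[n]}(u)\mathbf{1},z)\,x^+_{[m]}(v)\mathbf{1}=p_{nm}(-u|-v|-z)\,g_{nm}(-u|-v|-z)\,g_{nm}(u+h(k+2)|v|z)\,x^+_{[n+m]}(z+u,v)\mathbf{1},$$ $$\mathcal{S}(z)\big(x^+_{[n]}(u)\mathbf{1}\otimes x^+_{[m]}(v)\mathbf{1}\big)=p_{nm}(u|v|z)^2g_{nm}(u|v|z)^2g_{nm}(-u|-v|-z-hk)\,g_{nm}(-u|-v|-z+(k+2)h)\big(x^+_{[n]}(u)\mathbf{1}\otimes x^+_{[m]}(v)\mathbf{1}\big).$$ Here $x^+_{[n]}(u)=x^+(u_1)\cdots x^+(u_n)$, $z+u=(z+u_1,\ldots,z+u_n)$, $u+ha=(u_1+ha,\ldots,u_n+ha)$, $g(u)$ is the unique series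 in $1+\frac hu\mathbb{C}[[h/u]]$ with $g(u+2h)=g(u)(1-h^2u^{-2})$, $g_{nm}(u|v|z)=\prod_{i,j}g(z+u_i-v_j)$, $p_{nm}(u|v|z)=\prod_{i,j}\big(1-\frac{h}{z+u_i-v_j}\big)$ (product over $1\le i\le n$, $1\le j\le m$), everything being expanded in negative powers of $z$. Ideals: for a subset $I$ of a quantum vertex algebra $V$ put $[I]=\{v\in V: h^nv\in I\text{ for some }n\ge0\}$. A topologically free $\mathbb{C}[[h]]$-submodule $I\subseteq V$ is an ideal if $I=[I]$, $Y(z)(V\otimes I)$ and $Y(z)(I\otimes V)$ are contained in $I((z))[[h]]$, $\mathcal S(z)(V\otimes I)\subseteq V\otimes I((z))[[h]]$ and $\mathcal S(z)(I\otimes V)\subseteq I\otimes V((z))[[h]]$. The submodule $\mathcal I^t$: let $x^t_{(k+1)}(-p)\in W$, $p\ge k+1$, be defined by $\sum_{p\ge k+1}x^t_{(k+1)}(-p)u^{p-k-1}=x^+(u)x^+(u+th)\cdots x^+(u+kth)$. Let $I^t_{\mathcal{V}_k(\mathfrak{sl}_2)}=\sum_{p\ge k+1}W\,x^t_{(k+1)}(-p)$ (algebra multiplication in $W$), and $\mathcal{I}^t_{\mathcal{V}_k(\mathfrak{sl}_2)}=\big[I^t_{\mathcal{V}_k(\mathfrak{sl}_2)}\cdot\mathbf{1}\big][[h]]$, i.e. the $h$-adic completion (closure in $W$) of $\big[I^t_{\mathcal{V}_k(\mathfrak{sl}_2)}\cdot\mathbf{1}\big]$. *)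

theory Defs
  imports
    "HOL-Library.Poly_Mapping"
    "HOL-Library.Product_Plus"
    "HOL-Computational_Algebra.Formal_Laurent_Series"
    "HOL-Combinatorics.Permutations"
begin

section \<open>Topologically free modules over $\mathbb{C}[[h]]$\<close>

text \<open>
  A topologically free module is $V_0[[h]]$ for a complex vector space $V_0$. Fixing a basis of
  $V_0$ indexed by a type \<open>'a\<close>, its elements are the power series in $h$ with coefficients in
  \<open>'a \<Rightarrow>\<^sub>0 complex\<close>; \<open>fps_nth\<close> extracts the coefficients of the powers of $h$. In the same way
  $V((z))[[h]] = V_0((z))[[h]]$, and the completed tensor product of the modules with bases
  \<open>'a\<close> and \<open>'b\<close> is the module with basis \<open>'a \<times> 'b\<close>.
\<close>

type_synonym 'a hmod = "('a \<Rightarrow>\<^sub>0 complex) fps"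
type_synonym 'a hlaurent = "('a \<Rightarrow>\<^sub>0 complex) fls fps"

definition hscale :: "complex fps \<Rightarrow> 'a hmod \<Rightarrow> 'a hmod" where
  "hscale c v = Abs_fps (\<lambda>N. \<Sum>n\<le>N. Poly_Mapping.map ((*) (fps_nth c n)) (fps_nth v (N - n)))"

text \<open>The $h$-adically convergent sum $\sum_n h^n a_n$.\<close>

definition hsum :: "(nat \<Rightarrow> 'a hmod) \<Rightarrow> 'a hmod" where
  "hsum a = Abs_fps (\<lambda>N. \<Sum>n\<le>N. fps_nth (a n) (N - n))"

definition hclosure :: "'c fps set \<Rightarrow> 'c fps set" where
  "hclosure A = {v. \<forall>N. \<exists>a\<in>A. \<forall>n<N. fps_nth v n = fps_nth a n}"

definition hsat :: "'a hmod set \<Rightarrow> 'a hmod set" where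
  "hsat I = {v. \<exists>n. hscale (fps_X ^ n) v \<in> I}"

definition hsubmodule :: "'a hmod set \<Rightarrow> bool" where
  "hsubmodule I \<longleftrightarrow> 0 \<in> I \<and> (\<forall>v\<in>I. \<forall>w\<in>I. v + w \<in> I) \<and> (\<forall>c. \<forall>v\<in>I. hscale c v \<in> I)"

definition csubspace :: "'a hmod set \<Rightarrow> bool" where
  "csubspace I \<longleftrightarrow>
     0 \<in> I \<and> (\<forall>v\<in>I. \<forall>w\<in>I. v + w \<in> I) \<and> (\<forall>c. \<forall>v\<in>I. hscale (fps_const c) v \<in> I)"

definition topologically_free :: "'a hmod set \<Rightarrow> bool" where
  "topologically_free I \<longleftrightarrow> (\<exists>I0. csubspace I0 \<and> bij_betw hsum {a. \<forall>n. a n \<in> I0} I)"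

definition zcoeff :: "'a hlaurent \<Rightarrow> int \<Rightarrow> 'a hmod" where
  "zcoeff F m = Abs_fps (\<lambda>N. fls_nth (fps_nth F N) m)"

text \<open>$I((z))[[h]]$: the series $\sum_n h^n f_n(z)$ with $f_n(z) \in I((z))$.\<close>

definition laurent_over :: "'a hmod set \<Rightarrow> 'a hlaurent set" where
  "laurent_over I = {F. \<exists>f :: nat \<Rightarrow> int \<Rightarrow> 'a hmod.
     (\<forall>n m. f n m \<in> I) \<and> (\<forall>n. \<exists>M. \<forall>m<M. f n m = 0) \<and> (\<forall>m. zcoeff F m = hsum (\<lambda>n. f n m))}"

definition tensor0 :: "('a \<Rightarrow>\<^sub>0 complex) \<Rightarrow> ('b \<Rightarrow>\<^sub>0 complex) \<Rightarrow> ('a \<times> 'b \<Rightarrow>\<^sub>0 complex)" where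
  "tensor0 p q = (\<Sum>a\<in>Poly_Mapping.keys p. \<Sum>b\<in>Poly_Mapping.keys q.
     Poly_Mapping.single (a, b) (Poly_Mapping.lookup p a * Poly_Mapping.lookup q b))"

definition htensor :: "'a hmod \<Rightarrow> 'b hmod \<Rightarrow> ('a \<times> 'b) hmod" where
  "htensor v w = Abs_fps (\<lambda>N. \<Sum>n\<le>N. tensor0 (fps_nth v n) (fps_nth w (N - n)))"

definition finite_sums :: "'c::comm_monoid_add set \<Rightarrow> 'c set" where
  "finite_sums G = sum_list ` lists G"

text \<open>
  Completed tensor products of submodules, realised inside the tensor product of the ambient
  modules: $A \otimes B$, and $A \otimes L$ for a set $L$ of Laurent series in $z$.
\<close>

definition tensor_sub :: "'a hmod set \<Rightarrow> 'b hmod set \<Rightarrow> ('a \<times> 'b) hmod set" where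
  "tensor_sub A B = hclosure (finite_sums {htensor a b | a b. a \<in> A \<and> b \<in> B})"

definition tensor_laurent :: "'a hmod set \<Rightarrow> 'b hlaurent set \<Rightarrow> ('a \<times> 'b) hlaurent set" where
  "tensor_laurent A L =
     hclosure (finite_sums {F. \<exists>a\<in>A. \<exists>f\<in>L. \<forall>m. zcoeff F m = htensor a (zcoeff f m)})"

text \<open>
  Ideals of a quantum vertex algebra with underlying module $V$ (all of \<open>'a hmod\<close>), vertex operator
  map \<open>Y\<close> and braiding \<open>S\<close>. These are the only data of the algebra which the notion depends on.
\<close>

definition qva_ideal ::
  "(('a \<times> 'a) hmod \<Rightarrow> 'a hlaurent) \<Rightarrow> (('a \<times> 'a) hmod \<Rightarrow> ('a \<times> 'a) hlaurent) \<Rightarrow> 'a hmod set \<Rightarrow> bool"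
  where
  "qva_ideal Y S I \<longleftrightarrow>
     hsubmodule I \<and> topologically_free I \<and> I = hsat I \<and>
     Y ` tensor_sub UNIV I \<subseteq> laurent_over I \<and>
     Y ` tensor_sub I UNIV \<subseteq> laurent_over I \<and>
     S ` tensor_sub UNIV I \<subseteq> tensor_laurent UNIV (laurent_over I) \<and>
     S ` tensor_sub I UNIV \<subseteq> tensor_laurent I (laurent_over UNIV)"

text \<open>The $\mathbb{C}[[h]]$-linear map with prescribed values on the basis.\<close>

definition hlinear_ext :: "('a \<Rightarrow> 'b::comm_monoid_add hlaurent) \<Rightarrow> 'a hmod \<Rightarrow> 'b hlaurent" where
  "hlinear_ext B v = Abs_fps (\<lambda>N. \<Sum>n\<le>N. \<Sum>a\<in>Poly_Mapping.keys (fps_nth v n).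
     fls_const (Poly_Mapping.single 0 (Poly_Mapping.lookup (fps_nth v n) a)) * fps_nth (B a) (N - n))"


section \<open>The scalar series $g$ and $p$\<close>

text \<open>
  With $y = h/u$ a series in $\mathbb{C}[[h/u]]$ is a power series in $y$; the shift
  $u \mapsto u + 2h$ becomes $y \mapsto y/(1+2y)$.
\<close>

definition gser :: "complex fps" where
  "gser = (THE G. fps_nth G 0 = 1 \<and>
     fps_compose G (fps_X / (1 + 2 * fps_X)) = G * (1 - fps_X ^ 2))"

lemma fps_power_nth_1:
  fixes r :: "complex fps"
  assumes "fps_nth r 0 = 1"
  shows "fps_nth (r ^ l) 1 = of_nat l * fps_nth r 1"
proof (induction l)
  case (Suc l)
  have "fps_nth (r ^ l) 0 = 1" using assms by (simp add: fps_nth_power_0)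
  with Suc assms show ?case by (simp add: fps_mult_nth_1 algebra_simps)
qed simp

text \<open>The recursion solved by the coefficients of $g$, used only for existence and uniqueness.\<close>

fun gser_coeff :: "nat \<Rightarrow> complex" where
  "gser_coeff N = (if N = 0 then 1 else
     (gser_coeff (N - 1) + (\<Sum>i<N. gser_coeff i * fps_nth ((fps_X / (1 + 2 * fps_X)) ^ i) (N + 1))) / (2 * of_nat N))"

lemma g_eq_nth:
  fixes G :: "complex fps"
  shows "fps_nth (fps_compose G (fps_X / (1 + 2 * fps_X)) - G * (1 - fps_X ^ 2)) n =
    (if n < 2 then 0 else
       fps_nth G (n - 2) - 2 * of_nat (n - 1) * fps_nth G (n - 1)
       + (\<Sum>i<n - 1. fps_nth G i * fps_nth ((fps_X / (1 + 2 * fps_X)) ^ i) n))"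
proof -
  define r :: "complex fps" where "r = inverse (1 + 2 * fps_X)"
  have r0: "fps_nth r 0 = 1" by (simp add: r_def)
  have rn0: "fps_nth (r ^ i) 0 = 1" for i using r0 by (simp add: fps_nth_power_0)
  have e2: "(2::complex fps) = fps_const 2" by (simp flip: numeral_fps_const)
  have "r * (1 + 2 * fps_X) = 1" unfolding r_def by (rule inverse_mult_eq_1) (simp add: e2)
  then have "fps_nth (r * (1 + 2 * fps_X)) 1 = 0" by simp
  then have r1: "fps_nth r 1 = - 2" using r0 
    by (simp add: fps_mult_nth_1 e2 eq_neg_iff_add_eq_0 add.commute)
  have s: "fps_X / (1 + 2 * fps_X) = fps_X * r"
    unfolding r_def by (rule fps_divide_unit) (simp add: e2)
  have sp: "fps_nth ((fps_X / (1 + 2 * fps_X)) ^ i) m = (if m < i then 0 else fps_nth (r ^ i) (m - i))" for i m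
    unfolding s power_mult_distrib by (simp add: fps_X_power_mult_nth)
  have D: "fps_nth (G * (1 - fps_X ^ 2)) n = fps_nth G n - (if n < 2 then 0 else fps_nth G (n - 2))"
    by (simp add: algebra_simps fps_X_power_mult_right_nth)
  show ?thesis
  proof (cases "n < 2")
    case True
    then have "n = 0 \<or> n = 1" by auto
    then show ?thesis unfolding fps_sub_nth D fps_compose_nth sp
      by (auto simp: r0)
  next
    case False
    then obtain m where n: "n = Suc (Suc m)" by (metis add_2_eq_Suc le_add_diff_inverse not_less)
    have a: "{0..n} = insert n (insert (n-1) {..<n-1})" using n by auto
    have "fps_nth (fps_compose G (fps_X / (1 + 2 * fps_X))) n
       = fps_nth G n - 2 * of_nat (n - 1) * fps_nth G (n - 1)
       + (\<Sum>i<n - 1. fps_nth G i * fps_nth ((fps_X / (1 + 2 * fps_X)) ^ i) n)"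
      unfolding fps_compose_nth a
      using fps_power_nth_1[OF r0, of "n-1"] r0
      by (subst sum.insert, simp, use n in simp, subst sum.insert, simp, simp, 
          simp only: sp) (use n r1 rn0 in \<open>simp add: algebra_simps\<close>)
    then show ?thesis unfolding fps_sub_nth D using False by simp
  qed
qed

lemma gser_ex1:
  "\<exists>!G :: complex fps. fps_nth G 0 = 1 \<and>
     fps_compose G (fps_X / (1 + 2 * fps_X)) = G * (1 - fps_X ^ 2)"
proof -
  have eqv: "fps_nth G 0 = 1 \<and> fps_compose G (fps_X / (1 + 2 * fps_X)) = G * (1 - fps_X ^ 2)
     \<longleftrightarrow> G = Abs_fps gser_coeff" for G :: "complex fps"
  proof -
    have "fps_compose G (fps_X / (1 + 2 * fps_X)) = G * (1 - fps_X ^ 2) \<longleftrightarrow>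
       (\<forall>n. fps_nth (fps_compose G (fps_X / (1 + 2 * fps_X)) - G * (1 - fps_X ^ 2)) n = 0)"
      by (metis (no_types, lifting) eq_iff_diff_eq_0 fps_eq_iff fps_zero_nth)
    also have "\<dots> \<longleftrightarrow> (\<forall>N>0. fps_nth G (N - 1) - 2 * of_nat N * fps_nth G N
       + (\<Sum>i<N. fps_nth G i * fps_nth ((fps_X / (1 + 2 * fps_X)) ^ i) (N + 1)) = 0)"
      (is "_ \<longleftrightarrow> (\<forall>N>0. ?Q N = 0)")
    proof (intro iffI allI impI, goal_cases)
      case (1 N) then show ?case using spec[OF 1(1), of "N+1"] unfolding g_eq_nth by (simp split: if_splits)
    next
      case (2 n) then show ?case using spec[OF 2, of "n-1"] unfolding g_eq_nth 
        by (cases n) (auto simp: numeral_2_eq_2)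
    qed
    also have "\<dots> \<longleftrightarrow> (\<forall>N>0. fps_nth G N = (fps_nth G (N - 1) + (\<Sum>i<N. fps_nth G i * fps_nth ((fps_X / (1 + 2 * fps_X)) ^ i) (N + 1))) / (2 * of_nat N))"
      (is "_ \<longleftrightarrow> (\<forall>N>0. fps_nth G N = ?R N)")
    proof -
      have "?Q N = 0 \<longleftrightarrow> fps_nth G N = ?R N" if "N > 0" for N
        using that by (simp add: field_simps) (auto simp: algebra_simps)
      then show ?thesis by blast
    qed
    finally have *: "fps_compose G (fps_X / (1 + 2 * fps_X)) = G * (1 - fps_X ^ 2) \<longleftrightarrow> (\<forall>N>0. fps_nth G N = ?R N)" .
    show ?thesis
    proof
      assume L: "fps_nth G 0 = 1 \<and> fps_compose G (fps_X / (1 + 2 * fps_X)) = G * (1 - fps_X ^ 2)"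
      have "fps_nth G N = gser_coeff N" for N
      proof (induction N rule: less_induct)
        case (less N)
        show ?case
        proof (cases "N = 0")
          case False
          then have "fps_nth G N = ?R N" using L * by blast
          also have "\<dots> = gser_coeff N" using False less by (subst gser_coeff.simps) (simp del: gser_coeff.simps)
          finally show ?thesis .
        qed (use L in simp)
      qed
      then show "G = Abs_fps gser_coeff" by (simp add: fps_eq_iff del: gser_coeff.simps)
    next
      assume G: "G = Abs_fps gser_coeff"
      have "fps_nth G N = ?R N" if "N > 0" for N
        using that unfolding G by (subst fps_nth_Abs_fps, subst gser_coeff.simps) (simp del: gser_coeff.simps)
      then show "fps_nth G 0 = 1 \<and> fps_compose G (fps_X / (1 + 2 * fps_X)) = G * (1 - fps_X ^ 2)"
        using * by (simp add: G)
    qed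
  qed
  then show ?thesis by auto
qed

declare gser_coeff.simps [simp del]

text \<open>
  $g(\epsilon w + ah)$ and $1 - h/(\epsilon w + ah)$, $\epsilon = \pm 1$, as power series in $y = h/w$;
  note that $h/(\epsilon w + ah) = y/(\epsilon + ay)$.
\<close>

definition g_at :: "complex \<Rightarrow> complex \<Rightarrow> complex fps" where
  "g_at \<epsilon> a = fps_compose gser (fps_X / (fps_const \<epsilon> + fps_const a * fps_X))"

definition p_at :: "complex \<Rightarrow> complex \<Rightarrow> complex fps" where
  "p_at \<epsilon> a = 1 - fps_X / (fps_const \<epsilon> + fps_const a * fps_X)"


section \<open>Generating series\<close>

text \<open>
  Power series in $u_0, u_1, \ldots$ and $v_0, v_1, \ldots$ (the variables \<open>Inl i\<close> and \<open>Inr j\<close>)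
  with coefficients in $V_0((z))[[h]]$, where $V_0$ is an algebra with a basis forming the monoid
  \<open>'b\<close>. Such a series is represented by the sequence of its homogeneous components, the component
  of total degree $c$ in the $u_i, v_j$ being the $c$-th coefficient of the outer \<open>fps\<close>;
  this is compatible with multiplication.
\<close>

type_synonym 'b gseries = "((nat + nat \<Rightarrow>\<^sub>0 nat) \<Rightarrow>\<^sub>0 'b hlaurent) fps"

definition gvar :: "nat + nat \<Rightarrow> ((nat + nat \<Rightarrow>\<^sub>0 nat) \<Rightarrow>\<^sub>0 'b::comm_monoid_add hlaurent)" where
  "gvar x = Poly_Mapping.single (Poly_Mapping.single x 1) 1"

text \<open>
  $\sum_c w^c a_c$ for a linear form $w$ in the variables and $a_c \in V_0((z))[[h]]$.
\<close>

definition gsubst ::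
  "(nat \<Rightarrow> 'b hlaurent) \<Rightarrow> ((nat + nat \<Rightarrow>\<^sub>0 nat) \<Rightarrow>\<^sub>0 'b::comm_monoid_add hlaurent) \<Rightarrow> 'b gseries" where
  "gsubst a w = Abs_fps (\<lambda>c. w ^ c * Poly_Mapping.single 0 (a c))"

text \<open>
  $\varphi(h/(z+u_i-v_j)) = \sum_l \varphi_l h^l (z+u_i-v_j)^{-l}$, where
  $(z+w)^{-l} = \sum_c \binom{-l}{c} w^c z^{-l-c}$.
\<close>

definition geval :: "complex fps \<Rightarrow> nat \<Rightarrow> nat \<Rightarrow> 'b::comm_monoid_add gseries" where
  "geval \<phi> i j = gsubst
     (\<lambda>c. Abs_fps (\<lambda>l. fls_const (Poly_Mapping.single 0 (fps_nth \<phi> l * ((- of_nat l) gchoose c)))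
                         * fls_X_intpow (- int l - int c)))
     (gvar (Inl i) - gvar (Inr j))"

text \<open>$g_{nm}(\epsilon u + ah\,|\,\epsilon v\,|\,\epsilon z)$ and $p_{nm}(\epsilon u + ah\,|\,\epsilon v\,|\,\epsilon z)$.\<close>

definition g_nm :: "complex \<Rightarrow> complex \<Rightarrow> nat \<Rightarrow> nat \<Rightarrow> 'b::comm_monoid_add gseries" where
  "g_nm \<epsilon> a n m = (\<Prod>i<n. \<Prod>j<m. geval (g_at \<epsilon> a) i j)"

definition p_nm :: "complex \<Rightarrow> complex \<Rightarrow> nat \<Rightarrow> nat \<Rightarrow> 'b::comm_monoid_add gseries" where
  "p_nm \<epsilon> a n m = (\<Prod>i<n. \<Prod>j<m. geval (p_at \<epsilon> a) i j)"

text \<open>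
  For $y(u) = \sum_r y_r u^r$ with $y_r \in V_0$: the series $y(w)$ in a variable $w$ and
  $y(z+w) = \sum_c w^c \sum_d \binom{c+d}{c} z^d y_{c+d}$.
\<close>

definition gfield :: "(nat \<Rightarrow> 'b \<Rightarrow>\<^sub>0 complex) \<Rightarrow> nat + nat \<Rightarrow> 'b::comm_monoid_add gseries" where
  "gfield y x = gsubst (\<lambda>c. fps_const (fls_const (y c))) (gvar x)"

definition gfield_shift :: "(nat \<Rightarrow> 'b \<Rightarrow>\<^sub>0 complex) \<Rightarrow> nat + nat \<Rightarrow> 'b::comm_monoid_add gseries" where
  "gfield_shift y x = gsubst
     (\<lambda>c. fps_const (fps_to_fls (Abs_fps (\<lambda>d. of_nat ((c + d) choose c) * y (c + d))))) (gvar x)"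

definition expo :: "nat list \<Rightarrow> nat list \<Rightarrow> (nat + nat \<Rightarrow>\<^sub>0 nat)" where
  "expo rs ss = (\<Sum>i<length rs. Poly_Mapping.single (Inl i) (rs ! i))
              + (\<Sum>j<length ss. Poly_Mapping.single (Inr j) (ss ! j))"

text \<open>The coefficient of $\prod_i u_i^{r_i} \prod_j v_j^{s_j}$.\<close>

definition gcoeff :: "nat list \<Rightarrow> nat list \<Rightarrow> 'b::comm_monoid_add gseries \<Rightarrow> 'b hlaurent" where
  "gcoeff rs ss F = Poly_Mapping.lookup (fps_nth F (sum_list rs + sum_list ss)) (expo rs ss)"


section \<open>The quantum vertex algebra $W$\<close>

text \<open>
  $W$ is the $h$-adic completion $\mathbb{C}[x(-1),x(-2),\ldots][[h]]$ of the polynomial algebra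
  over $\mathbb{C}[[h]]$. The variable with index $r$ is $x(-r-1)$, so that
  $x^+(u) = \sum_{r\ge 0} x_r u^r$. The unit \<open>1\<close> is the vacuum, and the multiplication of
  \<open>fps\<close> is the multiplication of $W$.
\<close>

type_synonym mon = "nat \<Rightarrow>\<^sub>0 nat"
type_synonym W = "mon hmod"

definition xgen :: "nat \<Rightarrow> (mon \<Rightarrow>\<^sub>0 complex)" where
  "xgen r = Poly_Mapping.single (Poly_Mapping.single r 1) 1"

definition xgenL :: "nat \<Rightarrow> (mon \<times> mon \<Rightarrow>\<^sub>0 complex)" where
  "xgenL r = Poly_Mapping.single (Poly_Mapping.single r 1, 0) 1"

definition xgenR :: "nat \<Rightarrow> (mon \<times> mon \<Rightarrow>\<^sub>0 complex)" where
  "xgenR r = Poly_Mapping.single (0, Poly_Mapping.single r 1) 1"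

text \<open>
  The right-hand sides of the formulas for $Y(x^+_{[n]}(u)\mathbf{1},z)\,x^+_{[m]}(v)\mathbf{1}$ and
  $\mathcal{S}(z)(x^+_{[n]}(u)\mathbf{1} \otimes x^+_{[m]}(v)\mathbf{1})$ at level \<open>k\<close>.
\<close>

definition Y_series :: "complex \<Rightarrow> nat \<Rightarrow> nat \<Rightarrow> mon gseries" where
  "Y_series k n m =
     p_nm (-1) 0 n m * g_nm (-1) 0 n m * g_nm 1 (k + 2) n m
     * ((\<Prod>i<n. gfield_shift xgen (Inl i)) * (\<Prod>j<m. gfield xgen (Inr j)))"

definition S_series :: "complex \<Rightarrow> nat \<Rightarrow> nat \<Rightarrow> (mon \<times> mon) gseries" where
  "S_series k n m =
     (p_nm 1 0 n m)\<^sup>2 * (g_nm 1 0 n m)\<^sup>2 * g_nm (-1) (- k) n m * g_nm (-1) (k + 2) n m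
     * ((\<Prod>i<n. gfield xgenL (Inl i)) * (\<Prod>j<m. gfield xgenR (Inr j)))"

text \<open>The indices of the variables occurring in a monomial, in increasing order.\<close>

definition mon_list :: "mon \<Rightarrow> nat list" where
  "mon_list \<alpha> = concat (map (\<lambda>r. replicate (Poly_Mapping.lookup \<alpha> r) r)
     (sorted_list_of_set (Poly_Mapping.keys \<alpha>)))"

text \<open>
  \<open>Y_W\<close> and \<open>S_W\<close> are defined on the monomial basis by the coefficients at the ordered exponents;
  the lemmas \<open>Y_W_formula\<close> and \<open>S_W_formula\<close> below give the formulas for all coefficients.
\<close>

definition Y_W :: "complex \<Rightarrow> (mon \<times> mon) hmod \<Rightarrow> mon hlaurent" where
  "Y_W k = hlinear_ext (\<lambda>(\<alpha>, \<beta>). gcoeff (mon_list \<alpha>) (mon_list \<beta>)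
     (Y_series k (length (mon_list \<alpha>)) (length (mon_list \<beta>))))"

definition S_W :: "complex \<Rightarrow> (mon \<times> mon) hmod \<Rightarrow> (mon \<times> mon) hlaurent" where
  "S_W k = hlinear_ext (\<lambda>(\<alpha>, \<beta>). gcoeff (mon_list \<alpha>) (mon_list \<beta>)
     (S_series k (length (mon_list \<alpha>)) (length (mon_list \<beta>))))"


lemma map_key_mult:
  fixes T :: "'a::monoid_add \<Rightarrow> 'a" and p q :: "'a \<Rightarrow>\<^sub>0 'r::semiring_0"
  assumes bij: "bij T" and add: "\<And>x y. T (x + y) = T x + T y"
  shows "Poly_Mapping.map_key T (p * q) = Poly_Mapping.map_key T p * Poly_Mapping.map_key T q"
proof (rule poly_mapping_eqI)
  fix k
  have inj: "inj T" using bij by (rule bij_is_inj)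
  have mk: "Poly_Mapping.lookup (Poly_Mapping.map_key T p) x = Poly_Mapping.lookup p (T x)"
    for p :: "'a \<Rightarrow>\<^sub>0 'r" and x using inj by (simp add: map_key.rep_eq)
  have inner: "(Sum_any (\<lambda>r. Poly_Mapping.lookup q r when T k = T l + r))
      = (Sum_any (\<lambda>r. Poly_Mapping.lookup q (T r) when k = l + r))" for l
    by (rule Sum_any.reindex_cong[OF bij]) (auto simp: fun_eq_iff when_def simp flip: add dest: injD[OF inj])
  have "Poly_Mapping.lookup (p * q) (T k) = Sum_any (\<lambda>l. Poly_Mapping.lookup p l * Sum_any (\<lambda>r. Poly_Mapping.lookup q r when T k = l + r))"
    by (simp add: lookup_mult)
  also have "\<dots> = Sum_any (\<lambda>l. Poly_Mapping.lookup p (T l) * Sum_any (\<lambda>r. Poly_Mapping.lookup q r when T k = T l + r))"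
    by (rule Sum_any.reindex_cong[OF bij]) (auto simp: fun_eq_iff)
  finally show "Poly_Mapping.lookup (Poly_Mapping.map_key T (p * q)) k
    = Poly_Mapping.lookup (Poly_Mapping.map_key T p * Poly_Mapping.map_key T q) k"
    by (simp add: mk lookup_mult inner)
qed


lemma lookup_map_key:
  "inj T \<Longrightarrow> Poly_Mapping.lookup (Poly_Mapping.map_key T p) x = Poly_Mapping.lookup p (T x)"
  by (simp add: map_key.rep_eq)

text \<open>Renaming the variables of a generating series.\<close>

definition grename :: "(nat + nat \<Rightarrow> nat + nat) \<Rightarrow> 'b::comm_monoid_add gseries \<Rightarrow> 'b gseries" where
  "grename \<sigma> F = Abs_fps (\<lambda>n. Poly_Mapping.map_key (Poly_Mapping.map_key \<sigma>) (fps_nth F n))"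

context
  fixes \<sigma> :: "nat + nat \<Rightarrow> nat + nat"
  assumes bij: "bij \<sigma>"
begin

private abbreviation T :: "(nat + nat \<Rightarrow>\<^sub>0 nat) \<Rightarrow> (nat + nat \<Rightarrow>\<^sub>0 nat)" where
  "T \<equiv> Poly_Mapping.map_key \<sigma>"

private lemma inj: "inj \<sigma>" using bij by (rule bij_is_inj)

private lemma bijT: "bij T"
proof (rule o_bij)
  have i: "inj (inv \<sigma>)" using bij by (simp add: bij_imp_bij_inv bij_is_inj)
  have *: "\<sigma> (inv \<sigma> x) = x" "inv \<sigma> (\<sigma> x) = x" for x using bij 
    by (simp_all add: bij_is_surj surj_f_inv_f inj)
  show "T \<circ> Poly_Mapping.map_key (inv \<sigma>) = id" "Poly_Mapping.map_key (inv \<sigma>) \<circ> T = id"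
    by (auto simp: fun_eq_iff lookup_map_key inj i * intro!: poly_mapping_eqI)
qed

private lemma injT: "inj T" using bijT by (rule bij_is_inj)

private lemma T_add: "T (x + y) = T x + T y"
  by (rule poly_mapping_eqI) (simp add: lookup_map_key inj lookup_add)

private lemma T_zero: "T 0 = 0"
  by (rule poly_mapping_eqI) (simp add: lookup_map_key inj)

private lemma T_single: "T (Poly_Mapping.single (\<sigma> x) c) = Poly_Mapping.single x c"
  using inj by (rule map_key_single)

private lemma R_add: "Poly_Mapping.map_key T (p + q) = Poly_Mapping.map_key T p + Poly_Mapping.map_key T q"
  by (rule poly_mapping_eqI) (simp add: lookup_map_key injT lookup_add)

private lemma R_minus: "Poly_Mapping.map_key T (p - q :: _ \<Rightarrow>\<^sub>0 _::ab_group_add) = Poly_Mapping.map_key T p - Poly_Mapping.map_key T q"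
  by (rule poly_mapping_eqI) (simp add: lookup_map_key injT lookup_minus)

private lemma R_sum: "Poly_Mapping.map_key T (sum f A) = (\<Sum>a\<in>A. Poly_Mapping.map_key T (f a :: _ \<Rightarrow>\<^sub>0 _::comm_monoid_add))"
  by (rule poly_mapping_eqI) (simp add: lookup_map_key injT lookup_sum)

private lemma R_single: "Poly_Mapping.map_key T (Poly_Mapping.single 0 c) = Poly_Mapping.single 0 c"
  using map_key_single[OF injT, of 0 c] by (simp add: T_zero)

private lemma R_mult: "Poly_Mapping.map_key T (p * q) = Poly_Mapping.map_key T p * Poly_Mapping.map_key T q"
  by (rule map_key_mult[OF bijT T_add])

private lemma R_one: "Poly_Mapping.map_key T 1 = (1 :: _ \<Rightarrow>\<^sub>0 _::semiring_1)"
  using R_single[of "1 :: 'b::semiring_1"] by simp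

private lemma R_power: "Poly_Mapping.map_key T (p ^ c) = Poly_Mapping.map_key T (p :: _ \<Rightarrow>\<^sub>0 _::semiring_1) ^ c"
  by (induction c) (simp_all add: R_one R_mult)

private lemma R_gvar: "Poly_Mapping.map_key T (gvar x) = gvar (\<sigma> x)"
  unfolding gvar_def using map_key_single[OF injT, of "Poly_Mapping.single (\<sigma> x) 1"] 
  by (simp add: T_single)

lemma grename_mult: "grename \<sigma> (F * G) = grename \<sigma> F * grename \<sigma> G"
  by (simp add: grename_def fps_eq_iff fps_mult_nth R_sum R_mult)

lemma grename_one: "grename \<sigma> 1 = 1"
  by (simp add: grename_def fps_eq_iff R_one map_key_zero[OF injT])

lemma grename_prod: "grename \<sigma> (prod f A) = (\<Prod>a\<in>A. grename \<sigma> (f a))"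
  by (induction A rule: infinite_finite_induct) (simp_all add: grename_mult grename_one)

lemma grename_power: "grename \<sigma> (F ^ n) = grename \<sigma> F ^ n"
  by (induction n) (simp_all add: grename_mult grename_one)

lemma grename_gsubst: "grename \<sigma> (gsubst a w) = gsubst a (Poly_Mapping.map_key T w)"
  by (simp add: grename_def gsubst_def fps_eq_iff R_mult R_power R_single)

lemma grename_gfield: "grename \<sigma> (gfield y x) = gfield y (\<sigma> x)"
  by (simp add: gfield_def grename_gsubst R_gvar)

lemma grename_gfield_shift: "grename \<sigma> (gfield_shift y x) = gfield_shift y (\<sigma> x)"
  by (simp add: gfield_shift_def grename_gsubst R_gvar)

lemma grename_geval:
  assumes "\<sigma> (Inl i) = Inl i'" "\<sigma> (Inr j) = Inr j'"
  shows "grename \<sigma> (geval \<phi> i j) = geval \<phi> i' j'"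
  by (simp add: geval_def grename_gsubst R_minus R_gvar assms)

lemma lookup_grename: 
  "Poly_Mapping.lookup (fps_nth (grename \<sigma> F) d) e = Poly_Mapping.lookup (fps_nth F d) (T e)"
  by (simp add: grename_def lookup_map_key injT)

end

lemma lookup_expo:
  "Poly_Mapping.lookup (expo rs ss) (Inl i) = (if i < length rs then rs ! i else 0)"
  "Poly_Mapping.lookup (expo rs ss) (Inr j) = (if j < length ss then ss ! j else 0)"
  by (simp_all add: expo_def lookup_add lookup_sum lookup_single when_def)

context
  fixes \<pi> \<tau> :: "nat \<Rightarrow> nat" and n m :: nat
  assumes p: "\<pi> permutes {..<n}" "\<tau> permutes {..<m}"
begin

private lemma bij: "bij (map_sum \<pi> \<tau>)"
proof (rule o_bij)
  show "map_sum \<pi> \<tau> \<circ> map_sum (inv \<pi>) (inv \<tau>) = id" "map_sum (inv \<pi>) (inv \<tau>) \<circ> map_sum \<pi> \<tau> = id"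
    by (simp_all add: map_sum.comp permutes_inv_o[OF p(1)] permutes_inv_o[OF p(2)] map_sum.id)
qed

private lemmas r = grename_mult[OF bij] grename_prod[OF bij] grename_power[OF bij]
  grename_gfield[OF bij] grename_gfield_shift[OF bij] 

private lemma prod2: "(\<Prod>i<n. \<Prod>j<m. f (\<pi> i) (\<tau> j)) = (\<Prod>i<n. \<Prod>j<m. f i j)"
  using prod.permute[OF p(1), of "\<lambda>i. \<Prod>j<m. f i j"] prod.permute[OF p(2), of "f (\<pi> i)" for i]
  by (simp add: comp_def)

private lemma prod1: "(\<Prod>i<n. f (\<pi> i)) = (\<Prod>i<n. f i)" "(\<Prod>j<m. f (\<tau> j)) = (\<Prod>j<m. f j)"
  using prod.permute[OF p(1), of f] prod.permute[OF p(2), of f] by (simp_all add: comp_def)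

private lemma g_inv: "grename (map_sum \<pi> \<tau>) (g_nm \<epsilon> a n m) = g_nm \<epsilon> a n m"
  using prod2[of "geval (g_at \<epsilon> a)"]
  by (simp add: g_nm_def r grename_geval[OF bij, of i "\<pi> i" j "\<tau> j" for i j])

private lemma p_inv: "grename (map_sum \<pi> \<tau>) (p_nm \<epsilon> a n m) = p_nm \<epsilon> a n m"
  using prod2[of "geval (p_at \<epsilon> a)"]
  by (simp add: p_nm_def r grename_geval[OF bij, of i "\<pi> i" j "\<tau> j" for i j])

lemma grename_Y_series: "grename (map_sum \<pi> \<tau>) (Y_series k n m) = Y_series k n m"
  using prod1(1)[of "\<lambda>i. gfield_shift xgen (Inl i)"] prod1(2)[of "\<lambda>i. gfield xgen (Inr i)"]
  by (simp add: Y_series_def r p_inv g_inv)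

lemma grename_S_series: "grename (map_sum \<pi> \<tau>) (S_series k n m) = S_series k n m"
  using prod1(1)[of "\<lambda>i. gfield xgenL (Inl i)"] prod1(2)[of "\<lambda>i. gfield xgenR (Inr i)"]
  by (simp add: S_series_def r p_inv g_inv)

lemma gcoeff_permute:
  assumes l: "length rs = n" "length ss = m" and F: "grename (map_sum \<pi> \<tau>) F = F"
  shows "gcoeff (permute_list \<pi> rs) (permute_list \<tau> ss) F = gcoeff rs ss F"
proof -
  have e: "expo (permute_list \<pi> rs) (permute_list \<tau> ss) = Poly_Mapping.map_key (map_sum \<pi> \<tau>) (expo rs ss)"
    (is "?l = ?r")
  proof (rule poly_mapping_eqI)
    fix x
    have "i < n \<longleftrightarrow> \<pi> i < n" "i < m \<longleftrightarrow> \<tau> i < m" for i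
      using permutes_in_image[OF p(1), of i] permutes_in_image[OF p(2), of i] by auto
    then show "Poly_Mapping.lookup ?l x = Poly_Mapping.lookup ?r x"
      using p l by (cases x) (auto simp: lookup_map_key bij_is_inj[OF bij] lookup_expo permute_list_nth)
  qed
  have "sum_list (permute_list \<pi> rs) = sum_list rs" "sum_list (permute_list \<tau> ss) = sum_list ss"
    using p l by (metis mset_permute_list sum_mset_sum_list)+
  then show ?thesis unfolding gcoeff_def e lookup_grename[OF bij, symmetric] F by simp
qed

end

lemma gcoeff_mset_cong:
  assumes "mset rs = mset rs'" "mset ss = mset ss'"
    "\<And>\<pi> \<tau>. \<pi> permutes {..<length rs} \<Longrightarrow> \<tau> permutes {..<length ss} \<Longrightarrow> grename (map_sum \<pi> \<tau>) F = F"
  shows "gcoeff rs ss F = gcoeff rs' ss' F"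
proof -
  obtain \<pi> where pi: "\<pi> permutes {..<length rs}" "permute_list \<pi> rs = rs'"
    using mset_eq_permutation[OF assms(1)[symmetric]] by metis
  obtain \<tau> where tau: "\<tau> permutes {..<length ss}" "permute_list \<tau> ss = ss'"
    using mset_eq_permutation[OF assms(2)[symmetric]] by metis
  show ?thesis using gcoeff_permute[OF pi(1) tau(1) refl refl assms(3)[OF pi(1) tau(1)]] pi tau by simp
qed

definition mon_of :: "nat list \<Rightarrow> mon" where
  "mon_of rs = (\<Sum>r\<leftarrow>rs. Poly_Mapping.single r 1)"

lemma count_mon_list: "count (mset (mon_list \<alpha>)) x = Poly_Mapping.lookup \<alpha> x"
proof -
  have "count (mset (concat (map (\<lambda>r. replicate (Poly_Mapping.lookup \<alpha> r) r) xs))) x =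
    (if x \<in> set xs then Poly_Mapping.lookup \<alpha> x else 0)" if "distinct xs" for xs
    using that by (induction xs) auto
  then show ?thesis by (auto simp: mon_list_def in_keys_iff)
qed

lemma mset_mon_list: "mset (mon_list (mon_of rs)) = mset rs"
proof (rule multiset_eqI)
  fix x
  have "Poly_Mapping.lookup (mon_of rs) x = count (mset rs) x"
    by (induction rs) (auto simp: mon_of_def lookup_add lookup_single when_def)
  then show "count (mset (mon_list (mon_of rs))) x = count (mset rs) x"
    by (simp add: count_mon_list)
qed

text \<open>$x(-r_1-1)\cdots x(-r_n-1)\mathbf{1}$\<close>

definition xmon :: "nat list \<Rightarrow> W" where
  "xmon rs = (\<Prod>r\<leftarrow>rs. fps_const (xgen r))"

lemma xmon_eq: "xmon rs = fps_const (Poly_Mapping.single (mon_of rs) 1)"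
  by (induction rs) (simp_all add: xmon_def mon_of_def xgen_def mult_single fps_const_mult)

lemma htensor_xmon: "htensor (xmon rs) (xmon ss) = fps_const (Poly_Mapping.single (mon_of rs, mon_of ss) 1)"
proof -
  have "(\<Sum>n\<le>N. tensor0 (fps_nth (xmon rs) n) (fps_nth (xmon ss) (N - n)))
     = (if N = 0 then Poly_Mapping.single (mon_of rs, mon_of ss) 1 else 0)" for N
  proof -
    have "(\<Sum>n\<le>N. tensor0 (fps_nth (xmon rs) n) (fps_nth (xmon ss) (N - n)))
      = (\<Sum>n\<in>{0}. tensor0 (fps_nth (xmon rs) n) (fps_nth (xmon ss) (N - n)))"
      by (rule sum.mono_neutral_right) (auto simp: xmon_eq tensor0_def)
    then show ?thesis by (simp add: xmon_eq tensor0_def)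
  qed
  then show ?thesis by (simp add: htensor_def fps_eq_iff)
qed

lemma hlinear_ext_basis: "hlinear_ext B (fps_const (Poly_Mapping.single a 1)) = B a"
proof -
  have "(\<Sum>n\<le>N. \<Sum>b\<in>Poly_Mapping.keys (fps_nth (fps_const (Poly_Mapping.single a (1::complex))) n).
     fls_const (Poly_Mapping.single 0 (Poly_Mapping.lookup (fps_nth (fps_const (Poly_Mapping.single a (1::complex))) n) b)) * fps_nth (B b) (N - n))
     = fps_nth (B a) N" for N
    by (subst sum.mono_neutral_right[of _ "{0}"]) auto
  then show ?thesis by (simp add: hlinear_ext_def fps_eq_iff)
qed

lemma Y_W_formula:
  "Y_W k (htensor (xmon rs) (xmon ss)) = gcoeff rs ss (Y_series k (length rs) (length ss))"
  using arg_cong[OF mset_mon_list[of rs], of size] arg_cong[OF mset_mon_list[of ss], of size]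
  by (simp add: Y_W_def htensor_xmon hlinear_ext_basis)
    (rule gcoeff_mset_cong; simp add: mset_mon_list grename_Y_series)

lemma S_W_formula:
  "S_W k (htensor (xmon rs) (xmon ss)) = gcoeff rs ss (S_series k (length rs) (length ss))"
  using arg_cong[OF mset_mon_list[of rs], of size] arg_cong[OF mset_mon_list[of ss], of size]
  by (simp add: S_W_def htensor_xmon hlinear_ext_basis)
    (rule gcoeff_mset_cong; simp add: mset_mon_list grename_S_series)


section \<open>The submodule $\mathcal{I}^t$\<close>

text \<open>$x^+(u+ah) \in W[[u]]$, the outer \<open>fps\<close> being in $u$ and the inner one in $h$.\<close>

definition xplus_shift :: "complex \<Rightarrow> W fps" where
  "xplus_shift a = Abs_fps (\<lambda>c. Abs_fps (\<lambda>d.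
     Poly_Mapping.single 0 (of_nat ((c + d) choose c) * a ^ d) * xgen (c + d)))"

text \<open>\<open>xt k t q\<close> is $x^t_{(k+1)}(-p)$ for $p = q + k + 1$.\<close>

definition xt :: "nat \<Rightarrow> complex \<Rightarrow> nat \<Rightarrow> W" where
  "xt k t q = fps_nth (\<Prod>j\<le>k. xplus_shift (of_nat j * t)) q"

definition I_alg :: "nat \<Rightarrow> complex \<Rightarrow> W set" where
  "I_alg k t = finite_sums {w * xt k t q | w q. True}"

text \<open>$I^t \cdot \mathbf{1} = I^t$, as the vacuum is the unit of the algebra $W$.\<close>

definition I_cal :: "nat \<Rightarrow> complex \<Rightarrow> W set" where
  "I_cal k t = hclosure (hsat (I_alg k t))"

end

theory Submission
  imports Defs
begin

text \<open>
  Put $X(w) = x^+(w)\,x^+(w+th) \cdots x^+(w+kth)$, the series whose coefficients generate the ideal.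
  The images under $Y$ and $\mathcal{S}$ of the monomials in the $x(-r)$ are the coefficients of
  $K(u,v) \prod_i x^+(z+u_i) \prod_j x^+(v_j)$, respectively of
  $K(u,v) \prod_i x^+(u_i) \otimes \prod_j x^+(v_j)$, where $K$ is a series in $u, v$ over
  $\mathbb{C}((z))[[h]]$. Specialise $k+1$ of the variables $v_j$ to
  $w, w+th, \ldots, w+kth$. On the left-hand side this produces the images of the coefficients of
  a monomial times $X(w)$; on the right-hand side it produces the specialised $K$ and the
  remaining fields, times $X(w)$, for any $K$. Specialising $k+1$ of the variables $u_i$ of $Y$
  gives $X(z+w)$ in place of $X(w)$, and its coefficients are multiples of those of $X(w)$ by Taylor
  expansion. So the coefficients on the right-hand side are $h$-adically convergent sums of multiples
  of elements of the ideal.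

  The specialisation $v = w + ah$ is \<open>subst_shift\<close>, for which
  \<open>subst_shift_convolution\<close> expresses that it is multiplicative; this rests on the
  Vandermonde identity. Iterating it gives \<open>multi_subst_shift\<close>, and the two sides of the
  comparison above are \<open>h_linear_mult_xplus_shift_product\<close> and
  \<open>multi_subst_shift_field_product\<close>. They combine to \<open>h_linear_mult_xt_mem\<close>.

  Everything else reduces the theorem to this computation. The submodule \<open>I_cal k t\<close> is an ideal of
  the algebra $W$ which is $h$-adically closed and contains $v$ whenever it contains $hv$
  (\<open>closed_ideal\<close>). Since $Y$ and $\mathcal{S}$ are linear over $\mathbb{C}[[h]]$, hence
  continuous, their values on the generators determine where they map the whole submodule
  (\<open>h_linear_I_cal_induct\<close>), provided that the target has the same closure properties. For $Y$ the
  target consists of the series with all coefficients in \<open>I_cal k t\<close>; it equals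
  $I((z))[[h]]$ because $I \to I/hI$ has a linear section, which also proves that $I$ is
  topologically free. For $\mathcal{S}$ one uses the closed ideal of $W \otimes W$ generated by the image of
  \<open>I_cal k t\<close> in one of the factors. All slices of its elements lie in \<open>I_cal k t\<close>, and
  as the coefficients of the powers of $h$ in the values of $\mathcal{S}$ are Laurent polynomials in $z$,
  these values are limits of finite sums of pure tensors.
\<close>


section \<open>Ideals closed under limits and division by $h$\<close>

text \<open>
  In $R[[h]]$ these are the ideals for which membership can be tested modulo all powers of $h$ and
  after multiplication by a power of $h$.
\<close>

locale closed_ideal =
  fixes J :: "'r::comm_ring_1 fps set"
  assumes zero: "0 \<in> J"
    and add: "v \<in> J \<Longrightarrow> w \<in> J \<Longrightarrow> v + w \<in> J"
    and mult: "v \<in> J \<Longrightarrow> r * v \<in> J"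
    and limit: "(\<And>N. \<exists>a\<in>J. \<forall>n<N. fps_nth v n = fps_nth a n) \<Longrightarrow> v \<in> J"
    and divide_X: "fps_X * v \<in> J \<Longrightarrow> v \<in> J"
begin

lemma diff: "v \<in> J \<Longrightarrow> w \<in> J \<Longrightarrow> v - w \<in> J"
  using add[of v "- w"] mult[of w "- 1"] by simp

lemma sum: "(\<And>i. i \<in> A \<Longrightarrow> f i \<in> J) \<Longrightarrow> sum f A \<in> J"
  by (induction A rule: infinite_finite_induct) (auto simp: zero add)

lemma divide_X_power: "fps_X ^ n * v \<in> J \<Longrightarrow> v \<in> J"
  by (induction n) (auto simp: mult.assoc dest: divide_X)

end

lemma fps_eq_X_power_mult:
  fixes v :: "'r::comm_ring_1 fps"
  assumes "\<And>i. i < n \<Longrightarrow> fps_nth v i = 0"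
  shows "v = fps_X ^ n * fps_shift n v"
  using assms by (auto simp: fps_eq_iff fps_X_power_mult_nth)

text \<open>
  Closing a saturated ideal keeps it saturated: if $hv$ agrees with $a$ modulo $h^{N+1}$, then $a$ has no
  constant term, so $a = hb$, and $v$ agrees with $b$ modulo $h^N$.
\<close>

lemma closed_ideal_hclosure_saturation:
  fixes I :: "'r::comm_ring_1 fps set"
  assumes z: "0 \<in> I" and a: "\<And>v w. v \<in> I \<Longrightarrow> w \<in> I \<Longrightarrow> v + w \<in> I" and m: "\<And>r v. v \<in> I \<Longrightarrow> r * v \<in> I"
  shows "closed_ideal (hclosure {v. \<exists>n. fps_X ^ n * v \<in> I})"
proof -
  define S where "S = {v. \<exists>n. fps_X ^ n * v \<in> I}"
  have SI: "\<exists>n. fps_X ^ n * v \<in> I" if "v \<in> S" for v using that by (simp add: S_def)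
  have Sm: "r * v \<in> S" if v: "v \<in> S" for r v
  proof -
    obtain n where "fps_X ^ n * v \<in> I" using SI[OF v] ..
    then show ?thesis using m[of "fps_X ^ n * v" r] by (auto simp: S_def mult.left_commute)
  qed
  have Sa: "v + w \<in> S" if vw: "v \<in> S" "w \<in> S" for v w
  proof -
    obtain n l where nl: "fps_X ^ n * v \<in> I" "fps_X ^ l * w \<in> I" using SI vw by meson
    have "fps_X ^ l * (fps_X ^ n * v) + fps_X ^ n * (fps_X ^ l * w) \<in> I" by (rule a[OF m[OF nl(1)] m[OF nl(2)]])
    then have "fps_X ^ (n + l) * (v + w) \<in> I" by (simp add: power_add algebra_simps)
    then show ?thesis by (auto simp: S_def)
  qed
  have Sd: "v \<in> S" if Xv: "fps_X * v \<in> S" for v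
  proof -
    obtain n where "fps_X ^ n * (fps_X * v) \<in> I" using SI[OF Xv] ..
    then have "fps_X ^ Suc n * v \<in> I" by (simp add: mult_ac)
    then show ?thesis unfolding S_def by blast
  qed
  have "closed_ideal (hclosure S)"
  proof
    have "0 \<in> S" using z by (simp add: S_def)
    then show "0 \<in> hclosure S" unfolding hclosure_def by blast
  next
    fix v w :: "'r fps" assume v: "v \<in> hclosure S" and w: "w \<in> hclosure S"
    show "v + w \<in> hclosure S" unfolding hclosure_def mem_Collect_eq
    proof
      fix N
      obtain a b where "a \<in> S" "b \<in> S" "\<forall>n<N. fps_nth v n = fps_nth a n" "\<forall>n<N. fps_nth w n = fps_nth b n"
        using v w unfolding hclosure_def mem_Collect_eq by meson
      then show "\<exists>a\<in>S. \<forall>n<N. fps_nth (v + w) n = fps_nth a n" by (intro bexI[of _ "a + b"]) (auto simp: Sa)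
    qed
  next
    fix v r :: "'r fps" assume v: "v \<in> hclosure S"
    show "r * v \<in> hclosure S" unfolding hclosure_def mem_Collect_eq
    proof
      fix N
      obtain a where "a \<in> S" "\<forall>n<N. fps_nth v n = fps_nth a n"
        using v unfolding hclosure_def mem_Collect_eq by meson
      then show "\<exists>a\<in>S. \<forall>n<N. fps_nth (r * v) n = fps_nth a n" 
        by (intro bexI[of _ "r * a"]) (auto simp: Sm fps_mult_nth)
    qed
  next
    fix v :: "'r fps" assume v: "\<And>N. \<exists>a\<in>hclosure S. \<forall>n<N. fps_nth v n = fps_nth a n"
    show "v \<in> hclosure S" unfolding hclosure_def mem_Collect_eq
    proof
      fix N
      obtain a where a: "a \<in> hclosure S" "\<forall>n<N. fps_nth v n = fps_nth a n" using v by blast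
      moreover obtain b where "b \<in> S" "\<forall>n<N. fps_nth a n = fps_nth b n"
        using a(1) unfolding hclosure_def mem_Collect_eq by meson
      ultimately show "\<exists>a\<in>S. \<forall>n<N. fps_nth v n = fps_nth a n" by auto
    qed
  next
    fix v :: "'r fps" assume v: "fps_X * v \<in> hclosure S"
    show "v \<in> hclosure S" unfolding hclosure_def mem_Collect_eq
    proof
      fix N
      obtain a where a: "a \<in> S" "\<forall>n<Suc N. fps_nth (fps_X * v) n = fps_nth a n"
        using v unfolding hclosure_def mem_Collect_eq by meson
      have "fps_nth a 0 = 0" using a(2) by (metis fps_X_mult_nth zero_less_Suc)
      then have e: "a = fps_X * fps_shift 1 a" using fps_eq_X_power_mult[of 1 a] by simp
      have "fps_nth v n = fps_nth (fps_shift 1 a) n" if "n < N" for n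
        using spec[OF a(2), of "Suc n"] that by simp
      then show "\<exists>a\<in>S. \<forall>n<N. fps_nth v n = fps_nth a n" using Sd[of "fps_shift 1 a"] e a(1) by metis
    qed
  qed
  then show ?thesis by (simp add: S_def)
qed

definition h_emb :: "complex fps \<Rightarrow> 'a::comm_monoid_add hmod" where
  "h_emb c = Abs_fps (\<lambda>n. Poly_Mapping.single 0 (fps_nth c n))"

lemma hscale_eq_mult: "hscale c v = h_emb c * (v :: 'a::comm_monoid_add hmod)"
  by (simp add: hscale_def h_emb_def fps_eq_iff fps_mult_nth mult_map_scale_conv_mult atLeast0AtMost)

lemma h_emb_X_power: "h_emb (fps_X ^ n) = fps_X ^ n"
  by (auto simp: h_emb_def fps_eq_iff fps_X_power_nth)

lemma h_emb_const: "h_emb (fps_const c) = fps_const (Poly_Mapping.single 0 c)"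
  by (auto simp: h_emb_def fps_eq_iff)

text \<open>
  For a closed ideal $J$ this is $J((z))[[h]]$; the condition on single coefficients is the easier
  one to verify.
\<close>

definition zlift :: "'a hmod set \<Rightarrow> 'a hlaurent set" where
  "zlift J = {F. \<forall>m. zcoeff F m \<in> J}"

lemma zcoeff_nth: "fps_nth (zcoeff F m) N = fls_nth (fps_nth F N) m"
  by (simp add: zcoeff_def)

lemma fls_mult_nth_bounded:
  fixes f g :: "'r::comm_ring_1 fls"
  assumes f: "\<And>i. i < A \<Longrightarrow> fls_nth f i = 0" and g: "\<And>i. i < B \<Longrightarrow> fls_nth g i = 0"
  shows "fls_nth (f * g) m = (\<Sum>i\<in>{A..m-B}. fls_nth f i * fls_nth g (m - i))"
proof -
  have z: "fls_nth f i * fls_nth g (m - i) = 0" if "i < fls_subdegree f \<or> m - fls_subdegree g < i \<or> i < A \<or> m - B < i" for i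
    using that f[of i] g[of "m - i"] fls_eq0_below_subdegree[of i f] fls_eq0_below_subdegree[of "m - i" g] by auto
  have "fls_nth (f * g) m = (\<Sum>i\<in>{fls_subdegree f..m - fls_subdegree g}. fls_nth f i * fls_nth g (m - i))"
    by (rule fls_times_nth)
  also have "\<dots> = (\<Sum>i\<in>{fls_subdegree f..m - fls_subdegree g} \<union> {A..m-B}. fls_nth f i * fls_nth g (m - i))"
    by (rule sum.mono_neutral_left) (use z in auto)
  also have "\<dots> = (\<Sum>i\<in>{A..m-B}. fls_nth f i * fls_nth g (m - i))"
    by (rule sum.mono_neutral_right) (use z in auto)
  finally show ?thesis .
qed

lemma hlaurent_lower_bound:
  fixes F :: "'r::zero fls fps"
  shows "\<exists>A. \<forall>n\<le>N. \<forall>i<A. fls_nth (fps_nth F n) i = 0"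
proof -
  define A where "A = Min ((\<lambda>n. fls_subdegree (fps_nth F n)) ` {..N})"
  have "A \<le> fls_subdegree (fps_nth F n)" if "n \<le> N" for n
    unfolding A_def by (rule Min_le) (use that in auto)
  then show ?thesis by (metis fls_eq0_below_subdegree order_less_le_trans)
qed

text \<open>
  A coefficient of a product of Laurent series over $R[[h]]$ is an infinite sum, but only finitely many terms
  are nonzero modulo a given power of $h$.
\<close>

lemma zcoeff_mult_approx:
  fixes F G :: "'a::comm_monoid_add hlaurent"
  shows "\<exists>A B. \<forall>n\<le>N. fps_nth (zcoeff (F * G) m) n = fps_nth (\<Sum>i\<in>{A..B}. zcoeff F i * zcoeff G (m - i)) n"
proof -
  obtain A where A: "\<And>n i. n \<le> N \<Longrightarrow> i < A \<Longrightarrow> fls_nth (fps_nth F n) i = 0" 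
    using hlaurent_lower_bound[of N F] by blast
  obtain B where B: "\<And>n i. n \<le> N \<Longrightarrow> i < B \<Longrightarrow> fls_nth (fps_nth G n) i = 0" 
    using hlaurent_lower_bound[of N G] by blast
  have "fps_nth (zcoeff (F * G) m) n = fps_nth (\<Sum>i\<in>{A..m - B}. zcoeff F i * zcoeff G (m - i)) n" if n: "n \<le> N" for n
  proof -
    have "fps_nth (zcoeff (F * G) m) n = (\<Sum>l=0..n. fls_nth (fps_nth F l * fps_nth G (n - l)) m)"
      by (simp add: zcoeff_nth fps_mult_nth fls_nth_sum)
    also have "\<dots> = (\<Sum>l=0..n. \<Sum>i\<in>{A..m - B}. fls_nth (fps_nth F l) i * fls_nth (fps_nth G (n - l)) (m - i))"
      by (intro sum.cong[OF refl] fls_mult_nth_bounded A B) (use n in auto)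
    also have "\<dots> = (\<Sum>i\<in>{A..m - B}. \<Sum>l=0..n. fls_nth (fps_nth F l) i * fls_nth (fps_nth G (n - l)) (m - i))"
      by (rule sum.swap)
    also have "\<dots> = fps_nth (\<Sum>i\<in>{A..m - B}. zcoeff F i * zcoeff G (m - i)) n"
      by (simp add: fps_sum_nth fps_mult_nth zcoeff_nth)
    finally show ?thesis .
  qed
  then show ?thesis by blast
qed

lemma zcoeff_add: "zcoeff (F + G) m = zcoeff F m + zcoeff G m"
  by (simp add: fps_eq_iff zcoeff_nth)

lemma zcoeff_X_mult: "zcoeff (fps_X * F) m = fps_X * zcoeff (F::'a::comm_monoid_add hlaurent) m"
  by (simp add: fps_eq_iff zcoeff_nth)

lemma closed_ideal_zlift:
  fixes J :: "'a::comm_monoid_add hmod set"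
  assumes "closed_ideal J"
  shows "closed_ideal (zlift J)"
proof -
  interpret closed_ideal J by fact
  show ?thesis
  proof
    show "0 \<in> zlift J" using zero by (simp add: zlift_def zcoeff_def fps_zero_def)
  next
    fix v w assume "v \<in> zlift J" "w \<in> zlift J"
    then show "v + w \<in> zlift J" by (simp add: zlift_def zcoeff_add add)
  next
    fix v r assume v: "v \<in> zlift J"
    show "r * v \<in> zlift J" unfolding zlift_def
    proof (intro CollectI allI limit)
      fix m N
      obtain A B where AB: "\<forall>n\<le>N. fps_nth (zcoeff (r * v) m) n = fps_nth (\<Sum>i\<in>{A..B}. zcoeff r i * zcoeff v (m - i)) n"
        using zcoeff_mult_approx by blast
      have "(\<Sum>i\<in>{A..B}. zcoeff r i * zcoeff v (m - i)) \<in> J"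
        by (intro sum mult) (use v in \<open>simp add: zlift_def\<close>)
      then show "\<exists>a\<in>J. \<forall>n<N. fps_nth (zcoeff (r * v) m) n = fps_nth a n"
        using AB by (meson less_imp_le)
    qed
  next
    fix v :: "'a hlaurent" assume v: "\<And>N. \<exists>a\<in>zlift J. \<forall>n<N. fps_nth v n = fps_nth a n"
    show "v \<in> zlift J" unfolding zlift_def
    proof (intro CollectI allI limit)
      fix m N
      obtain a where "a \<in> zlift J" "\<forall>n<N. fps_nth v n = fps_nth a n" using v by blast
      then show "\<exists>a\<in>J. \<forall>n<N. fps_nth (zcoeff v m) n = fps_nth a n"
        by (intro bexI[of _ "zcoeff a m"]) (auto simp: zlift_def zcoeff_nth)
    qed
  next
    fix v assume "fps_X * v \<in> zlift J"
    then show "v \<in> zlift J" by (auto simp: zlift_def zcoeff_X_mult intro: divide_X)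
  qed
qed


section \<open>The ideal $\mathcal{I}^t$ and topological freeness\<close>

lemma finite_sums_0: "0 \<in> finite_sums G"
  unfolding finite_sums_def by (rule image_eqI[of _ _ "[]"]) auto

lemma finite_sums_add: "v \<in> finite_sums G \<Longrightarrow> w \<in> finite_sums G \<Longrightarrow> v + w \<in> finite_sums G"
  unfolding finite_sums_def by (auto simp flip: sum_list_append intro!: imageI)

lemma finite_sums_base: "v \<in> G \<Longrightarrow> v \<in> finite_sums G"
  unfolding finite_sums_def by (rule image_eqI[of _ _ "[v]"]) auto

lemma finite_sums_sum: "(\<And>i. i \<in> A \<Longrightarrow> f i \<in> finite_sums G) \<Longrightarrow> sum f A \<in> finite_sums G"
  by (induction A rule: infinite_finite_induct) (auto simp: finite_sums_0 finite_sums_add)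

lemma finite_sums_induct [consumes 1, case_names zero add]:
  assumes "v \<in> finite_sums G" "P 0" "\<And>v w. v \<in> G \<Longrightarrow> P w \<Longrightarrow> P (v + w)"
  shows "P v"
proof -
  obtain xs where "v = sum_list xs" "set xs \<subseteq> G" using assms(1) by (auto simp: finite_sums_def lists_eq_set)
  then show ?thesis by (induction xs arbitrary: v) (auto intro: assms(2,3))
qed

lemma I_cal_eq: "I_cal k t = hclosure {v. \<exists>n. fps_X ^ n * v \<in> I_alg k t}"
  by (simp add: I_cal_def hsat_def hscale_eq_mult h_emb_X_power)

lemma I_alg_mult: "v \<in> I_alg k t \<Longrightarrow> r * v \<in> I_alg k t"
  unfolding I_alg_def
proof (induction rule: finite_sums_induct)
  case (add v w)
  obtain u q where "v = u * xt k t q" using add(1) by auto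
  then have "r * v = (r * u) * xt k t q" by (simp add: mult.assoc)
  then have "r * v \<in> {w * xt k t q |w q. True}" by blast
  then show ?case unfolding distrib_left by (rule finite_sums_add[OF finite_sums_base add(2)])
qed (simp add: finite_sums_0)

lemma closed_ideal_I_cal: "closed_ideal (I_cal k t)"
  unfolding I_cal_eq
  by (rule closed_ideal_hclosure_saturation) 
    (simp_all add: I_alg_mult, simp_all add: I_alg_def finite_sums_0 finite_sums_add)

lemma subset_hclosure: "A \<subseteq> hclosure A"
  by (auto simp: hclosure_def)

lemma I_alg_subset_I_cal: "I_alg k t \<subseteq> I_cal k t"
proof -
  have "I_alg k t \<subseteq> {v. \<exists>n. fps_X ^ n * v \<in> I_alg k t}" by (auto intro: exI[of _ 0])
  then show ?thesis unfolding I_cal_eq using subset_hclosure by blast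
qed

lemma xt_in_I_cal: "xt k t q \<in> I_cal k t"
proof -
  have "1 * xt k t q \<in> {w * xt k t q |w q. True}" by blast
  then have "xt k t q \<in> I_alg k t" unfolding I_alg_def by (intro finite_sums_base) simp
  then show ?thesis using I_alg_subset_I_cal by blast
qed

lemma hsubmodule_closed_ideal:
  fixes J :: "'a::comm_monoid_add hmod set"
  assumes "closed_ideal J" shows "hsubmodule J"
proof -
  interpret closed_ideal J by fact
  show ?thesis by (simp add: hsubmodule_def zero add mult hscale_eq_mult)
qed

lemma hsat_closed_ideal:
  fixes J :: "'a::comm_monoid_add hmod set"
  assumes "closed_ideal J" shows "J = hsat J"
proof -
  interpret closed_ideal J by fact
  show ?thesis by (auto simp: hsat_def hscale_eq_mult h_emb_X_power mult intro: divide_X_power)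
qed

abbreviation cscale :: "complex \<Rightarrow> ('a::comm_monoid_add \<Rightarrow>\<^sub>0 complex) \<Rightarrow> ('a \<Rightarrow>\<^sub>0 complex)" where
  "cscale c p \<equiv> Poly_Mapping.single 0 c * p"

abbreviation cscale_h :: "complex \<Rightarrow> 'a::comm_monoid_add hmod \<Rightarrow> 'a hmod" where
  "cscale_h c v \<equiv> fps_const (Poly_Mapping.single 0 c) * v"

lemma vector_space_pair_cscale:
  "vector_space_pair (cscale_h :: _ \<Rightarrow> 'a::comm_monoid_add hmod \<Rightarrow> _) (cscale :: _ \<Rightarrow> ('a \<Rightarrow>\<^sub>0 complex) \<Rightarrow> _)"
  by unfold_locales
    (simp_all add: algebra_simps single_add mult_single fps_const_mult flip: fps_const_add mult.assoc)

text \<open>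
  A linear section of the map which takes the constant term in $h$. It embeds $J/hJ$ into $J$, and the image of $J/hJ$
  is a space over which $J$ is topologically free.
\<close>

locale leading_term_section = closed_ideal J
  for J :: "'a::comm_monoid_add hmod set" +
  fixes g :: "('a \<Rightarrow>\<^sub>0 complex) \<Rightarrow> 'a hmod"
  assumes section_mem: "g p \<in> J"
    and section_add: "g (p + q) = g p + g q"
    and section_scale: "g (cscale c p) = cscale_h c (g p)"
    and section_nth_0: "v \<in> J \<Longrightarrow> fps_nth (g (fps_nth v 0)) 0 = fps_nth v 0"

lemma leading_term_section_exists:
  fixes J :: "'a::comm_monoid_add hmod set"
  assumes "closed_ideal J"
  obtains g where "leading_term_section J g"
proof -
  interpret closed_ideal J by fact
  interpret vector_space_pair "cscale_h :: _ \<Rightarrow> 'a hmod \<Rightarrow> _" "cscale :: _ \<Rightarrow> ('a \<Rightarrow>\<^sub>0 complex) \<Rightarrow> _"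
    by (rule vector_space_pair_cscale)
  have l: "Vector_Spaces.linear cscale_h cscale (\<lambda>v::'a hmod. fps_nth v 0)"
    by unfold_locales simp_all
  have "vs1.subspace J" unfolding vs1.subspace_def by (simp add: zero add mult)
  then obtain g where "g ` UNIV \<subseteq> J" and g: "Vector_Spaces.linear cscale cscale_h g" and "\<forall>v\<in>(\<lambda>v. fps_nth v 0) ` J. fps_nth (g v) 0 = v"
    using linear_exists_right_inverse_on[OF l] by blast
  moreover interpret g: Vector_Spaces.linear "cscale :: _ \<Rightarrow> ('a \<Rightarrow>\<^sub>0 complex) \<Rightarrow> _" cscale_h g by (rule g)
  have "g (p + q) = g p + g q" "g (cscale c p) = cscale_h c (g p)" for p q c
    by (rule g.add g.scale)+
  ultimately show ?thesis
    by (intro that[of g] leading_term_section.intro assms leading_term_section_axioms.intro) auto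
qed

text \<open>
  The digits $a_n$ in an expansion $v = \sum_n h^n a_n$, obtained by repeatedly subtracting the
  representative of the constant term and dividing by $h$.
\<close>

primrec hdigits :: "(('a \<Rightarrow>\<^sub>0 complex) \<Rightarrow> 'a hmod) \<Rightarrow> 'a hmod \<Rightarrow> nat \<Rightarrow> 'a hmod" where
  "hdigits g v 0 = g (fps_nth v 0)"
| "hdigits g v (Suc n) = hdigits g (fps_shift 1 (v - g (fps_nth v 0))) n"

lemma hsum_nth_eq_partial_sum:
  fixes a :: "nat \<Rightarrow> 'a::comm_monoid_add hmod"
  assumes "N < M"
  shows "fps_nth (hsum a) N = fps_nth (\<Sum>n<M. fps_X ^ n * a n) N"
proof -
  have "fps_nth (\<Sum>n<M. fps_X ^ n * a n) N = (\<Sum>n<M. if N < n then 0 else fps_nth (a n) (N - n))"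
    by (simp add: fps_sum_nth fps_X_power_mult_nth)
  also have "\<dots> = (\<Sum>n\<le>N. fps_nth (a n) (N - n))"
    by (rule sum.mono_neutral_cong_right) (use assms in auto)
  finally show ?thesis by (simp add: hsum_def)
qed

context leading_term_section
begin

lemma section_0: "g 0 = 0" using section_add[of 0 0] by simp

lemma remainder:
  assumes "v \<in> J"
  shows "v = g (fps_nth v 0) + fps_X * fps_shift 1 (v - g (fps_nth v 0))"
    and "fps_shift 1 (v - g (fps_nth v 0)) \<in> J"
proof -
  \<comment> \<open>The difference has no constant term, and dividing it by $h$ stays in $J$ by saturation.\<close>
  have e: "v - g (fps_nth v 0) = fps_X * fps_shift 1 (v - g (fps_nth v 0))"
    using fps_eq_X_power_mult[of 1 "v - g (fps_nth v 0)"] section_nth_0[OF assms] by simp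
  then show "v = g (fps_nth v 0) + fps_X * fps_shift 1 (v - g (fps_nth v 0))" by (simp add: algebra_simps)
  have "v - g (fps_nth v 0) \<in> J" by (intro diff section_mem assms)
  then show "fps_shift 1 (v - g (fps_nth v 0)) \<in> J" using e divide_X by metis
qed

lemma hdigits_range: "hdigits g v n \<in> range g"
  by (induction n arbitrary: v) auto

lemma hsum_hdigits:
  assumes "v \<in> J"
  shows "hsum (hdigits g v) = v"
proof -
  \<comment> \<open>The first $M$ digits determine $v$ up to a multiple of $h^M$.\<close>
  have "\<exists>r. v = (\<Sum>n<M. fps_X ^ n * hdigits g v n) + fps_X ^ M * r" for M
    using assms
  proof (induction M arbitrary: v)
    case (Suc M)
    define w where "w = fps_shift 1 (v - g (fps_nth v 0))"
    have w: "w \<in> J" "v = g (fps_nth v 0) + fps_X * w" using remainder[OF Suc.prems] by (simp_all add: w_def)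
    obtain r where r: "w = (\<Sum>n<M. fps_X ^ n * hdigits g w n) + fps_X ^ M * r" using Suc.IH[OF w(1)] by blast
    have "(\<Sum>n<Suc M. fps_X ^ n * hdigits g v n) = g (fps_nth v 0) + (\<Sum>n<M. fps_X ^ Suc n * hdigits g w n)"
      by (subst sum.lessThan_Suc_shift) (simp add: w_def)
    also have "\<dots> = g (fps_nth v 0) + fps_X * (\<Sum>n<M. fps_X ^ n * hdigits g w n)"
      by (simp add: sum_distrib_left mult.assoc)
    finally have e: "(\<Sum>n<Suc M. fps_X ^ n * hdigits g v n) = g (fps_nth v 0) + fps_X * (\<Sum>n<M. fps_X ^ n * hdigits g w n)" .
    have "v = g (fps_nth v 0) + fps_X * ((\<Sum>n<M. fps_X ^ n * hdigits g w n) + fps_X ^ M * r)"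
      using w(2) r by simp
    also have "\<dots> = (\<Sum>n<Suc M. fps_X ^ n * hdigits g v n) + fps_X ^ Suc M * r"
      unfolding e by (simp add: distrib_left mult.assoc)
    finally show ?case by blast
  qed simp
  then have "fps_nth (hsum (hdigits g v)) N = fps_nth v N" for N
  proof -
    obtain r where r: "v = (\<Sum>n<Suc N. fps_X ^ n * hdigits g v n) + fps_X ^ Suc N * r"
      using \<open>\<And>M. \<exists>r. v = (\<Sum>n<M. fps_X ^ n * hdigits g v n) + fps_X ^ M * r\<close> by blast
    have "fps_nth v N = fps_nth (\<Sum>n<Suc N. fps_X ^ n * hdigits g v n) N + fps_nth (fps_X ^ Suc N * r) N"
      by (subst r) (rule fps_add_nth)
    then show ?thesis using hsum_nth_eq_partial_sum[of N "Suc N" "hdigits g v"]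
      by (simp add: fps_X_power_mult_nth del: sum.lessThan_Suc power_Suc)
  qed
  then show ?thesis by (simp add: fps_eq_iff)
qed

text \<open>
  This keeps the digits of a Laurent series bounded below in $z$.
\<close>

lemma hdigits_eq_0: "(\<And>i. i \<le> n \<Longrightarrow> fps_nth v i = 0) \<Longrightarrow> hdigits g v n = 0"
  by (induction n arbitrary: v) (simp_all add: section_0)

lemma hsum_in: "(\<And>n. a n \<in> J) \<Longrightarrow> hsum a \<in> J"
  by (rule limit, rule bexI, intro allI impI, erule hsum_nth_eq_partial_sum) (intro sum mult)

lemma zlift_subset_laurent_over: "zlift J \<subseteq> laurent_over J"
proof
  fix F assume F: "F \<in> zlift J"
  define f where "f n m = hdigits g (zcoeff F m) n" for n m
  have "f n m \<in> J" for n m using hdigits_range[of "zcoeff F m" n] section_mem by (auto simp: f_def)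
  moreover have "\<exists>M. \<forall>m<M. f n m = 0" for n
  proof -
    obtain A where "\<forall>i\<le>n. \<forall>m<A. fls_nth (fps_nth F i) m = 0" using hlaurent_lower_bound[of n F] by blast
    then show ?thesis unfolding f_def by (intro exI[of _ A] allI impI hdigits_eq_0) (simp add: zcoeff_nth)
  qed
  moreover have "zcoeff F m = hsum (\<lambda>n. f n m)" for m
    using F hsum_hdigits[of "zcoeff F m"] by (simp add: f_def zlift_def)
  ultimately show "F \<in> laurent_over J" unfolding laurent_over_def by blast
qed

lemma topologically_free: "topologically_free J"
  unfolding topologically_free_def
proof (intro exI conjI)
  \<comment> \<open>The image of $J/hJ$ under the section is the space of coefficients of the expansions.\<close>
  define I0 where "I0 = (\<lambda>v. g (fps_nth v 0)) ` J"
  show "csubspace I0" unfolding csubspace_def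
  proof (intro conjI allI ballI)
    show "0 \<in> I0" using zero by (auto simp: I0_def section_0 intro!: image_eqI[of _ _ 0])
  next
    fix v w assume "v \<in> I0" "w \<in> I0"
    then show "v + w \<in> I0" by (auto simp: I0_def add simp flip: section_add fps_add_nth)
  next
    fix c v assume "v \<in> I0"
    then obtain u where u: "u \<in> J" "v = g (fps_nth u 0)" by (auto simp: I0_def)
    have "hscale (fps_const c) v = g (fps_nth (cscale_h c u) 0)"
      by (simp add: hscale_eq_mult h_emb_const u section_scale)
    then show "hscale (fps_const c) v \<in> I0" unfolding I0_def by (rule image_eqI[of _ _ "cscale_h c u"]) (rule mult[OF u(1)])
  qed
  have I0: "v \<in> J" "g (fps_nth v 0) = v" if "v \<in> I0" for v
    using that by (auto simp: I0_def section_mem section_nth_0)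
  show "bij_betw hsum {a. \<forall>n. a n \<in> I0} J"
    unfolding bij_betw_def
  proof
    show "inj_on hsum {a. \<forall>n. a n \<in> I0}"
    proof (rule inj_onI, rule ext)
      fix a b n assume ab: "a \<in> {a. \<forall>n. a n \<in> I0}" "b \<in> {a. \<forall>n. a n \<in> I0}" "hsum a = hsum b"
      show "a n = b n"
      proof (induction n rule: less_induct)
        case (less n)
        have "(\<Sum>i\<le>n. fps_nth (a i) (n - i)) = (\<Sum>i\<le>n. fps_nth (b i) (n - i))"
          using arg_cong[OF ab(3), of "\<lambda>v. fps_nth v n"] by (simp add: hsum_def)
        moreover have "(\<Sum>i<n. fps_nth (a i) (n - i)) = (\<Sum>i<n. fps_nth (b i) (n - i))"
          by (rule sum.cong) (use less in auto)
        ultimately have "fps_nth (a n) 0 = fps_nth (b n) 0"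
          by (simp add: lessThan_Suc_atMost[symmetric])
        moreover have "a n \<in> I0" "b n \<in> I0" using ab(1,2) by blast+
        ultimately show "a n = b n" by (metis I0(2))
      qed
    qed
    have "hdigits g v n \<in> I0" if "v \<in> J" for v n
      using that remainder(2) by (induction n arbitrary: v) (auto simp: I0_def simp del: One_nat_def)
    then have "v \<in> hsum ` {a. \<forall>n. a n \<in> I0}" if "v \<in> J" for v
      using that by - (rule image_eqI[of _ hsum "hdigits g v"], simp_all add: hsum_hdigits)
    moreover have "hsum a \<in> J" if "\<forall>n. a n \<in> I0" for a
      by (intro hsum_in I0(1)) (use that in blast)
    ultimately show "hsum ` {a. \<forall>n. a n \<in> I0} = J" by blast
  qed
qed

end

lemma topologically_free_closed_ideal:
  fixes J :: "'a::comm_monoid_add hmod set"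
  assumes "closed_ideal J"
  shows "topologically_free J"
  using leading_term_section_exists[OF assms] leading_term_section.topologically_free by blast

lemma zlift_subset_laurent_over_closed_ideal:
  fixes J :: "'a::comm_monoid_add hmod set"
  assumes "closed_ideal J"
  shows "zlift J \<subseteq> laurent_over J"
  using leading_term_section_exists[OF assms] leading_term_section.zlift_subset_laurent_over by blast


section \<open>Maps linear over $\mathbb{C}[[h]]$\<close>

text \<open>
  Coordinates with respect to the basis; in these, tensor products become products of power series in $h$.
\<close>

definition hcoeff :: "'a hmod \<Rightarrow> 'a \<Rightarrow> complex fps" where
  "hcoeff v a = Abs_fps (\<lambda>n. Poly_Mapping.lookup (fps_nth v n) a)"

lemma hcoeff_nth: "fps_nth (hcoeff v a) n = Poly_Mapping.lookup (fps_nth v n) a"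
  by (simp add: hcoeff_def)

lemma hcoeff_eqI: "(\<And>a. hcoeff v a = hcoeff w a) \<Longrightarrow> v = w"
  by (auto simp: hcoeff_def fps_eq_iff intro!: poly_mapping_eqI)

lemma hcoeff_add: "hcoeff (v + w) a = hcoeff v a + hcoeff w a"
  by (simp add: fps_eq_iff hcoeff_nth lookup_add)

lemma hcoeff_X_mult: "hcoeff (fps_X * v) a = fps_X * hcoeff (v::'a::comm_monoid_add hmod) a"
  by (simp add: fps_eq_iff hcoeff_nth)

lemma hcoeff_const_mult: "hcoeff (fps_const (Poly_Mapping.single 0 c) * v) a = fps_const c * hcoeff (v::'a::comm_monoid_add hmod) a"
  by (simp add: fps_eq_iff hcoeff_nth map.rep_eq when_def flip: mult_map_scale_conv_mult)

lemma lookup_tensor0: "Poly_Mapping.lookup (tensor0 p q) (a, b) = Poly_Mapping.lookup p a * Poly_Mapping.lookup q b"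
proof -
  have "Poly_Mapping.lookup (tensor0 p q) (a, b) = (\<Sum>a'\<in>Poly_Mapping.keys p. \<Sum>b'\<in>Poly_Mapping.keys q.
     if a' = a then if b' = b then Poly_Mapping.lookup p a' * Poly_Mapping.lookup q b' else 0 else 0)"
    unfolding tensor0_def lookup_sum lookup_single by (intro sum.cong refl) (auto simp: when_def)
  also have "\<dots> = (\<Sum>a'\<in>Poly_Mapping.keys p. if a' = a then \<Sum>b'\<in>Poly_Mapping.keys q.
     (if b' = b then Poly_Mapping.lookup p a' * Poly_Mapping.lookup q b' else 0) else 0)"
    by (intro sum.cong refl) auto
  finally show ?thesis by (auto simp: in_keys_iff)
qed

lemma hcoeff_htensor: "hcoeff (htensor v w) (a, b) = hcoeff v a * hcoeff w b"
  by (simp add: fps_eq_iff hcoeff_nth htensor_def lookup_sum lookup_tensor0 fps_mult_nth atLeast0AtMost)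

text \<open>
  Linearity over $\mathbb{C}[[h]]$, reduced to scalars in $\mathbb{C}$ and multiplication by $h$; by
  \<open>h_linear_cong\<close> it implies $h$-adic continuity.
\<close>

definition h_linear :: "('a::comm_monoid_add hmod \<Rightarrow> 'b::comm_monoid_add hlaurent) \<Rightarrow> bool" where
  "h_linear \<Phi> \<longleftrightarrow> (\<forall>v w. \<Phi> (v + w) = \<Phi> v + \<Phi> w) \<and> (\<forall>v. \<Phi> (fps_X * v) = fps_X * \<Phi> v) \<and>
     (\<forall>c v. \<Phi> (fps_const (Poly_Mapping.single 0 c) * v) = fps_const (fls_const (Poly_Mapping.single 0 c)) * \<Phi> v)"

lemma
  assumes "h_linear \<Phi>"
  shows h_linear_add: "\<Phi> (v + w) = \<Phi> v + \<Phi> w"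
    and h_linear_X: "\<Phi> (fps_X * v) = fps_X * \<Phi> v"
    and h_linear_scale: "\<Phi> (fps_const (Poly_Mapping.single 0 c) * v) = fps_const (fls_const (Poly_Mapping.single 0 c)) * \<Phi> v"
  using assms by (simp_all add: h_linear_def)

lemma h_linear_0: "h_linear \<Phi> \<Longrightarrow> \<Phi> 0 = 0"
  using h_linear_add[of \<Phi> 0 0] by simp

lemma h_linear_sum: "h_linear \<Phi> \<Longrightarrow> \<Phi> (sum f A) = (\<Sum>a\<in>A. \<Phi> (f a))"
  by (induction A rule: infinite_finite_induct) (simp_all add: h_linear_add h_linear_0)

lemma h_linear_X_power: "h_linear \<Phi> \<Longrightarrow> \<Phi> (fps_X ^ n * v) = fps_X ^ n * \<Phi> v"
  by (induction n) (simp_all add: h_linear_X mult.assoc)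

lemma h_linear_cong:
  assumes L: "h_linear \<Phi>" and vw: "\<And>i. i < N \<Longrightarrow> fps_nth v i = fps_nth w i" and i: "i < N"
  shows "fps_nth (\<Phi> v) i = fps_nth (\<Phi> w) i"
proof -
  have "v - w = fps_X ^ N * fps_shift N (v - w)" by (rule fps_eq_X_power_mult) (simp add: vw)
  then have "v = w + fps_X ^ N * fps_shift N (v - w)" by (simp add: algebra_simps)
  then have "\<Phi> v = \<Phi> w + fps_X ^ N * \<Phi> (fps_shift N (v - w))"
    by (metis h_linear_add[OF L] h_linear_X_power[OF L])
  then show ?thesis using i by (simp add: fps_X_power_mult_nth)
qed

lemma h_linear_limit:
  assumes L: "h_linear \<Phi>" and J: "closed_ideal J" and v: "\<And>N. \<exists>w. \<Phi> w \<in> J \<and> (\<forall>n<N. fps_nth v n = fps_nth w n)"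
  shows "\<Phi> v \<in> J"
proof (rule closed_ideal.limit[OF J])
  fix N
  obtain w where "\<Phi> w \<in> J" "\<And>n. n < N \<Longrightarrow> fps_nth v n = fps_nth w n" using v by blast
  then show "\<exists>a\<in>J. \<forall>n<N. fps_nth (\<Phi> v) n = fps_nth a n"
    using h_linear_cong[OF L, of N v w] by blast
qed

lemma poly_mapping_sum_single:
  "(\<Sum>a\<in>Poly_Mapping.keys p. Poly_Mapping.single a (Poly_Mapping.lookup p a)) = p"
  by (rule poly_mapping_eqI) (simp add: lookup_sum lookup_single when_def in_keys_iff)

lemma h_linear_basis_induct:
  assumes L: "h_linear \<Phi>" and J: "closed_ideal J" and b: "\<And>a. \<Phi> (fps_const (Poly_Mapping.single a 1)) \<in> J"
  shows "\<Phi> v \<in> J"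
proof (rule h_linear_limit[OF L J])
  fix N
  define w where "w = (\<Sum>n<N. fps_X ^ n * (\<Sum>a\<in>Poly_Mapping.keys (fps_nth v n).
     fps_const (Poly_Mapping.single 0 (Poly_Mapping.lookup (fps_nth v n) a)) * fps_const (Poly_Mapping.single a 1)))"
  have "(\<Sum>a\<in>Poly_Mapping.keys (fps_nth v n). fps_const (Poly_Mapping.single 0 (Poly_Mapping.lookup (fps_nth v n) a)) * fps_const (Poly_Mapping.single a 1))
     = fps_const (fps_nth v n)" for n
    using poly_mapping_sum_single[of "fps_nth v n"] by (simp add: fps_const_mult mult_single fps_eq_iff fps_sum_nth)
  then have w: "w = (\<Sum>n<N. fps_X ^ n * fps_const (fps_nth v n))" by (simp add: w_def)
  have "fps_nth w n = fps_nth v n" if "n < N" for n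
    unfolding w fps_sum_nth using that 
    by (subst sum.remove[of _ n]) (auto simp: fps_X_power_mult_nth intro!: sum.neutral)
  moreover have "\<Phi> w \<in> J"
    unfolding w_def h_linear_sum[OF L] h_linear_X_power[OF L] h_linear_scale[OF L]
    by (intro closed_ideal.sum[OF J] closed_ideal.mult[OF J] b)
  ultimately show "\<exists>w. \<Phi> w \<in> J \<and> (\<forall>n<N. fps_nth v n = fps_nth w n)" by metis
qed

lemma hlinear_ext_nth:
  assumes "finite K" "\<And>n. n \<le> N \<Longrightarrow> Poly_Mapping.keys (fps_nth v n) \<subseteq> K"
  shows "fps_nth (hlinear_ext B v) N = (\<Sum>n\<le>N. \<Sum>a\<in>K. fls_const (Poly_Mapping.single 0 (Poly_Mapping.lookup (fps_nth v n) a)) * fps_nth (B a) (N - n))"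
  unfolding hlinear_ext_def fps_nth_Abs_fps
proof (rule sum.cong[OF refl])
  fix n assume "n \<in> {..N}"
  then show "(\<Sum>a\<in>Poly_Mapping.keys (fps_nth v n). fls_const (Poly_Mapping.single 0 (Poly_Mapping.lookup (fps_nth v n) a)) * fps_nth (B a) (N - n))
     = (\<Sum>a\<in>K. fls_const (Poly_Mapping.single 0 (Poly_Mapping.lookup (fps_nth v n) a)) * fps_nth (B a) (N - n))"
    using assms by (intro sum.mono_neutral_left) (auto simp: in_keys_iff)
qed

lemma h_linear_hlinear_ext:
  fixes B :: "'a::comm_monoid_add \<Rightarrow> 'b::comm_monoid_add hlaurent"
  shows "h_linear (hlinear_ext B)"
proof -
  have K: "\<exists>K. finite K \<and> (\<forall>n\<le>N. Poly_Mapping.keys (fps_nth v n) \<subseteq> K)" for v :: "'a hmod" and N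
    by (intro exI[of _ "\<Union>n\<le>N. Poly_Mapping.keys (fps_nth v n)"]) auto
  have add: "hlinear_ext B (v + w) = hlinear_ext B v + hlinear_ext B w" for v w
  proof (rule fps_ext)
    fix N
    obtain K1 K2 where "finite K1" "\<forall>n\<le>N. Poly_Mapping.keys (fps_nth v n) \<subseteq> K1" "finite K2" "\<forall>n\<le>N. Poly_Mapping.keys (fps_nth w n) \<subseteq> K2"
      using K by meson
    then have *: "finite (K1 \<union> K2)" "\<And>n. n \<le> N \<Longrightarrow> Poly_Mapping.keys (fps_nth v n) \<subseteq> K1 \<union> K2"
      "\<And>n. n \<le> N \<Longrightarrow> Poly_Mapping.keys (fps_nth w n) \<subseteq> K1 \<union> K2"
      "\<And>n. n \<le> N \<Longrightarrow> Poly_Mapping.keys (fps_nth (v + w) n) \<subseteq> K1 \<union> K2"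
      using Poly_Mapping.keys_add by fastforce+
    show "fps_nth (hlinear_ext B (v + w)) N = fps_nth (hlinear_ext B v + hlinear_ext B w) N"
      by (simp add: hlinear_ext_nth[OF *(1,2)] hlinear_ext_nth[OF *(1,3)] hlinear_ext_nth[OF *(1,4)]
        lookup_add single_add distrib_right sum.distrib flip: fls_plus_const)
  qed
  have X: "hlinear_ext B (fps_X * v) = fps_X * hlinear_ext B v" for v
  proof (rule fps_ext)
    fix N
    obtain K where K: "finite K" "\<And>n. n \<le> N \<Longrightarrow> Poly_Mapping.keys (fps_nth v n) \<subseteq> K" using K by meson
    then have *: "\<And>n. n \<le> N \<Longrightarrow> Poly_Mapping.keys (fps_nth (fps_X * v) n) \<subseteq> K" by auto
    show "fps_nth (hlinear_ext B (fps_X * v)) N = fps_nth (fps_X * hlinear_ext B v) N"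
    proof (cases N)
      case (Suc M)
      then show ?thesis using K(2)
        by (simp add: hlinear_ext_nth[OF K(1) *] hlinear_ext_nth[OF K(1), of M] sum.atMost_Suc_shift del: sum.atMost_Suc)
    qed (simp add: hlinear_ext_def)
  qed
  have "hlinear_ext B (fps_const (Poly_Mapping.single 0 c) * v) = fps_const (fls_const (Poly_Mapping.single 0 c)) * hlinear_ext B v" for c v
  proof (rule fps_ext)
    fix N
    obtain K where K: "finite K" "\<And>n. n \<le> N \<Longrightarrow> Poly_Mapping.keys (fps_nth v n) \<subseteq> K" using K by meson
    have l: "Poly_Mapping.lookup (fps_nth (fps_const (Poly_Mapping.single 0 c) * v) n) a = c * Poly_Mapping.lookup (fps_nth v n) a" for n a
      using arg_cong[OF hcoeff_const_mult[of c v a], of "\<lambda>f. fps_nth f n"] by (simp add: hcoeff_nth)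
    then have *: "\<And>n. n \<le> N \<Longrightarrow> Poly_Mapping.keys (fps_nth (fps_const (Poly_Mapping.single 0 c) * v) n) \<subseteq> K" 
      using K(2) by (auto simp: in_keys_iff subset_iff)
    have s: "fls_const (Poly_Mapping.single 0 (c * d)) = fls_const (Poly_Mapping.single (0::'b) c) * fls_const (Poly_Mapping.single 0 d)" for d
      by (simp add: mult_single fls_const_mult_const)
    show "fps_nth (hlinear_ext B (fps_const (Poly_Mapping.single 0 c) * v)) N = fps_nth (fps_const (fls_const (Poly_Mapping.single 0 c)) * hlinear_ext B v) N"
      by (subst hlinear_ext_nth[OF K(1) *], assumption, subst l)
        (simp add: hlinear_ext_nth[OF K] s sum_distrib_left mult.assoc del: fls_const_mult_const)
  qed
  with add X show ?thesis by (simp add: h_linear_def)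
qed

lemma htensor_linear:
  fixes v w :: "'a::comm_monoid_add hmod" and u u' :: "'b::comm_monoid_add hmod"
  shows "htensor (v + w) u = htensor v u + htensor w u" "htensor v (u + u') = htensor v u + htensor v u'"
    "htensor (fps_X * v) u = fps_X * htensor v u" "htensor v (fps_X * u) = fps_X * htensor v u"
    "htensor (fps_const (Poly_Mapping.single 0 c) * v) u = fps_const (Poly_Mapping.single 0 c) * htensor v u" 
    "htensor v (fps_const (Poly_Mapping.single 0 c) * u) = fps_const (Poly_Mapping.single 0 c) * htensor v u" 
  by (rule hcoeff_eqI, clarify, simp only: hcoeff_htensor hcoeff_add hcoeff_X_mult hcoeff_const_mult distrib_left distrib_right mult.assoc mult.left_commute)+

lemma h_linear_htensor_left: "h_linear T \<Longrightarrow> h_linear (\<lambda>v. T (htensor v u))"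
  by (simp add: h_linear_def htensor_linear)

lemma h_linear_htensor_right: "h_linear T \<Longrightarrow> h_linear (\<lambda>u. T (htensor v u))"
  by (simp add: h_linear_def htensor_linear)

lemma h_linear_mult_right: "h_linear \<Phi> \<Longrightarrow> h_linear (\<lambda>u. \<Phi> (u * r))"
  by (simp add: h_linear_def distrib_right mult.assoc)

lemma h_linear_mult_left: "h_linear \<Phi> \<Longrightarrow> h_linear (\<lambda>u. \<Phi> (r * u))"
  using h_linear_mult_right[of \<Phi> r] by (simp add: mult.commute)

lemma fps_const_single_eq_xmon: "fps_const (Poly_Mapping.single \<alpha> 1) = xmon (mon_list \<alpha>)"
proof -
  have "Poly_Mapping.lookup (mon_of rs) x = count (mset rs) x" for rs x
    by (induction rs) (auto simp: mon_of_def lookup_add lookup_single when_def)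
  then have "mon_of (mon_list \<alpha>) = \<alpha>" by (auto intro: poly_mapping_eqI simp: count_mon_list)
  then show ?thesis by (simp add: xmon_eq)
qed

lemma h_linear_xmon_induct:
  "h_linear \<Phi> \<Longrightarrow> closed_ideal J \<Longrightarrow> (\<And>rs. \<Phi> (xmon rs) \<in> J) \<Longrightarrow> \<Phi> v \<in> J"
  by (rule h_linear_basis_induct) (auto simp: fps_const_single_eq_xmon)

text \<open>
  The preimage of $L$ is closed under the three operations that build \<open>I_cal\<close> from its generators: finite
  sums, division by $h$ and limits.
\<close>

lemma h_linear_I_cal_induct:
  assumes \<Phi>: "h_linear \<Phi>" and L: "closed_ideal L" and x: "\<And>ss q. \<Phi> (xmon ss * xt k t q) \<in> L" and v: "v \<in> I_cal k t"
  shows "\<Phi> v \<in> L"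
proof -
  interpret closed_ideal L by fact
  have alg: "\<Phi> v \<in> L" if "v \<in> I_alg k t" for v
    using that unfolding I_alg_def
  proof (induction rule: finite_sums_induct)
    case (add v w)
    obtain u q where v: "v = u * xt k t q" using add(1) by auto
    have "\<Phi> (u * xt k t q) \<in> L"
      by (rule h_linear_xmon_induct[OF h_linear_mult_right[OF \<Phi>] L x])
    then show ?case using add(2) by (simp add: h_linear_add[OF \<Phi>] v closed_ideal.add[OF L])
  qed (simp add: h_linear_0[OF \<Phi>] zero)
  have sat: "\<Phi> v \<in> L" if "fps_X ^ n * v \<in> I_alg k t" for v n
    using alg[OF that] by (auto simp: h_linear_X_power[OF \<Phi>] intro: divide_X_power)
  show ?thesis
  proof (rule h_linear_limit[OF \<Phi> L])
    fix N
    have "\<exists>w\<in>{v. \<exists>n. fps_X ^ n * v \<in> I_alg k t}. \<forall>n<N. fps_nth v n = fps_nth w n"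
      using v by (simp only: I_cal_eq hclosure_def mem_Collect_eq)
    then show "\<exists>w. \<Phi> w \<in> L \<and> (\<forall>n<N. fps_nth v n = fps_nth w n)" using sat by blast
  qed
qed

lemma h_linear_tensor_sub_subset:
  assumes T: "h_linear T" and L: "closed_ideal L" and ab: "\<And>a b. a \<in> A \<Longrightarrow> b \<in> B \<Longrightarrow> T (htensor a b) \<in> L"
  shows "T ` tensor_sub A B \<subseteq> L"
proof -
  interpret closed_ideal L by fact
  have f: "T v \<in> L" if "v \<in> finite_sums {htensor a b | a b. a \<in> A \<and> b \<in> B}" for v
    using that by (induction rule: finite_sums_induct) (auto simp: h_linear_0[OF T] zero h_linear_add[OF T] ab intro: add)
  have "T v \<in> L" if v: "v \<in> tensor_sub A B" for v
  proof (rule h_linear_limit[OF T L])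
    fix N
    show "\<exists>w. T w \<in> L \<and> (\<forall>n<N. fps_nth v n = fps_nth w n)"
      using v f unfolding tensor_sub_def hclosure_def mem_Collect_eq by meson
  qed
  then show ?thesis by blast
qed

lemma h_linear_tensor_I_cal_right:
  assumes T: "h_linear T" and L: "closed_ideal L"
    and x: "\<And>rs ss q. T (htensor (xmon rs) (xmon ss * xt k t q)) \<in> L"
  shows "T ` tensor_sub UNIV (I_cal k t) \<subseteq> L"
proof (rule h_linear_tensor_sub_subset[OF T L])
  fix a :: W and b assume "b \<in> I_cal k t"
  then show "T (htensor a b) \<in> L"
  proof (rule h_linear_I_cal_induct[OF h_linear_htensor_right[OF T] L, rotated])
    show "T (htensor a (xmon ss * xt k t q)) \<in> L" for ss q
      by (rule h_linear_xmon_induct[OF h_linear_htensor_left[OF T] L x])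
  qed
qed

lemma h_linear_tensor_I_cal_left:
  assumes T: "h_linear T" and L: "closed_ideal L"
    and x: "\<And>rs ss q. T (htensor (xmon rs * xt k t q) (xmon ss)) \<in> L"
  shows "T ` tensor_sub (I_cal k t) UNIV \<subseteq> L"
proof (rule h_linear_tensor_sub_subset[OF T L])
  fix b :: W and a assume "a \<in> I_cal k t"
  then show "T (htensor a b) \<in> L"
  proof (rule h_linear_I_cal_induct[OF h_linear_htensor_left[OF T] L, rotated])
    show "T (htensor (xmon rs * xt k t q) b) \<in> L" for rs q
      by (rule h_linear_xmon_induct[OF h_linear_htensor_right[OF T] L x])
  qed
qed


section \<open>Taylor expansion and substitution of $w + ah$\<close>

lemma vandermonde_taylor:
  fixes i c d :: nat
  assumes "i \<le> c + d"
  shows "(\<Sum>j\<in>{j. j \<le> c \<and> j \<le> i \<and> i \<le> j + d}. (i choose j) * ((c + d - i) choose (c - j))) = (c + d) choose c"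
proof -
  have "(\<Sum>j\<in>{j. j \<le> c \<and> j \<le> i \<and> i \<le> j + d}. (i choose j) * ((c + d - i) choose (c - j)))
      = (\<Sum>j\<le>c. (i choose j) * ((c + d - i) choose (c - j)))"
    by (rule sum.mono_neutral_left) (use assms in auto)
  then show ?thesis using assms vandermonde[of i "c + d - i" c] by simp
qed

text \<open>
  Taylor expansion $f(w) \mapsto f(w+y)$ is multiplicative; the two sides are the coefficients of $w^c y^d$ in
  $g(w+y)\,f(w+y)$ and in $(gf)(w+y)$.
\<close>

lemma taylor_convolution:
  fixes g f :: "nat \<Rightarrow> 'a::comm_ring_1"
  shows "(\<Sum>i\<le>c. \<Sum>j\<le>d. (of_nat ((i + j) choose i) * g (i + j))
            * (of_nat (((c - i) + (d - j)) choose (c - i)) * f ((c - i) + (d - j))))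
       = of_nat ((c + d) choose c) * (\<Sum>m\<le>c+d. g m * f (c + d - m))"
proof -
  define t where "t i m = of_nat ((m choose i) * ((c + d - m) choose (c - i))) * (g m * f (c + d - m))" for i m
  have "(\<Sum>i\<le>c. \<Sum>j\<le>d. (of_nat ((i + j) choose i) * g (i + j))
            * (of_nat (((c - i) + (d - j)) choose (c - i)) * f ((c - i) + (d - j))))
      = (\<Sum>i\<le>c. \<Sum>j\<le>d. t i (i + j))"
  proof (intro sum.cong refl)
    fix i j assume "i \<in> {..c}" "j \<in> {..d}"
    then have "c + d - (i + j) = (c - i) + (d - j)" by simp
    then show "(of_nat ((i + j) choose i) * g (i + j))
            * (of_nat (((c - i) + (d - j)) choose (c - i)) * f ((c - i) + (d - j))) = t i (i + j)"
      by (simp add: t_def algebra_simps)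
  qed
  also have "\<dots> = (\<Sum>i\<le>c. \<Sum>m\<in>{m. m \<le> c + d \<and> i \<le> m \<and> m \<le> i + d}. t i m)"
  proof (rule sum.cong[OF refl])
    fix i assume "i \<in> {..c}"
    then show "(\<Sum>j\<le>d. t i (i + j)) = (\<Sum>m\<in>{m. m \<le> c + d \<and> i \<le> m \<and> m \<le> i + d}. t i m)"
      by (intro sum.reindex_bij_witness[of _ "\<lambda>m. m - i" "\<lambda>j. i + j"]) auto
  qed
  also have "\<dots> = (\<Sum>m\<le>c+d. \<Sum>i\<in>{i. i \<le> c \<and> i \<le> m \<and> m \<le> i + d}. t i m)"
    using sum.swap_restrict[of "{..c}" "{..c+d}" t "\<lambda>i m. i \<le> m \<and> m \<le> i + d"] by simp
  also have "\<dots> = (\<Sum>m\<le>c+d. of_nat ((c + d) choose c) * (g m * f (c + d - m)))"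
  proof (rule sum.cong[OF refl])
    fix m assume m: "m \<in> {..c+d}"
    have "(\<Sum>i\<in>{i. i \<le> c \<and> i \<le> m \<and> m \<le> i + d}. t i m)
      = of_nat (\<Sum>i\<in>{i. i \<le> c \<and> i \<le> m \<and> m \<le> i + d}. (m choose i) * ((c + d - m) choose (c - i))) * (g m * f (c + d - m))"
      by (simp add: t_def sum_distrib_right)
    then show "(\<Sum>i\<in>{i. i \<le> c \<and> i \<le> m \<and> m \<le> i + d}. t i m) = of_nat ((c + d) choose c) * (g m * f (c + d - m))"
      using m by (subst (asm) vandermonde_taylor) auto
  qed
  finally show ?thesis by (simp add: sum_distrib_left)
qed

text \<open>
  The series $f(w+ah)$ for $f(v) = \sum_c f_c v^c$, as a power series in $w$ (outer) and $h$ (inner).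
\<close>

definition taylor :: "'a::comm_ring_1 \<Rightarrow> (nat \<Rightarrow> 'a) \<Rightarrow> 'a fps fps" where
  "taylor a f = Abs_fps (\<lambda>c. Abs_fps (\<lambda>d. of_nat ((c + d) choose c) * a ^ d * f (c + d)))"

text \<open>
  The value at $v = w + ah$ of $\sum_m \psi_m v^m$, where the $\psi_m$ are themselves series in $w$ and
  $h$. The term with indices $c$ and $d$ comes from $w^c (ah)^d$ in $(w+ah)^{c+d}$.
\<close>

definition subst_shift :: "'a::comm_ring_1 \<Rightarrow> (nat \<Rightarrow> 'a fps fps) \<Rightarrow> 'a fps fps" where
  "subst_shift a \<psi> = Abs_fps (\<lambda>q. Abs_fps (\<lambda>N.
     \<Sum>c\<le>q. \<Sum>d\<le>N. of_nat ((c + d) choose c) * a ^ d * fps_nth (fps_nth (\<psi> (c + d)) (q - c)) (N - d)))"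

lemma subst_shift_nth:
  "fps_nth (fps_nth (subst_shift a \<psi>) q) N =
     (\<Sum>c\<le>q. \<Sum>d\<le>N. of_nat ((c + d) choose c) * a ^ d * fps_nth (fps_nth (\<psi> (c + d)) (q - c)) (N - d))"
  by (simp add: subst_shift_def)

lemma triangle_swap:
  fixes F :: "nat \<Rightarrow> nat \<Rightarrow> nat \<Rightarrow> 'a::comm_monoid_add"
  shows "(\<Sum>Q\<le>q. \<Sum>c\<le>Q. F c (Q - c) (q - Q)) = (\<Sum>c\<le>q. \<Sum>c'\<le>c. F c' (q - c) (c - c'))"
proof -
  have "(\<Sum>Q\<le>q. \<Sum>c\<le>Q. F c (Q - c) (q - Q)) = (\<Sum>(Q,c)\<in>Sigma {..q} (\<lambda>Q. {..Q}). F c (Q - c) (q - Q))"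
    by (subst sum.Sigma) auto
  also have "\<dots> = (\<Sum>(c,c')\<in>Sigma {..q} (\<lambda>Q. {..Q}). F c' (q - c) (c - c'))"
    by (rule sum.reindex_bij_witness[of _ "\<lambda>(c,c'). (q - c + c', c')" "\<lambda>(Q,c). (q - Q + c, c)"]) auto
  also have "\<dots> = (\<Sum>c\<le>q. \<Sum>c'\<le>c. F c' (q - c) (c - c'))"
    by (subst sum.Sigma) auto
  finally show ?thesis .
qed

lemma triangle_assoc:
  fixes F :: "nat \<Rightarrow> nat \<Rightarrow> nat \<Rightarrow> 'a::comm_monoid_add"
  shows "(\<Sum>Q\<le>q. \<Sum>c\<le>Q. F c (Q - c) (q - Q)) = (\<Sum>c\<le>q. \<Sum>r\<le>q-c. F c r (q - c - r))"
  using fps_mult_assoc_lemma[of F q q] by (simp add: atLeast0AtMost)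

text \<open>
  The argument on the left is the product of $\sum_i \psi_i v^i$ and $f(v)$. For fixed powers of $w$ and $h$
  in the coefficients of the $\psi_i$ the claim is the multiplicativity of Taylor expansion; the
  rest regroups the convolutions in $w$ and in $h$.
\<close>

lemma subst_shift_convolution:
  fixes \<psi> :: "nat \<Rightarrow> 'a::comm_ring_1 fps fps"
  shows "subst_shift a (\<lambda>m. \<Sum>i\<le>m. \<psi> i * fps_const (fps_const (f (m - i)))) = subst_shift a \<psi> * taylor a f"
proof (rule fps_ext, rule fps_ext)
  fix q N
  define G where "G c1 d1 q' N' c2 d2 = of_nat ((c1 + d1) choose c1) * a ^ d1 * fps_nth (fps_nth (\<psi> (c1 + d1)) q') N'
      * (of_nat ((c2 + d2) choose c2) * a ^ d2 * f (c2 + d2))" for c1 d1 q' N' c2 d2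
  have "fps_nth (fps_nth (subst_shift a \<psi> * taylor a f) q) N
      = (\<Sum>Q\<le>q. \<Sum>M\<le>N. (\<Sum>c\<le>Q. \<Sum>d\<le>M. of_nat ((c + d) choose c) * a ^ d * fps_nth (fps_nth (\<psi> (c + d)) (Q - c)) (M - d))
          * (of_nat (((q - Q) + (N - M)) choose (q - Q)) * a ^ (N - M) * f ((q - Q) + (N - M))))"
    by (simp add: fps_mult_nth fps_sum_nth subst_shift_nth taylor_def atLeast0AtMost add.commute)
  also have "\<dots> = (\<Sum>Q\<le>q. \<Sum>M\<le>N. \<Sum>c\<le>Q. \<Sum>d\<le>M. G c d (Q - c) (M - d) (q - Q) (N - M))"
    by (simp add: G_def sum_distrib_right)
  also have "\<dots> = (\<Sum>Q\<le>q. \<Sum>c\<le>Q. \<Sum>M\<le>N. \<Sum>d\<le>M. G c d (Q - c) (M - d) (q - Q) (N - M))"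
    by (rule sum.cong[OF refl], rule sum.swap)
  also have "\<dots> = (\<Sum>Q\<le>q. \<Sum>c\<le>Q. \<Sum>d\<le>N. \<Sum>d'\<le>d. G c d' (Q - c) (N - d) (q - Q) (d - d'))"
    by (rule sum.cong[OF refl], rule sum.cong[OF refl], rule triangle_swap)
  also have "\<dots> = (\<Sum>c\<le>q. \<Sum>c'\<le>c. \<Sum>d\<le>N. \<Sum>d'\<le>d. G c' d' (q - c) (N - d) (c - c') (d - d'))"
    by (rule triangle_swap[of "\<lambda>c q' r. \<Sum>d\<le>N. \<Sum>d'\<le>d. G c d' q' (N - d) r (d - d')" for N])
  also have "\<dots> = (\<Sum>c\<le>q. \<Sum>d\<le>N. \<Sum>c'\<le>c. \<Sum>d'\<le>d. G c' d' (q - c) (N - d) (c - c') (d - d'))"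
    by (rule sum.cong[OF refl], rule sum.swap)
  also have "\<dots> = (\<Sum>c\<le>q. \<Sum>d\<le>N. of_nat ((c + d) choose c) * a ^ d *
       (\<Sum>m\<le>c+d. fps_nth (fps_nth (\<psi> m) (q - c)) (N - d) * f (c + d - m)))"
  proof (intro sum.cong refl)
    fix c d assume "c \<in> {..q}" "d \<in> {..N}"
    have "(\<Sum>c'\<le>c. \<Sum>d'\<le>d. G c' d' (q - c) (N - d) (c - c') (d - d'))
      = a ^ d * (\<Sum>i\<le>c. \<Sum>j\<le>d. (of_nat ((i + j) choose i) * fps_nth (fps_nth (\<psi> (i+j)) (q - c)) (N - d))
            * (of_nat (((c - i) + (d - j)) choose (c - i)) * f ((c - i) + (d - j))))"
      unfolding sum_distrib_left
    proof (intro sum.cong refl)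
      fix i j assume "j \<in> {..d}"
      then have "a ^ d = a ^ j * a ^ (d - j)" by (simp flip: power_add)
      then show "G i j (q - c) (N - d) (c - i) (d - j) = 
        a ^ d * ((of_nat ((i + j) choose i) * fps_nth (fps_nth (\<psi> (i+j)) (q - c)) (N - d))
            * (of_nat (((c - i) + (d - j)) choose (c - i)) * f ((c - i) + (d - j))))"
        by (simp add: G_def mult_ac)
    qed
    then show "(\<Sum>c'\<le>c. \<Sum>d'\<le>d. G c' d' (q - c) (N - d) (c - c') (d - d')) =
        of_nat ((c + d) choose c) * a ^ d * (\<Sum>m\<le>c+d. fps_nth (fps_nth (\<psi> m) (q - c)) (N - d) * f (c + d - m))"
      by (subst (asm) taylor_convolution) (simp add: mult_ac)
  qed
  also have "\<dots> = fps_nth (fps_nth (subst_shift a (\<lambda>m. \<Sum>i\<le>m. \<psi> i * fps_const (fps_const (f (m - i))))) q) N"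
    by (simp add: subst_shift_nth fps_sum_nth)
  finally show "fps_nth (fps_nth (subst_shift a (\<lambda>m. \<Sum>i\<le>m. \<psi> i * fps_const (fps_const (f (m - i))))) q) N
     = fps_nth (fps_nth (subst_shift a \<psi> * taylor a f) q) N" by simp
qed

lemma subst_shift_mult_const:
  "subst_shift a (\<lambda>m. \<psi> m * G) = subst_shift a \<psi> * G"
proof (rule fps_ext, rule fps_ext)
  fix q N
  define T where "T c d q' N' r R = of_nat ((c + d) choose c) * a ^ d * fps_nth (fps_nth (\<psi> (c + d)) q') N' * fps_nth (fps_nth G r) R" for c d q' N' r R
  have "fps_nth (fps_nth (subst_shift a \<psi> * G) q) N 
    = (\<Sum>Q\<le>q. \<Sum>M\<le>N. \<Sum>c\<le>Q. \<Sum>d\<le>M. T c d (Q - c) (M - d) (q - Q) (N - M))"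
    by (simp add: fps_mult_nth fps_sum_nth subst_shift_nth atLeast0AtMost T_def sum_distrib_right)
  also have "\<dots> = (\<Sum>Q\<le>q. \<Sum>c\<le>Q. \<Sum>M\<le>N. \<Sum>d\<le>M. T c d (Q - c) (M - d) (q - Q) (N - M))"
    by (rule sum.cong[OF refl], rule sum.swap)
  also have "\<dots> = (\<Sum>Q\<le>q. \<Sum>c\<le>Q. \<Sum>d\<le>N. \<Sum>M\<le>N-d. T c d (Q - c) M (q - Q) (N - d - M))"
    by (rule sum.cong[OF refl], rule sum.cong[OF refl], rule triangle_assoc)
  also have "\<dots> = (\<Sum>c\<le>q. \<Sum>r\<le>q-c. \<Sum>d\<le>N. \<Sum>M\<le>N-d. T c d r M (q - c - r) (N - d - M))"
    by (rule triangle_assoc)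
  also have "\<dots> = (\<Sum>c\<le>q. \<Sum>d\<le>N. \<Sum>r\<le>q-c. \<Sum>M\<le>N-d. T c d r M (q - c - r) (N - d - M))"
    by (rule sum.cong[OF refl], rule sum.swap)
  also have "\<dots> = fps_nth (fps_nth (subst_shift a (\<lambda>m. \<psi> m * G)) q) N"
    by (simp add: subst_shift_nth fps_mult_nth fps_sum_nth atLeast0AtMost T_def sum_distrib_left mult.assoc)
  finally show "fps_nth (fps_nth (subst_shift a (\<lambda>m. \<psi> m * G)) q) N = fps_nth (fps_nth (subst_shift a \<psi> * G) q) N" ..
qed


section \<open>Images of the series $x^+(w) \cdots x^+(w+kth)$ under ring homomorphisms\<close>

locale ring_homomorphism =
  fixes \<phi> :: "'r::comm_ring_1 \<Rightarrow> 's::comm_ring_1"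
  assumes add: "\<phi> (x + y) = \<phi> x + \<phi> y" and mult: "\<phi> (x * y) = \<phi> x * \<phi> y" and one: "\<phi> 1 = 1"
begin

lemma zero: "\<phi> 0 = 0" using add[of 0 0] by simp

lemma sum: "\<phi> (sum f A) = (\<Sum>a\<in>A. \<phi> (f a))"
  by (induction A rule: infinite_finite_induct) (simp_all add: zero add)

lemma prod: "\<phi> (prod f A) = (\<Prod>a\<in>A. \<phi> (f a))"
  by (induction A rule: infinite_finite_induct) (simp_all add: one mult)

lemma of_nat: "\<phi> (of_nat n) = of_nat n"
  by (induction n) (simp_all add: zero one add)

lemma power: "\<phi> (x ^ n) = \<phi> x ^ n"
  by (induction n) (simp_all add: one mult)

end

definition map_fps :: "('r \<Rightarrow> 's) \<Rightarrow> 'r fps \<Rightarrow> 's fps" where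
  "map_fps \<phi> F = Abs_fps (\<lambda>n. \<phi> (fps_nth F n))"

lemma map_fps_nth [simp]: "fps_nth (map_fps \<phi> F) n = \<phi> (fps_nth F n)"
  by (simp add: map_fps_def)

lemma ring_homomorphism_map_fps:
  assumes "ring_homomorphism \<phi>"
  shows "ring_homomorphism (map_fps \<phi>)"
proof -
  interpret ring_homomorphism \<phi> by fact
  show ?thesis
    by unfold_locales (auto intro!: fps_ext simp: add mult one zero sum fps_mult_nth)
qed

lemma ring_homomorphism_comp: "ring_homomorphism \<phi> \<Longrightarrow> ring_homomorphism \<psi> \<Longrightarrow> ring_homomorphism (\<lambda>x. \<phi> (\<psi> x))"
  by (simp add: ring_homomorphism_def)

lemma ring_homomorphism_fls_const: "ring_homomorphism fls_const"
  by unfold_locales (simp_all flip: fls_plus_const)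

lemma map_fps_taylor:
  assumes "ring_homomorphism \<phi>"
  shows "map_fps (map_fps \<phi>) (taylor a f) = taylor (\<phi> a) (\<lambda>c. \<phi> (f c))"
proof -
  interpret ring_homomorphism \<phi> by fact
  show ?thesis by (auto intro!: fps_ext simp: taylor_def mult of_nat power)
qed

text \<open>
  Every series of fields occurring in $Y$ and $\mathcal{S}$ is an image of $x^+$ under a ring homomorphism, so the
  corresponding product of $k+1$ shifted fields is the image of $x^+(w) \cdots x^+(w+kth)$.
\<close>

lemma prod_taylor_ring_homomorphism:
  assumes "ring_homomorphism \<phi>"
  shows "(\<Prod>j\<in>A. taylor (\<phi> (a j)) (\<lambda>c. \<phi> (f c))) = map_fps (map_fps \<phi>) (\<Prod>j\<in>A. taylor (a j) f)"
  using ring_homomorphism.prod[OF ring_homomorphism_map_fps[OF ring_homomorphism_map_fps[OF assms]], of "\<lambda>j. taylor (a j) f" A]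
  by (simp add: map_fps_taylor[OF assms])

text \<open>
  The substitution $w \mapsto w + z$, with values in Laurent series in $z$.
\<close>

definition translate :: "'a::comm_ring_1 fps fps \<Rightarrow> 'a fls fps fps" where
  "translate F = Abs_fps (\<lambda>c. Abs_fps (\<lambda>N. fps_to_fls (Abs_fps (\<lambda>m. of_nat ((c + m) choose c) * fps_nth (fps_nth F (c + m)) N))))"

lemma translate_nth: "fps_nth (fps_nth (translate F) c) N = fps_to_fls (Abs_fps (\<lambda>m. of_nat ((c + m) choose c) * fps_nth (fps_nth F (c + m)) N))"
  by (simp add: translate_def)

lemma fps_to_fls_sum: "fps_to_fls (sum f A) = (\<Sum>a\<in>A. fps_to_fls (f a))"
  by (induction A rule: infinite_finite_induct) (simp_all add: fps_to_fls_plus)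

text \<open>
  Multiplicativity is again that of Taylor expansion, in each power of $h$.
\<close>

lemma ring_homomorphism_translate: "ring_homomorphism (translate :: 'a::comm_ring_1 fps fps \<Rightarrow> _)"
proof
  fix F G :: "'a fps fps"
  show "translate (F + G) = translate F + translate G"
    by (intro fps_ext) (simp add: translate_nth fps_eq_iff algebra_simps flip: fps_to_fls_plus)
  have "translate (1 :: 'a fps fps) = 1"
  proof (intro fps_ext)
    fix c N
    have "Abs_fps (\<lambda>m. of_nat ((c + m) choose c) * fps_nth (fps_nth (1::'a fps fps) (c + m)) N) = (if c = 0 \<and> N = 0 then 1 else 0)"
      by (auto simp: fps_eq_iff fps_one_nth)
    then show "fps_nth (fps_nth (translate (1 :: 'a fps fps)) c) N = fps_nth (fps_nth 1 c) N"
      by (simp add: translate_nth)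
  qed
  then show "translate (1 :: 'a fps fps) = 1" .
  show "translate (F * G) = translate F * translate G"
  proof (intro fps_ext)
    fix c N
    define t where "t F c N = Abs_fps (\<lambda>m. of_nat ((c + m) choose c) * fps_nth (fps_nth F (c + m)) N)" for F :: "'a fps fps" and c N
    have "t (F * G) c N = (\<Sum>i\<le>c. \<Sum>n\<le>N. t F i n * t G (c - i) (N - n))"
    proof (rule fps_ext)
      fix m
      have "fps_nth (t (F * G) c N) m = of_nat ((c + m) choose c) * (\<Sum>i\<le>c+m. \<Sum>n\<le>N. fps_nth (fps_nth F i) n * fps_nth (fps_nth G (c + m - i)) (N - n))"
        by (simp add: t_def fps_mult_nth fps_sum_nth atLeast0AtMost)
      also have "\<dots> = (\<Sum>n\<le>N. of_nat ((c + m) choose c) * (\<Sum>i\<le>c+m. fps_nth (fps_nth F i) n * fps_nth (fps_nth G (c + m - i)) (N - n)))"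
        by (subst sum.swap) (simp add: sum_distrib_left)
      also have "\<dots> = (\<Sum>n\<le>N. \<Sum>i\<le>c. \<Sum>j\<le>m. fps_nth (t F i n) j * fps_nth (t G (c - i) (N - n)) (m - j))"
        by (subst taylor_convolution[symmetric]) (simp add: t_def add.commute)
      also have "\<dots> = (\<Sum>i\<le>c. \<Sum>n\<le>N. \<Sum>j\<le>m. fps_nth (t F i n) j * fps_nth (t G (c - i) (N - n)) (m - j))"
        by (rule sum.swap)
      finally show "fps_nth (t (F * G) c N) m = fps_nth (\<Sum>i\<le>c. \<Sum>n\<le>N. t F i n * t G (c - i) (N - n)) m"
        by (simp add: fps_sum_nth fps_mult_nth atLeast0AtMost)
    qed
    moreover have "fps_nth (fps_nth (translate F) c) N = fps_to_fls (t F c N)" for F c N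
      by (simp add: translate_nth t_def)
    ultimately show "fps_nth (fps_nth (translate (F * G)) c) N = fps_nth (fps_nth (translate F * translate G) c) N"
      by (simp add: fps_mult_nth fps_sum_nth atLeast0AtMost fps_to_fls_sum fls_times_fps_to_fls)
  qed
qed

text \<open>
  Both sides are $f(w + z + ah)$: the shifts by $z$ and by $ah$ commute.
\<close>

lemma translate_taylor:
  "translate (taylor a f) = taylor (fls_const a) (\<lambda>c. fps_to_fls (Abs_fps (\<lambda>d. of_nat ((c + d) choose c) * f (c + d))))"
proof (intro fps_ext)
  fix c N
  \<comment> \<open>Both products are the multinomial coefficient $(c+m+N)!/(c!\,m!\,N!)$.\<close>
  have b: "((c + m) choose c) * ((c + m + N) choose (c + m)) = ((c + N) choose c) * ((c + N + m) choose (c + N))" for m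
  proof -
    have "((c + m + N) choose (c + m)) * ((c + m) choose c) = ((c + m + N) choose c) * ((c + m + N - c) choose (c + m - c))"
      by (rule choose_mult) auto
    moreover have "((c + N + m) choose (c + N)) * ((c + N) choose c) = ((c + N + m) choose c) * ((c + N + m - c) choose (c + N - c))"
      by (rule choose_mult) auto
    moreover have "((m + N) choose m) = ((N + m) choose N)"
      using binomial_symmetric[of m "m + N"] by (simp add: add.commute)
    ultimately show ?thesis by (simp add: mult.commute add_ac)
  qed
  have b': "of_nat ((c + m) choose c) * (of_nat ((c + m + N) choose (c + m)) * x) = (of_nat ((c + N) choose c) * (of_nat ((c + N + m) choose (c + N)) * x) :: 'a)" for m x
    using arg_cong[OF b[of m], of "\<lambda>n. of_nat n * x"] by (simp add: mult.assoc)
  have "fps_nth (fps_nth (translate (taylor a f)) c) N =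
     fps_to_fls (Abs_fps (\<lambda>m. of_nat ((c + m) choose c) * (of_nat ((c + m + N) choose (c + m)) * (a ^ N * f (c + m + N)))))"
    by (simp add: translate_nth taylor_def mult.assoc)
  also have "Abs_fps (\<lambda>m. of_nat ((c + m) choose c) * (of_nat ((c + m + N) choose (c + m)) * (a ^ N * f (c + m + N))))
     = of_nat ((c + N) choose c) * fps_const a ^ N * Abs_fps (\<lambda>m. of_nat ((c + N + m) choose (c + N)) * f (c + N + m))"
    by (rule fps_ext) (simp only: b', simp add: fps_of_nat[symmetric] fps_const_power mult.assoc mult.left_commute[of "a ^ N"] add_ac)
  finally show "fps_nth (fps_nth (translate (taylor a f)) c) N = fps_nth (fps_nth (taylor (fls_const a) (\<lambda>c. fps_to_fls (Abs_fps (\<lambda>d. of_nat ((c + d) choose c) * f (c + d))))) c) N"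
    by (simp add: taylor_def fls_times_fps_to_fls fps_to_fls_power fls_const_power)
qed

lemma single_0_of_nat_mult_power:
  "Poly_Mapping.single (0::'b::comm_monoid_add) (of_nat n * a ^ d) = of_nat n * Poly_Mapping.single 0 (a::complex) ^ d"
proof -
  have "Poly_Mapping.single (0::'b) (a ^ d) = Poly_Mapping.single 0 a ^ d"
    by (induction d) (simp, metis mult_single add_0_left power_Suc)
  moreover have "Poly_Mapping.single (0::'b) (of_nat n * b) = of_nat n * Poly_Mapping.single 0 b" for b :: complex
    by (simp add: mult_single flip: single_of_nat)
  ultimately show ?thesis by simp
qed

lemma xt_eq_prod_taylor: "xt k t q = fps_nth (\<Prod>j<Suc k. taylor (Poly_Mapping.single 0 (of_nat j * t)) xgen) q"
proof -
  have "xplus_shift a = taylor (Poly_Mapping.single 0 a) xgen" for a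
    by (simp add: xplus_shift_def taylor_def single_0_of_nat_mult_power)
  then show ?thesis by (simp add: xt_def lessThan_Suc_atMost del: prod.lessThan_Suc)
qed

lemma prod_taylor_const_mem_zlift:
  fixes \<iota> :: "(mon \<Rightarrow>\<^sub>0 complex) \<Rightarrow> ('b::comm_monoid_add \<Rightarrow>\<^sub>0 complex)"
  assumes \<iota>: "ring_homomorphism \<iota>" "\<And>c. \<iota> (Poly_Mapping.single 0 c) = Poly_Mapping.single 0 c"
    and J: "0 \<in> J" "\<And>q. map_fps \<iota> (xt k t q) \<in> J"
  shows "fps_nth (\<Prod>j<Suc k. taylor (fls_const (Poly_Mapping.single 0 (of_nat j * t))) (\<lambda>c. fls_const (\<iota> (xgen c)))) q \<in> zlift J"
proof -
  define F where "F = map_fps (\<lambda>p. fls_const (\<iota> p)) (xt k t q)"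
  have h: "ring_homomorphism (\<lambda>p. fls_const (\<iota> p))"
    by (rule ring_homomorphism_comp[OF ring_homomorphism_fls_const \<iota>(1)])
  have "fps_nth (\<Prod>j<Suc k. taylor (fls_const (Poly_Mapping.single 0 (of_nat j * t))) (\<lambda>c. fls_const (\<iota> (xgen c)))) q = F"
    using arg_cong[OF prod_taylor_ring_homomorphism[OF h, of "\<lambda>j. Poly_Mapping.single 0 (of_nat j * t)" xgen "{..<Suc k}"], of "\<lambda>F. fps_nth F q"]
    by (simp add: \<iota>(2) F_def xt_eq_prod_taylor del: prod.lessThan_Suc)
  moreover have "zcoeff F m = (if m = 0 then map_fps \<iota> (xt k t q) else 0)" for m
    by (simp add: F_def fps_eq_iff zcoeff_nth)
  ultimately show ?thesis using J by (simp add: zlift_def)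
qed

text \<open>
  The coefficient of $w^q z^m$ in $X(w+z)$ is a binomial multiple of the coefficient of $w^{q+m}$ in $X(w)$.
\<close>

lemma prod_taylor_translate_mem_zlift:
  assumes J: "closed_ideal J" "\<And>q. xt k t q \<in> J"
  shows "fps_nth (\<Prod>j<Suc k. taylor (fls_const (Poly_Mapping.single 0 (of_nat j * t)))
     (\<lambda>c. fps_to_fls (Abs_fps (\<lambda>d. of_nat ((c + d) choose c) * xgen (c + d))))) q \<in> zlift J"
proof -
  define P where "P = (\<Prod>j<Suc k. taylor (Poly_Mapping.single 0 (of_nat j * t)) xgen)"
  have "(\<Prod>j<Suc k. taylor (fls_const (Poly_Mapping.single 0 (of_nat j * t)))
     (\<lambda>c. fps_to_fls (Abs_fps (\<lambda>d. of_nat ((c + d) choose c) * xgen (c + d))))) = translate P"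
    unfolding P_def ring_homomorphism.prod[OF ring_homomorphism_translate] translate_taylor ..
  moreover have "zcoeff (fps_nth (translate P) q) m = (if m < 0 then 0 else of_nat ((q + nat m) choose q) * fps_nth P (q + nat m))" for m
    by (simp add: fps_eq_iff zcoeff_nth translate_nth fps_of_nat[symmetric])
  moreover have "fps_nth P i \<in> J" for i using J(2)[of i] by (simp add: P_def xt_eq_prod_taylor)
  ultimately show ?thesis using closed_ideal.mult[OF J(1)] closed_ideal.zero[OF J(1)] by (simp add: zlift_def)
qed


section \<open>Specialising variables of a generating series\<close>

type_synonym exponents = "nat + nat \<Rightarrow>\<^sub>0 nat"

definition total_degree :: "exponents \<Rightarrow> nat" where
  "total_degree e = (\<Sum>x\<in>Poly_Mapping.keys e. Poly_Mapping.lookup e x)"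

lemma total_degree_eq: "finite A \<Longrightarrow> Poly_Mapping.keys e \<subseteq> A \<Longrightarrow> total_degree e = (\<Sum>x\<in>A. Poly_Mapping.lookup e x)"
  unfolding total_degree_def by (intro sum.mono_neutral_left) (auto simp: in_keys_iff)

lemma total_degree_add: "total_degree (e + e') = total_degree e + total_degree e'"
  using total_degree_eq[of "Poly_Mapping.keys e \<union> Poly_Mapping.keys e'"] Poly_Mapping.keys_add[of e e']
  by (simp add: lookup_add sum.distrib)

lemma total_degree_single: "total_degree (Poly_Mapping.single x n) = n"
  using total_degree_eq[of "{x}" "Poly_Mapping.single x n"] by simp

lemma total_degree_sum: "total_degree (sum f A) = (\<Sum>a\<in>A. total_degree (f a))"
  by (induction A rule: infinite_finite_induct) (simp_all add: total_degree_add, simp_all add: total_degree_def)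

text \<open>
  A generating series stores its homogeneous components separately, so the coefficient at an exponent vector is
  read off in the component of its total degree.
\<close>

definition exp_coeff :: "'b::comm_monoid_add gseries \<Rightarrow> exponents \<Rightarrow> 'b hlaurent" where
  "exp_coeff F e = Poly_Mapping.lookup (fps_nth F (total_degree e)) e"

lemma gcoeff_eq_exp_coeff: "gcoeff rs ss F = exp_coeff F (expo rs ss)"
  by (simp add: gcoeff_def exp_coeff_def expo_def total_degree_add total_degree_sum total_degree_single
    atLeast0LessThan flip: sum_list_sum_nth sum_list_sum_nth[unfolded atLeast0LessThan])

lemma lookup_mult_single:
  fixes p :: "'k::cancel_comm_monoid_add \<Rightarrow>\<^sub>0 'r::comm_semiring_1"
  shows "Poly_Mapping.lookup (p * Poly_Mapping.single s c) (e + s) = Poly_Mapping.lookup p e * c"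
proof -
  have "(\<Sum>q. Poly_Mapping.lookup (Poly_Mapping.single s c) q when e + s = l + q) = (c when l = e)" for l
  proof -
    have "(\<lambda>q. Poly_Mapping.lookup (Poly_Mapping.single s c) q when e + s = l + q) = (\<lambda>q. (if l = e then c else 0) when q = s)"
      by (auto simp: fun_eq_iff lookup_single when_def)
    then show ?thesis by (simp only: Sum_any_when_equal) (simp add: when_def)
  qed
  then show ?thesis by (simp add: lookup_mult mult_when)
qed

lemma lookup_mult_single_eq_0:
  fixes p :: "'k::cancel_comm_monoid_add \<Rightarrow>\<^sub>0 'r::comm_semiring_1"
  assumes "\<And>l. e \<noteq> l + s"
  shows "Poly_Mapping.lookup (p * Poly_Mapping.single s c) e = 0"
proof -
  have "(\<lambda>q. Poly_Mapping.lookup (Poly_Mapping.single s c) q when e = l + q) = (\<lambda>q. 0)" for l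
    using assms by (auto simp: fun_eq_iff lookup_single when_def)
  then show ?thesis by (simp only: lookup_mult) simp
qed

text \<open>
  The common form of the fields $x^+(u_i)$ and $x^+(z+u_i)$ and their analogues in the tensor square.
\<close>

definition field_series :: "(nat \<Rightarrow> ('b::comm_monoid_add \<Rightarrow>\<^sub>0 complex) fls) \<Rightarrow> nat + nat \<Rightarrow> 'b gseries" where
  "field_series f x = gsubst (\<lambda>c. fps_const (f c)) (gvar x)"

lemma gvar_power: "gvar x ^ c = Poly_Mapping.single (Poly_Mapping.single x c) 1"
  by (induction c) (simp_all add: gvar_def mult_single flip: single_add)

lemma field_series_nth: "fps_nth (field_series f x) c = Poly_Mapping.single (Poly_Mapping.single x c) (fps_const (f c))"
  by (simp add: field_series_def gsubst_def gvar_power mult_single)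

lemma exp_coeff_mult_field_series:
  fixes K :: "'b::comm_monoid_add gseries"
  assumes "Poly_Mapping.lookup e x = 0"
  shows "exp_coeff (K * field_series f x) (e + Poly_Mapping.single x n)
       = (\<Sum>i\<le>n. exp_coeff K (e + Poly_Mapping.single x i) * fps_const (f (n - i)))"
proof -
  define d where "d = total_degree e"
  have deg: "total_degree (e + Poly_Mapping.single x i) = d + i" for i
    by (simp add: d_def total_degree_add total_degree_single)
  have *: "Poly_Mapping.lookup (fps_nth K (d + n - j) * Poly_Mapping.single (Poly_Mapping.single x j) (fps_const (f j))) (e + Poly_Mapping.single x n)
     = (if j \<le> n then exp_coeff K (e + Poly_Mapping.single x (n - j)) * fps_const (f j) else 0)" for j
  proof (cases "j \<le> n")
    case True
    have "e + Poly_Mapping.single x n = (e + Poly_Mapping.single x (n - j)) + Poly_Mapping.single x j"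
      using True by (simp add: add.assoc flip: single_add)
    then show ?thesis using True by (simp only: lookup_mult_single) (simp add: exp_coeff_def deg)
  next
    case False
    have "e + Poly_Mapping.single x n \<noteq> l + Poly_Mapping.single x j" for l
    proof
      assume "e + Poly_Mapping.single x n = l + Poly_Mapping.single x j"
      from arg_cong[OF this, of "\<lambda>p. Poly_Mapping.lookup p x"] show False using assms False by (simp add: lookup_add)
    qed
    then show ?thesis using False by (simp add: lookup_mult_single_eq_0)
  qed
  have "exp_coeff (K * field_series f x) (e + Poly_Mapping.single x n)
     = (\<Sum>j\<le>d+n. Poly_Mapping.lookup (fps_nth K (d + n - j) * Poly_Mapping.single (Poly_Mapping.single x j) (fps_const (f j))) (e + Poly_Mapping.single x n))"
    unfolding exp_coeff_def deg mult.commute[of K] fps_mult_nth lookup_sum field_series_nth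
    by (simp add: mult.commute atLeast0AtMost)
  also have "\<dots> = (\<Sum>j\<le>n. exp_coeff K (e + Poly_Mapping.single x (n - j)) * fps_const (f j))"
    unfolding * by (rule sum.mono_neutral_cong_right) auto
  also have "\<dots> = (\<Sum>i\<le>n. exp_coeff K (e + Poly_Mapping.single x i) * fps_const (f (n - i)))"
    by (rule sum.reindex_bij_witness[of _ "\<lambda>i. n - i" "\<lambda>i. n - i"]) auto
  finally show ?thesis .
qed

text \<open>
  Given the coefficients \<open>\<phi>\<close> of a series in many variables, this is the coefficient, at the exponents \<open>e\<close>
  of the other variables, of the series in which the variable $V_j$ is replaced by $w + a_j h$ for
  all $j < J$.
\<close>

primrec multi_subst_shift :: "(nat \<Rightarrow> 'a::comm_ring_1) \<Rightarrow> (nat \<Rightarrow> nat + nat) \<Rightarrow> nat \<Rightarrow> (exponents \<Rightarrow> 'a fps) \<Rightarrow> exponents \<Rightarrow> 'a fps fps" where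
  "multi_subst_shift a V 0 \<phi> e = fps_const (\<phi> e)"
| "multi_subst_shift a V (Suc J) \<phi> e = subst_shift (a J) (\<lambda>n. multi_subst_shift a V J \<phi> (e + Poly_Mapping.single (V J) n))"

lemma subst_shift_sum: "subst_shift a (\<lambda>n. \<Sum>i\<in>S. \<psi> i n) = (\<Sum>i\<in>S. subst_shift a (\<psi> i))"
proof (rule fps_ext, rule fps_ext)
  fix q N
  have "fps_nth (fps_nth (subst_shift a (\<lambda>n. \<Sum>i\<in>S. \<psi> i n)) q) N
    = (\<Sum>c\<le>q. \<Sum>d\<le>N. \<Sum>i\<in>S. of_nat ((c + d) choose c) * a ^ d * fps_nth (fps_nth (\<psi> i (c + d)) (q - c)) (N - d))"
    by (simp add: subst_shift_nth fps_sum_nth sum_distrib_left)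
  also have "\<dots> = (\<Sum>c\<le>q. \<Sum>i\<in>S. \<Sum>d\<le>N. of_nat ((c + d) choose c) * a ^ d * fps_nth (fps_nth (\<psi> i (c + d)) (q - c)) (N - d))"
    by (rule sum.cong[OF refl], rule sum.swap)
  also have "\<dots> = (\<Sum>i\<in>S. \<Sum>c\<le>q. \<Sum>d\<le>N. of_nat ((c + d) choose c) * a ^ d * fps_nth (fps_nth (\<psi> i (c + d)) (q - c)) (N - d))"
    by (rule sum.swap)
  finally show "fps_nth (fps_nth (subst_shift a (\<lambda>n. \<Sum>i\<in>S. \<psi> i n)) q) N = fps_nth (fps_nth (\<Sum>i\<in>S. subst_shift a (\<psi> i)) q) N"
    by (simp add: subst_shift_nth fps_sum_nth)
qed

lemma multi_subst_shift_linear: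
  assumes "\<And>s :: exponents. Poly_Mapping.keys s \<subseteq> V ` {..<J} \<Longrightarrow> \<phi> (e + s) = (\<Sum>i\<in>S. \<phi>' (e' i + s) * fps_const (c i))"
  shows "multi_subst_shift a V J \<phi> e = (\<Sum>i\<in>S. multi_subst_shift a V J \<phi>' (e' i) * fps_const (fps_const (c i)))"
  using assms
proof (induction J arbitrary: e e')
  case 0
  show ?case using 0[of 0] by (intro fps_ext) (simp add: fps_sum_nth)
next
  case (Suc J)
  have *: "multi_subst_shift a V J \<phi> (e + Poly_Mapping.single (V J) n)
     = (\<Sum>i\<in>S. multi_subst_shift a V J \<phi>' (e' i + Poly_Mapping.single (V J) n) * fps_const (fps_const (c i)))" for n
  proof (rule Suc.IH)
    fix s :: exponents assume "Poly_Mapping.keys s \<subseteq> V ` {..<J}"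
    then have "Poly_Mapping.keys (Poly_Mapping.single (V J) n + s) \<subseteq> V ` {..<Suc J}"
      using Poly_Mapping.keys_add[of "Poly_Mapping.single (V J) n" s] by (auto simp: lessThan_Suc split: if_splits)
    from Suc.prems[OF this] show "\<phi> (e + Poly_Mapping.single (V J) n + s) = (\<Sum>i\<in>S. \<phi>' (e' i + Poly_Mapping.single (V J) n + s) * fps_const (c i))"
      by (simp add: add.assoc)
  qed
  show ?case by (simp add: * subst_shift_sum subst_shift_mult_const)
qed

text \<open>
  Specialisation turns the factor $f(V_j)$ into $f(w + a_j h)$. The assumption on \<open>e\<close> says that it involves only
  the other variables.
\<close>

lemma multi_subst_shift_field_product:
  assumes "inj_on V {..<J}" "\<And>j. j < J \<Longrightarrow> Poly_Mapping.lookup e (V j) = 0"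
  shows "multi_subst_shift a V J (exp_coeff (K * (\<Prod>j<J. field_series f (V j)))) e
       = multi_subst_shift a V J (exp_coeff K) e * (\<Prod>j<J. taylor (a j) f)"
  using assms
proof (induction J arbitrary: K e)
  case (Suc J)
  have V: "V J \<noteq> V j" if "j < J" for j using Suc.prems(1) that by (auto dest: inj_onD)
  \<comment> \<open>The factor for $V_J$ is absorbed into $K$ to apply the induction hypothesis, and is then split off by the
    outer substitution.\<close>
  have IH: "multi_subst_shift a V J (exp_coeff (K * (\<Prod>j<Suc J. field_series f (V j)))) (e + Poly_Mapping.single (V J) n)
     = multi_subst_shift a V J (exp_coeff (K * field_series f (V J))) (e + Poly_Mapping.single (V J) n) * (\<Prod>j<J. taylor (a j) f)" for n
  proof -
    have "multi_subst_shift a V J (exp_coeff (K * field_series f (V J) * (\<Prod>j<J. field_series f (V j)))) (e + Poly_Mapping.single (V J) n)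
     = multi_subst_shift a V J (exp_coeff (K * field_series f (V J))) (e + Poly_Mapping.single (V J) n) * (\<Prod>j<J. taylor (a j) f)"
      by (rule Suc.IH) (use Suc.prems V in \<open>auto simp: lookup_add lookup_single when_def intro: inj_on_subset\<close>)
    then show ?thesis by (simp add: mult_ac)
  qed
  have conv: "multi_subst_shift a V J (exp_coeff (K * field_series f (V J))) (e + Poly_Mapping.single (V J) n)
      = (\<Sum>i\<le>n. multi_subst_shift a V J (exp_coeff K) (e + Poly_Mapping.single (V J) i) * fps_const (fps_const (f (n - i))))" for n
  proof (rule multi_subst_shift_linear)
    fix s :: exponents assume s: "Poly_Mapping.keys s \<subseteq> V ` {..<J}"
    have "V J \<notin> Poly_Mapping.keys s" using s V by fastforce
    then have "Poly_Mapping.lookup (e + s) (V J) = 0" using Suc.prems(2)[of J] by (simp add: lookup_add in_keys_iff)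
    from exp_coeff_mult_field_series[OF this, of K f n]
    show "exp_coeff (K * field_series f (V J)) (e + Poly_Mapping.single (V J) n + s)
       = (\<Sum>i\<le>n. exp_coeff K (e + Poly_Mapping.single (V J) i + s) * fps_const (f (n - i)))"
      by (simp add: add.assoc add.commute[of s])
  qed
  show ?case
    unfolding multi_subst_shift.simps IH conv subst_shift_mult_const subst_shift_convolution[where f = f]
    by (simp add: mult_ac)
qed simp

lemma fls_const_single_of_nat_power:
  "fls_const (Poly_Mapping.single (0::'b::comm_monoid_add) (of_nat n * a ^ d)) = of_nat n * fls_const (Poly_Mapping.single 0 (a::complex)) ^ d"
  by (simp add: single_0_of_nat_mult_power fls_const_power fls_of_nat flip: fls_const_mult_const)

text \<open>
  The expansion $x^+(w+ah) = \sum_n (w+ah)^n x_n$ is carried through $\Phi$, term by term and with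
  continuity in $h$.
\<close>

lemma h_linear_mult_xplus_shift:
  assumes \<Phi>: "h_linear \<Phi>"
  shows "Abs_fps (\<lambda>q. \<Phi> (fps_nth (G * xplus_shift a) q)) =
    subst_shift (fls_const (Poly_Mapping.single 0 a)) (\<lambda>n. Abs_fps (\<lambda>q. \<Phi> (fps_nth (G * fps_const (fps_const (xgen n))) q)))"
proof (rule fps_ext, rule fps_ext)
  fix q N
  have *: "fps_nth (\<Phi> (y * fps_nth (xplus_shift a) c)) N = 
    (\<Sum>d\<le>N. of_nat ((c + d) choose c) * fls_const (Poly_Mapping.single 0 a) ^ d * fps_nth (\<Phi> (y * fps_const (xgen (c + d)))) (N - d))" for y c
  proof -
    define s where "s d = Poly_Mapping.single (0::mon) (of_nat ((c + d) choose c) * a ^ d)" for d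
    \<comment> \<open>For the coefficient of $h^N$ the terms with $d \le N$ suffice.\<close>
    have "fps_nth (fps_nth (xplus_shift a) c) i = fps_nth (\<Sum>d\<le>N. fps_X ^ d * (fps_const (s d) * fps_const (xgen (c + d)))) i" if "i < Suc N" for i
    proof -
      have "fps_nth (\<Sum>d\<le>N. fps_X ^ d * (fps_const (s d) * fps_const (xgen (c + d)))) i
         = (\<Sum>d\<le>N. if d = i then s i * xgen (c + i) else 0)"
        unfolding fps_sum_nth by (rule sum.cong) (auto simp: fps_X_power_mult_nth)
      then show ?thesis using that by (simp add: xplus_shift_def s_def)
    qed
    then have "fps_nth (\<Phi> (y * fps_nth (xplus_shift a) c)) N = fps_nth (\<Phi> (y * (\<Sum>d\<le>N. fps_X ^ d * (fps_const (s d) * fps_const (xgen (c + d)))))) N"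
      by (intro h_linear_cong[OF h_linear_mult_left[OF \<Phi>, of y], where N = "Suc N"]) simp_all
    also have "\<dots> = (\<Sum>d\<le>N. fls_const (Poly_Mapping.single 0 (of_nat ((c + d) choose c) * a ^ d)) * fps_nth (\<Phi> (y * fps_const (xgen (c + d)))) (N - d))"
      unfolding h_linear_sum[OF h_linear_mult_left[OF \<Phi>]] h_linear_X_power[OF h_linear_mult_left[OF \<Phi>]] 
        h_linear_scale[OF h_linear_mult_left[OF \<Phi>]] s_def fps_sum_nth
      by (rule sum.cong) (auto simp: fps_X_power_mult_nth simp del: fps_const_mult)
    finally show ?thesis by (simp add: fls_const_single_of_nat_power)
  qed
  have "fps_nth (G * xplus_shift a) q = (\<Sum>c\<le>q. fps_nth G (q - c) * fps_nth (xplus_shift a) c)"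
    unfolding mult.commute[of G] fps_mult_nth atLeast0AtMost by (simp add: mult.commute)
  then show "fps_nth (fps_nth (Abs_fps (\<lambda>q. \<Phi> (fps_nth (G * xplus_shift a) q))) q) N = 
     fps_nth (fps_nth (subst_shift (fls_const (Poly_Mapping.single 0 a)) (\<lambda>n. Abs_fps (\<lambda>q. \<Phi> (fps_nth (G * fps_const (fps_const (xgen n))) q)))) q) N"
    by (simp add: h_linear_sum[OF \<Phi>] fps_sum_nth * subst_shift_nth)
qed

lemma xmon_snoc: "xmon (l @ [n]) = xmon l * fps_const (xgen n)"
  by (simp add: xmon_def)

text \<open>
  If the values of $\Phi$ on the monomials $y\,x_{l_0} \cdots x_{l_{J-1}}$ are the coefficients of a series in
  $V_0, \ldots, V_{J-1}$, then its values on the coefficients of $y \prod_j x^+(w+a_jh)$ are obtained by the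
  specialisation $V_j = w + a_jh$.
\<close>

lemma h_linear_mult_xplus_shift_product:
  assumes \<Phi>: "h_linear \<Phi>"
    and "\<And>l. length l = J \<Longrightarrow> \<Phi> (y * xmon l) = \<phi> (e + (\<Sum>j<J. Poly_Mapping.single (V j) (l ! j)))"
  shows "Abs_fps (\<lambda>q. \<Phi> (fps_nth (fps_const y * (\<Prod>j<J. xplus_shift (a j))) q)) =
    multi_subst_shift (\<lambda>j. fls_const (Poly_Mapping.single 0 (a j))) V J \<phi> e"
  using assms(2)
proof (induction J arbitrary: y e)
  case 0
  then have "\<Phi> y = \<phi> e" by (simp add: xmon_def)
  then show ?case by (auto simp: fps_eq_iff h_linear_0[OF \<Phi>])
next
  case (Suc J)
  have *: "Abs_fps (\<lambda>q. \<Phi> (fps_nth (fps_const y * (\<Prod>j<J. xplus_shift (a j)) * fps_const (fps_const (xgen n))) q))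
      = multi_subst_shift (\<lambda>j. fls_const (Poly_Mapping.single 0 (a j))) V J \<phi> (e + Poly_Mapping.single (V J) n)" for n
  proof -
    have "fps_const y * (\<Prod>j<J. xplus_shift (a j)) * fps_const (fps_const (xgen n)) = fps_const (y * fps_const (xgen n)) * (\<Prod>j<J. xplus_shift (a j))"
      by (simp add: mult_ac flip: fps_const_mult)
    moreover have "\<Phi> (y * fps_const (xgen n) * xmon l) = \<phi> (e + Poly_Mapping.single (V J) n + (\<Sum>j<J. Poly_Mapping.single (V j) (l ! j)))"
      if l: "length l = J" for l
      using Suc.prems[of "l @ [n]"] l by (simp add: xmon_snoc mult_ac nth_append add_ac)
    ultimately show ?thesis using Suc.IH[of "y * fps_const (xgen n)" "e + Poly_Mapping.single (V J) n"] by metis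
  qed
  show ?case
    unfolding prod.lessThan_Suc mult.assoc[symmetric] multi_subst_shift.simps h_linear_mult_xplus_shift[OF \<Phi>] *
    by (rule refl)
qed

text \<open>
  If the values of $\Phi$ are the coefficients of $K \prod_j f(V_j)$, then the specialisation $V_j = w + jth$ has the
  factor $\prod_j f(w+jth)$, and this alone puts it into the ideal.
\<close>

lemma h_linear_mult_xt_mem:
  assumes \<Phi>: "h_linear \<Phi>" and L: "closed_ideal L"
    and V: "inj V" "\<And>j. Poly_Mapping.lookup e (V j) = 0"
    and \<Phi>_eq: "\<And>l. length l = Suc k \<Longrightarrow> \<Phi> (y * xmon l) = 
       exp_coeff (K * (\<Prod>j<Suc k. field_series f (V j))) (e + (\<Sum>j<Suc k. Poly_Mapping.single (V j) (l ! j)))"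
    and f: "\<And>q. fps_nth (\<Prod>j<Suc k. taylor (fls_const (Poly_Mapping.single 0 (of_nat j * t))) f) q \<in> L"
  shows "\<Phi> (y * xt k t q) \<in> L"
proof -
  define P where "P = (\<Prod>j<Suc k. taylor (fls_const (Poly_Mapping.single 0 (of_nat j * t))) f)"
  define C where "C = multi_subst_shift (\<lambda>j. fls_const (Poly_Mapping.single 0 (of_nat j * t))) V (Suc k) (exp_coeff K) e"
  have "\<Phi> (y * xt k t q) = fps_nth (Abs_fps (\<lambda>q. \<Phi> (fps_nth (fps_const y * (\<Prod>j<Suc k. xplus_shift (of_nat j * t))) q))) q"
    by (simp add: xt_def lessThan_Suc_atMost del: prod.lessThan_Suc)
  also have "\<dots> = fps_nth (C * P) q"
  proof -
    have "Abs_fps (\<lambda>q. \<Phi> (fps_nth (fps_const y * (\<Prod>j<Suc k. xplus_shift (of_nat j * t))) q))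
      = multi_subst_shift (\<lambda>j. fls_const (Poly_Mapping.single 0 (of_nat j * t))) V (Suc k)
          (exp_coeff (K * (\<Prod>j<Suc k. field_series f (V j)))) e"
      by (rule h_linear_mult_xplus_shift_product[OF \<Phi> \<Phi>_eq])
    also have "\<dots> = C * P"
      unfolding C_def P_def by (rule multi_subst_shift_field_product) (use V in \<open>auto intro: inj_on_subset\<close>)
    finally show ?thesis by simp
  qed
  also have "\<dots> = (\<Sum>i=0..q. fps_nth C i * fps_nth P (q - i))" by (rule fps_mult_nth)
  also have "\<dots> \<in> L" by (intro closed_ideal.sum[OF L] closed_ideal.mult[OF L]) (simp only: P_def f)
  finally show ?thesis .
qed


section \<open>Slices and Laurent polynomials in the tensor square\<close>

text \<open>
  The algebra homomorphism induced by a map of monomials. For $\beta \mapsto (0, \beta)$ it is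
  $b \mapsto 1 \otimes b$.
\<close>

definition push_keys :: "('a \<Rightarrow> 'b) \<Rightarrow> ('a \<Rightarrow>\<^sub>0 complex) \<Rightarrow> ('b \<Rightarrow>\<^sub>0 complex)" where
  "push_keys \<kappa> p = (\<Sum>a\<in>Poly_Mapping.keys p. Poly_Mapping.single (\<kappa> a) (Poly_Mapping.lookup p a))"

lemma push_keys_superset:
  "finite A \<Longrightarrow> Poly_Mapping.keys p \<subseteq> A \<Longrightarrow> push_keys \<kappa> p = (\<Sum>a\<in>A. Poly_Mapping.single (\<kappa> a) (Poly_Mapping.lookup p a))"
  unfolding push_keys_def by (rule sum.mono_neutral_left) (auto simp: in_keys_iff)

lemma push_keys_add: "push_keys \<kappa> (p + q) = push_keys \<kappa> p + push_keys \<kappa> q"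
  using Poly_Mapping.keys_add[of p q]
  by (simp add: push_keys_superset[of "Poly_Mapping.keys p \<union> Poly_Mapping.keys q"] lookup_add single_add sum.distrib)

lemma push_keys_0: "push_keys \<kappa> 0 = 0"
  by (simp add: push_keys_def)

lemma push_keys_single: "push_keys \<kappa> (Poly_Mapping.single a c) = Poly_Mapping.single (\<kappa> a) c"
  by (simp add: push_keys_superset[of "{a}"])

lemma push_keys_sum: "push_keys \<kappa> (sum f A) = (\<Sum>a\<in>A. push_keys \<kappa> (f a))"
  by (induction A rule: infinite_finite_induct) (simp_all add: push_keys_0 push_keys_add)

lemma poly_mapping_mult_eq_sum_single:
  "p * q = (\<Sum>a\<in>Poly_Mapping.keys p. \<Sum>b\<in>Poly_Mapping.keys q.
     Poly_Mapping.single (a + b) (Poly_Mapping.lookup p a * Poly_Mapping.lookup q b))"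
proof -
  have "p * q = (\<Sum>a\<in>Poly_Mapping.keys p. Poly_Mapping.single a (Poly_Mapping.lookup p a)) *
      (\<Sum>b\<in>Poly_Mapping.keys q. Poly_Mapping.single b (Poly_Mapping.lookup q b))"
    by (simp only: poly_mapping_sum_single)
  then show ?thesis by (simp add: sum_product mult_single)
qed

lemma ring_homomorphism_push_keys:
  fixes \<kappa> :: "'a::comm_monoid_add \<Rightarrow> 'b::comm_monoid_add"
  assumes "\<And>a b. \<kappa> (a + b) = \<kappa> a + \<kappa> b" "\<kappa> 0 = 0"
  shows "ring_homomorphism (push_keys \<kappa>)"
proof
  fix p q :: "'a \<Rightarrow>\<^sub>0 complex"
  show "push_keys \<kappa> (p * q) = push_keys \<kappa> p * push_keys \<kappa> q"
    unfolding poly_mapping_mult_eq_sum_single[of p q]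
    by (simp add: push_keys_sum push_keys_single assms(1) push_keys_def[of \<kappa> p] push_keys_def[of \<kappa> q] sum_product mult_single)
  show "push_keys \<kappa> 1 = 1"
    using push_keys_single[of \<kappa> 0 1] by (simp add: assms(2))
qed (rule push_keys_add)

lemma map_key_sum: "inj \<iota> \<Longrightarrow> Poly_Mapping.map_key \<iota> (sum f A) = (\<Sum>a\<in>A. Poly_Mapping.map_key \<iota> (f a))"
  by (induction A rule: infinite_finite_induct) (simp_all add: map_key_plus)

lemma map_key_single_eq_0:
  "inj \<iota> \<Longrightarrow> s \<notin> range \<iota> \<Longrightarrow> Poly_Mapping.map_key \<iota> (Poly_Mapping.single s c) = 0"
  by (rule poly_mapping_eqI) (auto simp: lookup_map_key lookup_single when_def)

text \<open>
  For $\iota = (\alpha, -)$ and $\kappa = (0, -)$ this is the linearity of the slice at $\alpha$ with respect to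
  the second tensor factor.
\<close>

lemma map_key_mult_push_keys:
  fixes \<iota> :: "'a::comm_monoid_add \<Rightarrow> 'b::comm_monoid_add"
  assumes inj: "inj \<iota>" and shift: "\<And>x b. \<iota> (x + b) = \<iota> x + \<kappa> b" and ran: "\<And>x s b. \<iota> x = s + \<kappa> b \<Longrightarrow> s \<in> range \<iota>"
  shows "Poly_Mapping.map_key \<iota> (p * push_keys \<kappa> q) = Poly_Mapping.map_key \<iota> p * q"
proof -
  have s: "Poly_Mapping.map_key \<iota> (Poly_Mapping.single (s + \<kappa> b) (c * d)) = Poly_Mapping.map_key \<iota> (Poly_Mapping.single s c) * Poly_Mapping.single b d"
    for s b and c d :: complex
  proof (cases "s \<in> range \<iota>")
    case True
    then obtain x where "s = \<iota> x" by blast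
    then show ?thesis using inj by (simp add: mult_single flip: shift)
  next
    case False
    then have "s + \<kappa> b \<notin> range \<iota>" using ran by (metis rangeE)
    then show ?thesis using False by (simp add: map_key_single_eq_0[OF inj])
  qed
  have "p * push_keys \<kappa> q = (\<Sum>a\<in>Poly_Mapping.keys p. \<Sum>b\<in>Poly_Mapping.keys q.
     Poly_Mapping.single (a + \<kappa> b) (Poly_Mapping.lookup p a * Poly_Mapping.lookup q b))"
    by (subst poly_mapping_sum_single[of p, symmetric], subst push_keys_def) (simp add: sum_product mult_single)
  then have "Poly_Mapping.map_key \<iota> (p * push_keys \<kappa> q) = (\<Sum>a\<in>Poly_Mapping.keys p. \<Sum>b\<in>Poly_Mapping.keys q.
     Poly_Mapping.map_key \<iota> (Poly_Mapping.single a (Poly_Mapping.lookup p a)) * Poly_Mapping.single b (Poly_Mapping.lookup q b))"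
    by (simp add: map_key_sum[OF inj] s)
  also have "\<dots> = Poly_Mapping.map_key \<iota> (\<Sum>a\<in>Poly_Mapping.keys p. Poly_Mapping.single a (Poly_Mapping.lookup p a)) *
      (\<Sum>b\<in>Poly_Mapping.keys q. Poly_Mapping.single b (Poly_Mapping.lookup q b))"
    by (simp add: map_key_sum[OF inj] sum_product)
  finally show ?thesis by (simp only: poly_mapping_sum_single)
qed

text \<open>
  The smallest closed ideal that contains the image of \<open>I\<close>; for the embedding of a tensor factor it is the
  completed $V \otimes I$, respectively $I \otimes V$.
\<close>

definition extended_ideal :: "('a \<Rightarrow> 'b::comm_monoid_add) \<Rightarrow> 'a hmod set \<Rightarrow> 'b hmod set" where
  "extended_ideal \<kappa> I = hclosure {v. \<exists>n. fps_X ^ n * v \<in> finite_sums {r * map_fps (push_keys \<kappa>) w | r w. w \<in> I}}"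

lemma closed_ideal_extended_ideal: "closed_ideal (extended_ideal \<kappa> I)"
  unfolding extended_ideal_def
proof (rule closed_ideal_hclosure_saturation)
  fix r v assume "v \<in> finite_sums {r * map_fps (push_keys \<kappa>) w | r w. w \<in> I}"
  then show "r * v \<in> finite_sums {r * map_fps (push_keys \<kappa>) w | r w. w \<in> I}"
  proof (induction rule: finite_sums_induct)
    case (add v w)
    obtain s u where "v = s * map_fps (push_keys \<kappa>) u" "u \<in> I" using add(1) by auto
    then have "r * v = (r * s) * map_fps (push_keys \<kappa>) u" "u \<in> I" by (simp_all add: mult.assoc)
    then have "r * v \<in> {r * map_fps (push_keys \<kappa>) w | r w. w \<in> I}" by blast
    then show ?case unfolding distrib_left by (rule finite_sums_add[OF finite_sums_base add(2)])
  qed (simp add: finite_sums_0)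
qed (simp_all add: finite_sums_0 finite_sums_add)

lemma push_keys_mem_extended_ideal:
  assumes "w \<in> I" shows "map_fps (push_keys \<kappa>) w \<in> extended_ideal \<kappa> I"
proof -
  have "1 * map_fps (push_keys \<kappa>) w \<in> {r * map_fps (push_keys \<kappa>) w | r w. w \<in> I}" using assms by blast
  then have "fps_X ^ 0 * map_fps (push_keys \<kappa>) w \<in> finite_sums {r * map_fps (push_keys \<kappa>) w | r w. w \<in> I}"
    by (intro finite_sums_base) simp
  then have "map_fps (push_keys \<kappa>) w \<in> {v. \<exists>n. fps_X ^ n * v \<in> finite_sums {r * map_fps (push_keys \<kappa>) w | r w. w \<in> I}}"
    unfolding mem_Collect_eq by (rule exI)
  then show ?thesis unfolding extended_ideal_def by (rule subsetD[OF subset_hclosure])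
qed

lemma map_key_mem_of_extended_ideal:
  fixes \<iota> :: "'a::comm_monoid_add \<Rightarrow> 'b::comm_monoid_add"
  assumes inj: "inj \<iota>" and shift: "\<And>x b. \<iota> (x + b) = \<iota> x + \<kappa> b" and ran: "\<And>x s b. \<iota> x = s + \<kappa> b \<Longrightarrow> s \<in> range \<iota>"
    and I: "closed_ideal I" and v: "v \<in> extended_ideal \<kappa> I"
  shows "map_fps (Poly_Mapping.map_key \<iota>) v \<in> I"
proof -
  interpret closed_ideal I by fact
  let ?s = "map_fps (Poly_Mapping.map_key \<iota>) :: 'b hmod \<Rightarrow> 'a hmod"
  have s0: "?s 0 = 0" by (rule fps_ext) (simp add: map_key_zero[OF inj])
  have sa: "?s (x + y) = ?s x + ?s y" for x y by (rule fps_ext) (simp add: map_key_plus[OF inj])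
  have sX: "?s (fps_X * x) = fps_X * ?s x" for x by (rule fps_ext) (simp add: map_key_zero[OF inj])
  have sXn: "?s (fps_X ^ n * x) = fps_X ^ n * ?s x" for n x by (induction n) (simp_all add: sX mult.assoc)
  have sm: "?s (r * map_fps (push_keys \<kappa>) w) = ?s r * w" for r w
    by (rule fps_ext) (simp add: fps_mult_nth map_key_sum[OF inj] map_key_mult_push_keys[OF inj shift ran])
  have fin: "?s x \<in> I" if "x \<in> finite_sums {r * map_fps (push_keys \<kappa>) w | r w. w \<in> I}" for x
    using that
  proof (induction rule: finite_sums_induct)
    case (add v w)
    then show ?case by (auto simp: sa sm intro!: closed_ideal.add[OF I] mult)
  qed (simp add: s0 zero)
  show ?thesis
  proof (rule limit)
    fix N
    have "\<exists>a\<in>{v. \<exists>n. fps_X ^ n * v \<in> finite_sums {r * map_fps (push_keys \<kappa>) w | r w. w \<in> I}}. \<forall>n<N. fps_nth v n = fps_nth a n"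
      using v by (simp only: extended_ideal_def hclosure_def mem_Collect_eq)
    then obtain a l where a: "fps_X ^ l * a \<in> finite_sums {r * map_fps (push_keys \<kappa>) w | r w. w \<in> I}" "\<forall>n<N. fps_nth v n = fps_nth a n"
      by blast
    have "?s a \<in> I" using fin[OF a(1)] unfolding sXn by (rule divide_X_power)
    then show "\<exists>a\<in>I. \<forall>n<N. fps_nth (?s v) n = fps_nth a n" using a(2) by (intro bexI[of _ "?s a"]) simp_all
  qed
qed

text \<open>
  The coefficient of every power of $h$ is a Laurent polynomial in $z$. This is a finiteness condition: a Laurent
  series with coefficients in $V \otimes I$ need not lie in $V \otimes I((z))$, as infinitely many
  basis vectors of $V$ may occur in it.
\<close>

definition z_finite :: "'a hlaurent \<Rightarrow> bool" where
  "z_finite F \<longleftrightarrow> (\<forall>N. finite {m. fls_nth (fps_nth F N) m \<noteq> 0})"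

lemma z_finite_0: "z_finite 0" by (simp add: z_finite_def)

lemma z_finite_add: "z_finite F \<Longrightarrow> z_finite G \<Longrightarrow> z_finite (F + G)"
  unfolding z_finite_def
proof
  fix N assume "\<forall>N. finite {m. fls_nth (fps_nth F N) m \<noteq> 0}" "\<forall>N. finite {m. fls_nth (fps_nth G N) m \<noteq> 0}"
  then have "finite ({m. fls_nth (fps_nth F N) m \<noteq> 0} \<union> {m. fls_nth (fps_nth G N) m \<noteq> 0})" by blast
  then show "finite {m. fls_nth (fps_nth (F + G) N) m \<noteq> 0}" by (rule rev_finite_subset) auto
qed

lemma z_finite_uminus: "z_finite F \<Longrightarrow> z_finite (- (F :: 'a::comm_monoid_add hlaurent))"
  by (simp add: z_finite_def)

lemma z_finite_sum: "(\<And>a. a \<in> A \<Longrightarrow> z_finite (f a)) \<Longrightarrow> z_finite (sum f A)"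
  by (induction A rule: infinite_finite_induct) (simp_all add: z_finite_0 z_finite_add)

lemma z_finite_fps_const_fls_const: "z_finite (fps_const (fls_const p))"
  unfolding z_finite_def by (auto intro: rev_finite_subset[of "{0}"])

lemma z_finite_1: "z_finite (1 :: 'a::comm_monoid_add hlaurent)"
  using z_finite_fps_const_fls_const[of 1] by simp

lemma finite_support_fls_mult:
  fixes f g :: "'r::comm_ring_1 fls"
  assumes "finite {m. fls_nth f m \<noteq> 0}" "finite {m. fls_nth g m \<noteq> 0}"
  shows "finite {m. fls_nth (f * g) m \<noteq> 0}"
proof (rule rev_finite_subset[OF finite_imageI[OF finite_cartesian_product[OF assms]]])
  show "{m. fls_nth (f * g) m \<noteq> 0} \<subseteq> (\<lambda>(i, j). i + j) ` ({m. fls_nth f m \<noteq> 0} \<times> {m. fls_nth g m \<noteq> 0})"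
  proof
    fix m assume "m \<in> {m. fls_nth (f * g) m \<noteq> 0}"
    moreover have "fls_nth (f * g) m = (\<Sum>i\<in>{fls_subdegree f..m - fls_subdegree g}. fls_nth f i * fls_nth g (m - i))"
      by (rule fls_times_nth)
    ultimately have "(\<Sum>i\<in>{fls_subdegree f..m - fls_subdegree g}. fls_nth f i * fls_nth g (m - i)) \<noteq> 0"
      by simp
    then obtain i where "fls_nth f i * fls_nth g (m - i) \<noteq> 0" 
      by (rule sum.not_neutral_contains_not_neutral)
    then have "fls_nth f i \<noteq> 0" "fls_nth g (m - i) \<noteq> 0" by (metis mult_zero_left, metis mult_zero_right)
    then show "m \<in> (\<lambda>(i, j). i + j) ` ({m. fls_nth f m \<noteq> 0} \<times> {m. fls_nth g m \<noteq> 0})"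
      by (intro image_eqI[of _ _ "(i, m - i)"]) auto
  qed
qed

lemma finite_support_fls_sum:
  "(\<And>a. a \<in> A \<Longrightarrow> finite {m. fls_nth (f a) m \<noteq> 0}) \<Longrightarrow> finite {m. fls_nth (sum f A) m \<noteq> 0}"
proof (induction A rule: infinite_finite_induct)
  case (insert a A)
  have "finite ({m. fls_nth (f a) m \<noteq> 0} \<union> {m. fls_nth (sum f A) m \<noteq> 0})"
    by (rule finite_UnI[OF insert.prems insert.IH[OF insert.prems]]) simp_all
  moreover have "{m. fls_nth (sum f (insert a A)) m \<noteq> 0} \<subseteq> {m. fls_nth (f a) m \<noteq> 0} \<union> {m. fls_nth (sum f A) m \<noteq> 0}"
    unfolding sum.insert[OF insert.hyps(1,2)] by auto
  ultimately show ?case by (rule rev_finite_subset)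
qed simp_all

lemma z_finite_mult:
  fixes F G :: "'a::comm_monoid_add hlaurent"
  assumes "z_finite F" "z_finite G" shows "z_finite (F * G)"
  unfolding z_finite_def fps_mult_nth
  by (intro allI finite_support_fls_sum finite_support_fls_mult; rule assms[unfolded z_finite_def, rule_format])

definition z_finite_coeffs :: "'b::comm_monoid_add gseries \<Rightarrow> bool" where
  "z_finite_coeffs F \<longleftrightarrow> (\<forall>c e. z_finite (Poly_Mapping.lookup (fps_nth F c) e))"

lemma z_finite_lookup_mult:
  fixes p q :: "'k::comm_monoid_add \<Rightarrow>\<^sub>0 'b::comm_monoid_add hlaurent"
  assumes "\<And>e. z_finite (Poly_Mapping.lookup p e)" "\<And>e. z_finite (Poly_Mapping.lookup q e)"
  shows "z_finite (Poly_Mapping.lookup (p * q) e)"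
  unfolding poly_mapping_mult_eq_sum_single[of p q] lookup_sum lookup_single when_def
  using assms by (auto intro!: z_finite_sum z_finite_mult z_finite_0)

lemma z_finite_coeffs_mult: "z_finite_coeffs F \<Longrightarrow> z_finite_coeffs G \<Longrightarrow> z_finite_coeffs (F * G)"
  unfolding z_finite_coeffs_def fps_mult_nth lookup_sum by (auto intro!: z_finite_sum z_finite_lookup_mult)

lemma z_finite_lookup_single: "z_finite F \<Longrightarrow> z_finite (Poly_Mapping.lookup (Poly_Mapping.single s F) e)"
  by (simp add: lookup_single when_def z_finite_0)

lemma z_finite_coeffs_1: "z_finite_coeffs 1"
  unfolding z_finite_coeffs_def 
  by (auto simp: fps_one_nth z_finite_0 z_finite_1 z_finite_lookup_single simp flip: single_one)

lemma z_finite_coeffs_prod: "(\<And>a. a \<in> A \<Longrightarrow> z_finite_coeffs (f a)) \<Longrightarrow> z_finite_coeffs (prod f A)"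
  by (induction A rule: infinite_finite_induct) (simp_all add: z_finite_coeffs_1 z_finite_coeffs_mult)

lemma z_finite_coeffs_gsubst:
  assumes w: "\<And>e. z_finite (Poly_Mapping.lookup w e)" and a: "\<And>c. z_finite (a c)"
  shows "z_finite_coeffs (gsubst a w)"
proof -
  have "z_finite (Poly_Mapping.lookup (w ^ c) e)" for c e
    by (induction c arbitrary: e) (auto simp: w z_finite_1 z_finite_lookup_single intro: z_finite_lookup_mult simp flip: single_one)
  then show ?thesis unfolding z_finite_coeffs_def gsubst_def
    by (auto intro!: z_finite_lookup_mult z_finite_lookup_single a)
qed

lemma z_finite_gvar: "z_finite (Poly_Mapping.lookup (gvar x) e)"
  by (simp add: gvar_def z_finite_lookup_single z_finite_1)

lemma z_finite_coeffs_gfield: "z_finite_coeffs (gfield y x)"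
  unfolding gfield_def by (intro z_finite_coeffs_gsubst z_finite_gvar z_finite_fps_const_fls_const)

text \<open>
  The power $h^l$ comes with $z^{-l-c}$ only, where $c$ is the degree in the variables.
\<close>

lemma z_finite_coeffs_geval: "z_finite_coeffs (geval \<phi> i j)"
  unfolding geval_def
proof (rule z_finite_coeffs_gsubst, goal_cases)
  case (1 e)
  show ?case
    using z_finite_add[OF z_finite_gvar[of "Inl i" e] z_finite_uminus[OF z_finite_gvar[of "Inr j" e]]]
    by (simp add: lookup_minus)
next
  case (2 c)
  show ?case unfolding z_finite_def fps_nth_Abs_fps
  proof (intro allI finite_support_fls_mult, goal_cases)
    case (1 N)
    show ?case by (rule rev_finite_subset[of "{0}"]) auto
  next
    case (2 N)
    show ?case by (rule rev_finite_subset[of "{- int N - int c}"]) auto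
  qed
qed

lemma z_finite_coeffs_S_series: "z_finite_coeffs (S_series k n m)"
  unfolding S_series_def g_nm_def p_nm_def power2_eq_square
  by (intro z_finite_coeffs_mult z_finite_coeffs_prod z_finite_coeffs_geval z_finite_coeffs_gfield)

lemma z_finite_hlinear_ext:
  fixes B :: "'a \<Rightarrow> 'b::comm_monoid_add hlaurent"
  assumes "\<And>a. z_finite (B a)"
  shows "z_finite (hlinear_ext B v)"
  unfolding z_finite_def hlinear_ext_def fps_nth_Abs_fps
proof (intro allI finite_support_fls_sum finite_support_fls_mult)
  fix N n a
  show "finite {m. fls_nth (fls_const (Poly_Mapping.single (0::'b) (Poly_Mapping.lookup (fps_nth v n) a))) m \<noteq> 0}"
    by (rule rev_finite_subset[of "{0}"]) auto
  show "finite {m. fls_nth (fps_nth (B a) (N - n)) m \<noteq> 0}" using assms[of a] by (simp add: z_finite_def)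
qed

lemma z_finite_S_W: "z_finite (S_W k v)"
proof -
  have "z_finite (case ab of (\<alpha>, \<beta>) \<Rightarrow> gcoeff (mon_list \<alpha>) (mon_list \<beta>) (S_series k (length (mon_list \<alpha>)) (length (mon_list \<beta>))))" for ab
    using z_finite_coeffs_S_series by (auto simp: gcoeff_def z_finite_coeffs_def split: prod.split)
  then show ?thesis unfolding S_W_def by (rule z_finite_hlinear_ext)
qed


section \<open>The operators $Y$ and $\mathcal{S}$ preserve $\mathcal{I}^t$\<close>

definition z_monomial :: "int \<Rightarrow> 'a hmod \<Rightarrow> 'a hlaurent" where
  "z_monomial m v = Abs_fps (\<lambda>N. fls_shift (- m) (fls_const (fps_nth v N)))"

lemma zcoeff_z_monomial: "zcoeff (z_monomial m v) m' = (if m' = m then v else 0)"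
  by (auto simp: z_monomial_def zcoeff_nth fps_eq_iff)

lemma z_monomial_mem_laurent_over:
  assumes "v \<in> I" "0 \<in> I"
  shows "z_monomial m v \<in> laurent_over I"
proof -
  define f where "f n m' = (if n = (0::nat) \<and> m' = m then v else 0)" for n m'
  have "zcoeff (z_monomial m v) m' = hsum (\<lambda>n. f n m')" for m'
  proof (rule fps_ext)
    fix N
    have "fps_nth (hsum (\<lambda>n. f n m')) N = (\<Sum>n\<in>{0}. fps_nth (f n m') (N - n))"
      unfolding hsum_def fps_nth_Abs_fps by (rule sum.mono_neutral_right) (auto simp: f_def)
    then show "fps_nth (zcoeff (z_monomial m v) m') N = fps_nth (hsum (\<lambda>n. f n m')) N"
      by (simp add: zcoeff_z_monomial f_def)
  qed
  moreover have "f n m' \<in> I" for n m' using assms by (simp add: f_def)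
  moreover have "\<exists>M. \<forall>m'<M. f n m' = 0" for n by (intro exI[of _ m]) (simp add: f_def)
  ultimately show ?thesis unfolding laurent_over_def by blast
qed

lemma z_finite_bound:
  assumes "z_finite F"
  obtains M where "finite M" "\<And>n m. n < N \<Longrightarrow> m \<notin> M \<Longrightarrow> fls_nth (fps_nth F n) m = 0"
proof
  show "finite (\<Union>n<N. {m. fls_nth (fps_nth F n) m \<noteq> 0})"
    using assms unfolding z_finite_def by (intro finite_UN_I) simp_all
qed auto

lemma z_monomial_expansion_nth:
  fixes F :: "'c hlaurent" and w :: "'x \<Rightarrow> int \<Rightarrow> 'c hmod"
  assumes "finite M" "\<And>m. m \<notin> M \<Longrightarrow> fls_nth (fps_nth F n) m = 0"
    and "\<And>m. m \<in> M \<Longrightarrow> fls_nth (fps_nth F n) m = fps_nth (\<Sum>x\<in>A. w x m) n"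
  shows "fps_nth F n = fps_nth (\<Sum>m\<in>M. \<Sum>x\<in>A. z_monomial m (w x m)) n"
proof (rule fls_eqI)
  fix m
  have "fls_nth (fps_nth (\<Sum>m\<in>M. \<Sum>x\<in>A. z_monomial m (w x m)) n) m = (\<Sum>m'\<in>M. \<Sum>x\<in>A. fps_nth (zcoeff (z_monomial m' (w x m')) m) n)"
    by (simp add: fps_sum_nth fls_nth_sum zcoeff_nth)
  also have "\<dots> = (\<Sum>m'\<in>M. if m' = m then \<Sum>x\<in>A. fps_nth (w x m) n else 0)"
    by (intro sum.cong refl) (simp add: zcoeff_z_monomial)
  also have "\<dots> = fls_nth (fps_nth F n) m"
    using assms by (simp add: fps_sum_nth)
  finally show "fls_nth (fps_nth F n) m = fls_nth (fps_nth (\<Sum>m\<in>M. \<Sum>x\<in>A. z_monomial m (w x m)) n) m" ..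
qed

lemma hcoeff_basis: "hcoeff (fps_const (Poly_Mapping.single a 1)) b = (if a = b then 1 else 0)"
  by (auto simp: fps_eq_iff hcoeff_nth lookup_single when_def fps_one_nth)

lemma hcoeff_sum: "hcoeff (sum f A) a = (\<Sum>x\<in>A. hcoeff (f x) a)"
  by (induction A rule: infinite_finite_induct) (auto simp: hcoeff_add, auto simp: hcoeff_def fps_eq_iff)

lemma hcoeff_0: "hcoeff 0 a = 0"
  by (simp add: fps_eq_iff hcoeff_nth)

lemma htensor_0: "htensor v 0 = 0" "htensor 0 v = 0"
  by (rule hcoeff_eqI, clarify, simp add: hcoeff_htensor hcoeff_0)+

lemma hcoeff_map_key: "inj \<iota> \<Longrightarrow> hcoeff (map_fps (Poly_Mapping.map_key \<iota>) v) a = hcoeff v (\<iota> a)"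
  by (simp add: fps_eq_iff hcoeff_nth lookup_map_key)

text \<open>
  Modulo $h^N$ such an $F$ is the finite sum of the tensors $e_\alpha \otimes z^m s$, where $s$ is the slice of
  the coefficient of $z^m$ at $\alpha$.
\<close>

lemma tensor_laurentI_right:
  fixes F :: "('a \<times> 'b) hlaurent"
  assumes F: "z_finite F" and I: "0 \<in> I"
    and slice: "\<And>\<alpha> m. map_fps (Poly_Mapping.map_key (Pair \<alpha>)) (zcoeff F m) \<in> I"
  shows "F \<in> tensor_laurent UNIV (laurent_over I)"
  unfolding tensor_laurent_def hclosure_def mem_Collect_eq
proof
  fix N
  obtain M where M: "finite M" "\<And>n m. n < N \<Longrightarrow> m \<notin> M \<Longrightarrow> fls_nth (fps_nth F n) m = 0"
    using z_finite_bound[OF F] by blast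
  define A where "A = (\<Union>n<N. \<Union>m\<in>M. fst ` Poly_Mapping.keys (fls_nth (fps_nth F n) m))"
  have A: "finite A" unfolding A_def using M(1) by simp
  define s where "s \<alpha> m = map_fps (Poly_Mapping.map_key (Pair \<alpha>)) (zcoeff F m)" for \<alpha> m
  define w where "w \<alpha> m = htensor (fps_const (Poly_Mapping.single \<alpha> 1)) (s \<alpha> m)" for \<alpha> m
  define G where "G = (\<Sum>m\<in>M. \<Sum>\<alpha>\<in>A. z_monomial m (w \<alpha> m))"
  have "fps_nth F n = fps_nth G n" if n: "n < N" for n
    unfolding G_def
  proof (rule z_monomial_expansion_nth)
    fix m assume m: "m \<in> M"
    show "fls_nth (fps_nth F n) m = fps_nth (\<Sum>\<alpha>\<in>A. w \<alpha> m) n"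
    proof (rule poly_mapping_eqI, clarify)
      fix \<alpha> \<beta>
      have "Poly_Mapping.lookup (fps_nth (\<Sum>\<alpha>\<in>A. w \<alpha> m) n) (\<alpha>, \<beta>) = fps_nth (\<Sum>\<alpha>'\<in>A. hcoeff (w \<alpha>' m) (\<alpha>, \<beta>)) n"
        by (simp add: hcoeff_sum flip: hcoeff_nth)
      also have "(\<Sum>\<alpha>'\<in>A. hcoeff (w \<alpha>' m) (\<alpha>, \<beta>)) = (\<Sum>\<alpha>'\<in>A. if \<alpha>' = \<alpha> then hcoeff (zcoeff F m) (\<alpha>, \<beta>) else 0)"
        by (rule sum.cong) (auto simp: w_def s_def hcoeff_htensor hcoeff_basis hcoeff_map_key inj_on_def)
      also have "fps_nth \<dots> n = (if \<alpha> \<in> A then Poly_Mapping.lookup (fls_nth (fps_nth F n) m) (\<alpha>, \<beta>) else 0)"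
        using A by (simp add: hcoeff_nth zcoeff_nth)
      also have "\<dots> = Poly_Mapping.lookup (fls_nth (fps_nth F n) m) (\<alpha>, \<beta>)"
        using n m by (force simp: A_def in_keys_iff)
      finally show "Poly_Mapping.lookup (fls_nth (fps_nth F n) m) (\<alpha>, \<beta>) = Poly_Mapping.lookup (fps_nth (\<Sum>\<alpha>\<in>A. w \<alpha> m) n) (\<alpha>, \<beta>)" ..
    qed
  qed (use M n in auto)
  moreover have "G \<in> finite_sums {F. \<exists>a\<in>UNIV. \<exists>f\<in>laurent_over I. \<forall>m. zcoeff F m = htensor a (zcoeff f m)}"
    unfolding G_def
  proof (intro finite_sums_sum finite_sums_base CollectI bexI allI)
    fix m \<alpha> m'
    show "zcoeff (z_monomial m (w \<alpha> m)) m' = htensor (fps_const (Poly_Mapping.single \<alpha> 1)) (zcoeff (z_monomial m (s \<alpha> m)) m')"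
      by (simp add: zcoeff_z_monomial w_def htensor_0)
    show "z_monomial m (s \<alpha> m) \<in> laurent_over I"
      unfolding s_def by (intro z_monomial_mem_laurent_over slice I)
  qed simp
  ultimately show "\<exists>a\<in>finite_sums {F. \<exists>a\<in>UNIV. \<exists>f\<in>laurent_over I. \<forall>m. zcoeff F m = htensor a (zcoeff f m)}.
      \<forall>n<N. fps_nth F n = fps_nth a n" by blast
qed

lemma tensor_laurentI_left:
  fixes F :: "('a \<times> 'b) hlaurent"
  assumes F: "z_finite F"
    and slice: "\<And>\<beta> m. map_fps (Poly_Mapping.map_key (\<lambda>\<alpha>. (\<alpha>, \<beta>))) (zcoeff F m) \<in> I"
  shows "F \<in> tensor_laurent I (laurent_over UNIV)"
  unfolding tensor_laurent_def hclosure_def mem_Collect_eq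
proof
  fix N
  obtain M where M: "finite M" "\<And>n m. n < N \<Longrightarrow> m \<notin> M \<Longrightarrow> fls_nth (fps_nth F n) m = 0"
    using z_finite_bound[OF F] by blast
  define A where "A = (\<Union>n<N. \<Union>m\<in>M. snd ` Poly_Mapping.keys (fls_nth (fps_nth F n) m))"
  have A: "finite A" unfolding A_def using M(1) by simp
  define s where "s \<beta> m = map_fps (Poly_Mapping.map_key (\<lambda>\<alpha>. (\<alpha>, \<beta>))) (zcoeff F m)" for \<beta> m
  define w where "w \<beta> m = htensor (s \<beta> m) (fps_const (Poly_Mapping.single \<beta> 1))" for \<beta> m
  define G where "G = (\<Sum>m\<in>M. \<Sum>\<beta>\<in>A. z_monomial m (w \<beta> m))"
  have "fps_nth F n = fps_nth G n" if n: "n < N" for n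
    unfolding G_def
  proof (rule z_monomial_expansion_nth)
    fix m assume m: "m \<in> M"
    show "fls_nth (fps_nth F n) m = fps_nth (\<Sum>\<beta>\<in>A. w \<beta> m) n"
    proof (rule poly_mapping_eqI, clarify)
      fix \<alpha> \<beta>
      have "Poly_Mapping.lookup (fps_nth (\<Sum>\<beta>\<in>A. w \<beta> m) n) (\<alpha>, \<beta>) = fps_nth (\<Sum>\<beta>'\<in>A. hcoeff (w \<beta>' m) (\<alpha>, \<beta>)) n"
        by (simp add: hcoeff_sum flip: hcoeff_nth)
      also have "(\<Sum>\<beta>'\<in>A. hcoeff (w \<beta>' m) (\<alpha>, \<beta>)) = (\<Sum>\<beta>'\<in>A. if \<beta>' = \<beta> then hcoeff (zcoeff F m) (\<alpha>, \<beta>) else 0)"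
        by (rule sum.cong) (auto simp: w_def s_def hcoeff_htensor hcoeff_basis hcoeff_map_key inj_on_def)
      also have "fps_nth \<dots> n = (if \<beta> \<in> A then Poly_Mapping.lookup (fls_nth (fps_nth F n) m) (\<alpha>, \<beta>) else 0)"
        using A by (simp add: hcoeff_nth zcoeff_nth)
      also have "\<dots> = Poly_Mapping.lookup (fls_nth (fps_nth F n) m) (\<alpha>, \<beta>)"
        using n m by (force simp: A_def in_keys_iff)
      finally show "Poly_Mapping.lookup (fls_nth (fps_nth F n) m) (\<alpha>, \<beta>) = Poly_Mapping.lookup (fps_nth (\<Sum>\<beta>\<in>A. w \<beta> m) n) (\<alpha>, \<beta>)" ..
    qed
  qed (use M n in auto)
  moreover have "G \<in> finite_sums {F. \<exists>a\<in>I. \<exists>f\<in>laurent_over UNIV. \<forall>m. zcoeff F m = htensor a (zcoeff f m)}"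
    unfolding G_def
  proof (intro finite_sums_sum finite_sums_base CollectI bexI allI)
    fix m \<beta> m'
    show "zcoeff (z_monomial m (w \<beta> m)) m' = htensor (s \<beta> m) (zcoeff (z_monomial m (fps_const (Poly_Mapping.single \<beta> 1))) m')"
      by (simp add: zcoeff_z_monomial w_def htensor_0)
    show "z_monomial m (fps_const (Poly_Mapping.single \<beta> 1)) \<in> laurent_over UNIV"
      by (intro z_monomial_mem_laurent_over UNIV_I)
    show "s \<beta> m \<in> I" unfolding s_def by (rule slice)
  qed
  ultimately show "\<exists>a\<in>finite_sums {F. \<exists>a\<in>I. \<exists>f\<in>laurent_over UNIV. \<forall>m. zcoeff F m = htensor a (zcoeff f m)}.
      \<forall>n<N. fps_nth F n = fps_nth a n" by blast
qed

lemma prod_lessThan_add: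
  fixes m n :: nat
  shows "(\<Prod>j<m+n. f j) = (\<Prod>j<m. f j) * (\<Prod>j<n. f (m + j) :: 'a::comm_monoid_mult)"
  by (induction n) (simp_all add: mult.assoc)

lemma sum_lessThan_add:
  fixes m n :: nat
  shows "(\<Sum>j<m+n. f j) = (\<Sum>j<m. f j) + (\<Sum>j<n. f (m + j) :: 'a::comm_monoid_add)"
  by (induction n) (simp_all add: add.assoc)

lemma product_factor_out:
  fixes p :: "'a::comm_ring_1"
  shows "\<exists>K. a * (b * (c * p)) = K * p" "\<exists>K. a * ((b * p) * c) = K * p"
  by (rule exI[of _ "a * b * c"], simp add: mult_ac)+

lemma expo_append_right: "expo rs (ss @ l) = expo rs ss + (\<Sum>j<length l. Poly_Mapping.single (Inr (length ss + j)) (l ! j))"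
  by (simp add: expo_def sum_lessThan_add nth_append add.assoc)

lemma expo_append_left: "expo (rs @ l) ss = expo rs ss + (\<Sum>j<length l. Poly_Mapping.single (Inl (length rs + j)) (l ! j))"
  unfolding expo_def length_append sum_lessThan_add by (simp add: nth_append add_ac)

lemma xmon_append: "xmon (rs @ l) = xmon rs * xmon l"
  by (simp add: xmon_def)

lemma gfield_eq_field_series: "gfield y x = field_series (\<lambda>c. fls_const (y c)) x"
  by (simp add: gfield_def field_series_def)

lemma gfield_shift_eq_field_series:
  "gfield_shift y x = field_series (\<lambda>c. fps_to_fls (Abs_fps (\<lambda>d. of_nat ((c + d) choose c) * y (c + d)))) x"
  by (simp add: gfield_shift_def field_series_def)

lemma h_linear_Y_W: "h_linear (Y_W c)" unfolding Y_W_def by (rule h_linear_hlinear_ext)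

lemma h_linear_S_W: "h_linear (S_W c)" unfolding S_W_def by (rule h_linear_hlinear_ext)

text \<open>
  Here \<open>D n m\<close> stands for the series with $n$ variables $u$ and $m$ variables $v$. The monomial is extended by $k+1$
  factors, whose variables are the last ones.
\<close>

lemma right_factor_mem:
  fixes D :: "nat \<Rightarrow> nat \<Rightarrow> 'b::comm_monoid_add gseries"
  assumes T: "h_linear T" and L: "closed_ideal L"
    and T_eq: "\<And>rs ss :: nat list. T (htensor (xmon rs) (xmon ss)) = gcoeff rs ss (D (length rs) (length ss))"
    and D: "\<And>n m. \<exists>K. D n (m + Suc k) = K * (\<Prod>j<Suc k. field_series f (Inr (m + j)))"
    and f: "\<And>q. fps_nth (\<Prod>j<Suc k. taylor (fls_const (Poly_Mapping.single 0 (of_nat j * t))) f) q \<in> L"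
  shows "T ` tensor_sub UNIV (I_cal k t) \<subseteq> L"
proof (rule h_linear_tensor_I_cal_right[OF T L])
  fix rs ss :: "nat list" and q
  obtain K where K: "D (length rs) (length ss + Suc k) = K * (\<Prod>j<Suc k. field_series f (Inr (length ss + j)))"
    using D by blast
  show "T (htensor (xmon rs) (xmon ss * xt k t q)) \<in> L"
  proof (rule h_linear_mult_xt_mem[OF h_linear_htensor_right[OF T] L _ _ _ f])
    fix l :: "nat list" assume l: "length l = Suc k"
    then have "T (htensor (xmon rs) (xmon ss * xmon l)) = gcoeff rs (ss @ l) (D (length rs) (length ss + Suc k))"
      using T_eq[of rs "ss @ l"] by (simp add: xmon_append)
    then show "T (htensor (xmon rs) (xmon ss * xmon l)) = exp_coeff (K * (\<Prod>j<Suc k. field_series f (Inr (length ss + j))))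
        (expo rs ss + (\<Sum>j<Suc k. Poly_Mapping.single (Inr (length ss + j)) (l ! j)))"
      by (simp only: K gcoeff_eq_exp_coeff expo_append_right l)
  qed (auto intro!: injI simp: lookup_expo)
qed

lemma left_factor_mem:
  fixes D :: "nat \<Rightarrow> nat \<Rightarrow> 'b::comm_monoid_add gseries"
  assumes T: "h_linear T" and L: "closed_ideal L"
    and T_eq: "\<And>rs ss :: nat list. T (htensor (xmon rs) (xmon ss)) = gcoeff rs ss (D (length rs) (length ss))"
    and D: "\<And>n m. \<exists>K. D (n + Suc k) m = K * (\<Prod>j<Suc k. field_series f (Inl (n + j)))"
    and f: "\<And>q. fps_nth (\<Prod>j<Suc k. taylor (fls_const (Poly_Mapping.single 0 (of_nat j * t))) f) q \<in> L"
  shows "T ` tensor_sub (I_cal k t) UNIV \<subseteq> L"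
proof (rule h_linear_tensor_I_cal_left[OF T L])
  fix rs ss :: "nat list" and q
  obtain K where K: "D (length rs + Suc k) (length ss) = K * (\<Prod>j<Suc k. field_series f (Inl (length rs + j)))"
    using D by blast
  show "T (htensor (xmon rs * xt k t q) (xmon ss)) \<in> L"
  proof (rule h_linear_mult_xt_mem[OF h_linear_htensor_left[OF T] L _ _ _ f])
    fix l :: "nat list" assume l: "length l = Suc k"
    then have "T (htensor (xmon rs * xmon l) (xmon ss)) = gcoeff (rs @ l) ss (D (length rs + Suc k) (length ss))"
      using T_eq[of "rs @ l" ss] by (simp add: xmon_append)
    then show "T (htensor (xmon rs * xmon l) (xmon ss)) = exp_coeff (K * (\<Prod>j<Suc k. field_series f (Inl (length rs + j))))
        (expo rs ss + (\<Sum>j<Suc k. Poly_Mapping.single (Inl (length rs + j)) (l ! j)))"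
      by (simp only: K gcoeff_eq_exp_coeff expo_append_left l)
  qed (auto intro!: injI simp: lookup_expo)
qed

lemma Y_W_right: "Y_W c ` tensor_sub UNIV (I_cal k t) \<subseteq> zlift (I_cal k t)"
proof (rule right_factor_mem[OF h_linear_Y_W closed_ideal_zlift[OF closed_ideal_I_cal] Y_W_formula])
  show "\<exists>K. Y_series c n (m + Suc k) = K * (\<Prod>j<Suc k. field_series (\<lambda>r. fls_const (xgen r)) (Inr (m + j)))" for n m
    unfolding Y_series_def prod_lessThan_add[of _ m "Suc k"] gfield_eq_field_series by (rule product_factor_out)
  have "ring_homomorphism (\<lambda>p. p)" by unfold_locales simp_all
  then show "fps_nth (\<Prod>j<Suc k. taylor (fls_const (Poly_Mapping.single 0 (of_nat j * t))) (\<lambda>r. fls_const (xgen r))) q \<in> zlift (I_cal k t)" for q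
    by (rule prod_taylor_const_mem_zlift) (simp_all add: closed_ideal.zero[OF closed_ideal_I_cal] xt_in_I_cal map_fps_def fps_nth_inverse)
qed

lemma Y_W_left: "Y_W c ` tensor_sub (I_cal k t) UNIV \<subseteq> zlift (I_cal k t)"
proof (rule left_factor_mem[OF h_linear_Y_W closed_ideal_zlift[OF closed_ideal_I_cal] Y_W_formula])
  show "\<exists>K. Y_series c (n + Suc k) m = K * (\<Prod>j<Suc k. field_series 
     (\<lambda>r. fps_to_fls (Abs_fps (\<lambda>d. of_nat ((r + d) choose r) * xgen (r + d)))) (Inl (n + j)))" for n m
    unfolding Y_series_def prod_lessThan_add[of _ n "Suc k"] gfield_shift_eq_field_series
    by (rule product_factor_out)
  show "fps_nth (\<Prod>j<Suc k. taylor (fls_const (Poly_Mapping.single 0 (of_nat j * t)))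
      (\<lambda>r. fps_to_fls (Abs_fps (\<lambda>d. of_nat ((r + d) choose r) * xgen (r + d))))) q \<in> zlift (I_cal k t)" for q
    by (rule prod_taylor_translate_mem_zlift[OF closed_ideal_I_cal xt_in_I_cal])
qed

lemma S_W_right: "S_W c ` tensor_sub UNIV (I_cal k t) \<subseteq> tensor_laurent UNIV (laurent_over (I_cal k t))"
proof -
  define J where "J = extended_ideal (Pair (0::mon)) (I_cal k t)"
  have x: "xgenR r = push_keys (Pair 0) (xgen r)" for r
    by (simp add: xgenR_def xgen_def push_keys_single)
  have "S_W c ` tensor_sub UNIV (I_cal k t) \<subseteq> zlift J"
  proof (rule right_factor_mem[OF h_linear_S_W closed_ideal_zlift S_W_formula])
    show "closed_ideal J" unfolding J_def by (rule closed_ideal_extended_ideal)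
    show "\<exists>K. S_series c n (m + Suc k) = K * (\<Prod>j<Suc k. field_series (\<lambda>r. fls_const (push_keys (Pair 0) (xgen r))) (Inr (m + j)))" for n m
      unfolding S_series_def prod_lessThan_add[of _ m "Suc k"] gfield_eq_field_series x by (rule product_factor_out)
    have "ring_homomorphism (push_keys (Pair (0::mon)) :: (mon \<Rightarrow>\<^sub>0 complex) \<Rightarrow> _)"
      by (rule ring_homomorphism_push_keys) (simp_all add: zero_prod_def)
    then show "fps_nth (\<Prod>j<Suc k. taylor (fls_const (Poly_Mapping.single 0 (of_nat j * t))) (\<lambda>r. fls_const (push_keys (Pair (0::mon)) (xgen r)))) q \<in> zlift J" for q
      by (rule prod_taylor_const_mem_zlift)
        (simp_all add: push_keys_single zero_prod_def closed_ideal.zero[OF closed_ideal_extended_ideal] J_def push_keys_mem_extended_ideal xt_in_I_cal)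
  qed
  moreover have "F \<in> tensor_laurent UNIV (laurent_over (I_cal k t))" if "z_finite F" "F \<in> zlift J" for F
  proof (rule tensor_laurentI_right[OF that(1) closed_ideal.zero[OF closed_ideal_I_cal]])
    show "map_fps (Poly_Mapping.map_key (Pair \<alpha>)) (zcoeff F m) \<in> I_cal k t" for \<alpha> m
      by (rule map_key_mem_of_extended_ideal[of _ "Pair 0"])
        (use that(2) in \<open>auto simp: zlift_def J_def closed_ideal_I_cal intro: injI\<close>)
  qed
  ultimately show ?thesis using z_finite_S_W by blast
qed

lemma S_W_left: "S_W c ` tensor_sub (I_cal k t) UNIV \<subseteq> tensor_laurent (I_cal k t) (laurent_over UNIV)"
proof -
  let ?\<kappa> = "\<lambda>\<alpha>. (\<alpha>, 0 :: mon)"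
  define J where "J = extended_ideal ?\<kappa> (I_cal k t)"
  have x: "xgenL r = push_keys ?\<kappa> (xgen r)" for r
    by (simp add: xgenL_def xgen_def push_keys_single)
  have "S_W c ` tensor_sub (I_cal k t) UNIV \<subseteq> zlift J"
  proof (rule left_factor_mem[OF h_linear_S_W closed_ideal_zlift S_W_formula])
    show "closed_ideal J" unfolding J_def by (rule closed_ideal_extended_ideal)
    show "\<exists>K. S_series c (n + Suc k) m = K * (\<Prod>j<Suc k. field_series (\<lambda>r. fls_const (push_keys ?\<kappa> (xgen r))) (Inl (n + j)))" for n m
      unfolding S_series_def prod_lessThan_add[of _ n "Suc k"] gfield_eq_field_series x
      by (rule product_factor_out)
    have "ring_homomorphism (push_keys ?\<kappa> :: (mon \<Rightarrow>\<^sub>0 complex) \<Rightarrow> _)"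
      by (rule ring_homomorphism_push_keys) (simp_all add: zero_prod_def)
    then show "fps_nth (\<Prod>j<Suc k. taylor (fls_const (Poly_Mapping.single 0 (of_nat j * t))) (\<lambda>r. fls_const (push_keys ?\<kappa> (xgen r)))) q \<in> zlift J" for q
      by (rule prod_taylor_const_mem_zlift)
        (simp_all add: push_keys_single zero_prod_def closed_ideal.zero[OF closed_ideal_extended_ideal] J_def push_keys_mem_extended_ideal xt_in_I_cal)
  qed
  moreover have "F \<in> tensor_laurent (I_cal k t) (laurent_over UNIV)" if "z_finite F" "F \<in> zlift J" for F
  proof (rule tensor_laurentI_left[OF that(1)])
    show "map_fps (Poly_Mapping.map_key (\<lambda>\<alpha>. (\<alpha>, \<beta>))) (zcoeff F m) \<in> I_cal k t" for \<beta> m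
      by (rule map_key_mem_of_extended_ideal[of _ ?\<kappa>])
        (use that(2) in \<open>auto simp: zlift_def J_def closed_ideal_I_cal intro: injI\<close>)
  qed
  ultimately show ?thesis using z_finite_S_W by blast
qed

theorem proposition4p5:
  fixes k :: nat and t :: complex
  assumes "k > 0"
  shows "qva_ideal (Y_W (of_nat k)) (S_W (of_nat k)) (I_cal k t)"
  unfolding qva_ideal_def
proof (intro conjI)
  note I = closed_ideal_I_cal[of k t]
  show "hsubmodule (I_cal k t)" by (rule hsubmodule_closed_ideal[OF I])
  show "topologically_free (I_cal k t)" by (rule topologically_free_closed_ideal[OF I])
  show "I_cal k t = hsat (I_cal k t)" by (rule hsat_closed_ideal[OF I])
  show "Y_W (of_nat k) ` tensor_sub UNIV (I_cal k t) \<subseteq> laurent_over (I_cal k t)"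
    by (rule subset_trans[OF Y_W_right zlift_subset_laurent_over_closed_ideal[OF I]])
  show "Y_W (of_nat k) ` tensor_sub (I_cal k t) UNIV \<subseteq> laurent_over (I_cal k t)"
    by (rule subset_trans[OF Y_W_left zlift_subset_laurent_over_closed_ideal[OF I]])
  show "S_W (of_nat k) ` tensor_sub UNIV (I_cal k t) \<subseteq> tensor_laurent UNIV (laurent_over (I_cal k t))"
    by (rule S_W_right)
  show "S_W (of_nat k) ` tensor_sub (I_cal k t) UNIV \<subseteq> tensor_laurent (I_cal k t) (laurent_over UNIV)"
    by (rule S_W_left)
qed

end
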